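(* Let $(R,\mathfrak m)$ be a commutative Artinian local ring and let $M$ be a finitely generated $R$-module with $\mathfrak m^2M=0$. If $\operatorname{Ext}^i_R(M, M\oplus R)=0$ for all $i$ with $0<i\le \max\{3, \nu(M), \nu(\mathfrak m M)\}$, then $M$ is free.
   Context: $\nu(L)$ denotes the minimal number of generators of a finitely generated $R$-module $L$. *)

theory Defs
  imports
    "HOL-Analysis.Product_Vector"
    "HOL-Library.Poly_Mapping"
    "HOL-Library.FuncSet"
begin

text \<open>
  A commutative ring is a type of class \<^class>\<open>comm_ring_1\<close>, and a module over it is a scalar
  multiplication satisfying \<^locale>\<open>module\<close>.  The ideals are the submodules of the
  ring regarded as a module over itself.
\<close>

abbreviation ideal :: "'a::comm_ring_1 set \<Rightarrow> bool"
  where "ideal \<equiv> module.subspace (*)"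

definition maximal_ideal :: "'a::comm_ring_1 set \<Rightarrow> bool"
  where "maximal_ideal \<mm> \<longleftrightarrow>
    ideal \<mm> \<and> \<mm> \<noteq> UNIV \<and> (\<forall>J. ideal J \<and> \<mm> \<subseteq> J \<longrightarrow> J = \<mm> \<or> J = UNIV)"

locale artinian_local_ring =
  fixes \<mm> :: "'a::comm_ring_1 set"
  assumes maximal: "maximal_ideal \<mm>"
    and local: "\<And>J :: 'a set. maximal_ideal J \<Longrightarrow> J = \<mm>"
    and artinian: "\<And>I :: nat \<Rightarrow> 'a set. \<lbrakk>\<And>n. ideal (I n); decseq I\<rbrakk> \<Longrightarrow> \<exists>k. \<forall>n\<ge>k. I n = I k"

definition finitely_generated :: "('a::comm_ring_1 \<Rightarrow> 'b::ab_group_add \<Rightarrow> 'b) \<Rightarrow> 'b set \<Rightarrow> bool"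
  where "finitely_generated s N \<longleftrightarrow> (\<exists>B. finite B \<and> module.span s B = N)"

definition min_gens :: "('a::comm_ring_1 \<Rightarrow> 'b::ab_group_add \<Rightarrow> 'b) \<Rightarrow> 'b set \<Rightarrow> nat"
  where "min_gens s N = (LEAST n. \<exists>B. finite B \<and> card B = n \<and> module.span s B = N)"

definition free_module :: "('a::comm_ring_1 \<Rightarrow> 'b::ab_group_add \<Rightarrow> 'b) \<Rightarrow> bool"
  where "free_module s \<longleftrightarrow>
    (\<exists>B. \<not> module.dependent s B \<and> module.span s B = UNIV)"

text \<open>The submodule \<open>I N\<close>; for \<open>s = (*)\<close> it is the product of two ideals.\<close>

definition ideal_mult ::
    "('a::comm_ring_1 \<Rightarrow> 'b::ab_group_add \<Rightarrow> 'b) \<Rightarrow> 'a set \<Rightarrow> 'b set \<Rightarrow> 'b set"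
  where "ideal_mult s I N = module.span s {s a x | a x. a \<in> I \<and> x \<in> N}"


section \<open>The standard free resolution of a module\<close>

text \<open>
  We compute Ext from a functorial free resolution
  \<open>\<cdots> \<rightarrow> F\<^sub>2 \<rightarrow> F\<^sub>1 \<rightarrow> F\<^sub>0 \<rightarrow> M \<rightarrow> 0\<close>.  The basis of \<open>F\<^sub>0\<close> is the set of all elements of \<open>M\<close>,
  and the basis of \<open>F\<^bsub>n+1\<^esub>\<close> is the set of all formal linear combinations of basis elements
  of \<open>F\<^sub>n\<close> whose value is a cycle.  The recursive datatype lets the bases of all the \<open>F\<^sub>n\<close>, and
  hence all the \<open>F\<^sub>n\<close>, live in one type.
\<close>

datatype ('a, 'b) gen = Elem 'b | Rel "('a \<times> ('a, 'b) gen) list"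

definition scale_free :: "'a::comm_ring_1 \<Rightarrow> ('g \<Rightarrow>\<^sub>0 'a) \<Rightarrow> ('g \<Rightarrow>\<^sub>0 'a)"
  where "scale_free r = Poly_Mapping.map ((*) r)"

definition linear_extension ::
    "('a::comm_ring_1 \<Rightarrow> 'c::ab_group_add \<Rightarrow> 'c) \<Rightarrow> ('g \<Rightarrow> 'c) \<Rightarrow> ('g \<Rightarrow>\<^sub>0 'a) \<Rightarrow> 'c"
  where "linear_extension s \<phi> p =
    (\<Sum>g\<in>Poly_Mapping.keys p. s (Poly_Mapping.lookup p g) (\<phi> g))"

definition combination :: "('a::comm_ring_1 \<times> 'g) list \<Rightarrow> ('g \<Rightarrow>\<^sub>0 'a)"
  where "combination xs = (\<Sum>(a, g)\<leftarrow>xs. Poly_Mapping.single g a)"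

definition boundary ::
    "(('a::comm_ring_1, 'b) gen \<Rightarrow>\<^sub>0 'a) \<Rightarrow> (('a, 'b) gen \<Rightarrow>\<^sub>0 'a)"
  where "boundary =
    linear_extension scale_free (\<lambda>g. case g of Elem x \<Rightarrow> 0 | Rel xs \<Rightarrow> combination xs)"

definition augmentation ::
    "('a::comm_ring_1 \<Rightarrow> 'b::ab_group_add \<Rightarrow> 'b) \<Rightarrow> (('a, 'b) gen \<Rightarrow>\<^sub>0 'a) \<Rightarrow> 'b"
  where "augmentation s =
    linear_extension s (\<lambda>g. case g of Elem x \<Rightarrow> x | Rel xs \<Rightarrow> 0)"

primrec gens ::
    "('a::comm_ring_1 \<Rightarrow> 'b::ab_group_add \<Rightarrow> 'b) \<Rightarrow> nat \<Rightarrow> ('a, 'b) gen set"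
where
  "gens s 0 = range Elem"
| "gens s (Suc n) = {Rel xs | xs. snd ` set xs \<subseteq> gens s n \<and>
     (if n = 0 then augmentation s (combination xs) = 0
      else boundary (combination xs) = 0)}"

definition free_res ::
    "('a::comm_ring_1 \<Rightarrow> 'b::ab_group_add \<Rightarrow> 'b) \<Rightarrow> nat \<Rightarrow> (('a, 'b) gen \<Rightarrow>\<^sub>0 'a) set"
  where "free_res s n = {p. Poly_Mapping.keys p \<subseteq> gens s n}"


section \<open>Ext\<close>

text \<open>
  \<open>cochains s t n\<close> is \<open>Hom(F\<^sub>n, N)\<close>, where \<open>F\<close> is the resolution of the module \<open>M\<close> given by \<open>s\<close>
  and \<open>N\<close> is the module given by \<open>t\<close>.
\<close>

definition cochains ::
    "('a::comm_ring_1 \<Rightarrow> 'b::ab_group_add \<Rightarrow> 'b) \<Rightarrow> ('a \<Rightarrow> 'c::ab_group_add \<Rightarrow> 'c) \<Rightarrow> nat \<Rightarrow>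
      ((('a, 'b) gen \<Rightarrow>\<^sub>0 'a) \<Rightarrow> 'c) set"
  where "cochains s t n = {f \<in> extensional (free_res s n).
    (\<forall>p\<in>free_res s n. \<forall>q\<in>free_res s n. f (p + q) = f p + f q) \<and>
    (\<forall>r. \<forall>p\<in>free_res s n. f (scale_free r p) = t r (f p))}"

definition cocycles ::
    "('a::comm_ring_1 \<Rightarrow> 'b::ab_group_add \<Rightarrow> 'b) \<Rightarrow> ('a \<Rightarrow> 'c::ab_group_add \<Rightarrow> 'c) \<Rightarrow> nat \<Rightarrow>
      ((('a, 'b) gen \<Rightarrow>\<^sub>0 'a) \<Rightarrow> 'c) set"
  where "cocycles s t n = {f \<in> cochains s t n. \<forall>p\<in>free_res s (Suc n). f (boundary p) = 0}"

primrec coboundaries ::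
    "('a::comm_ring_1 \<Rightarrow> 'b::ab_group_add \<Rightarrow> 'b) \<Rightarrow> ('a \<Rightarrow> 'c::ab_group_add \<Rightarrow> 'c) \<Rightarrow> nat \<Rightarrow>
      ((('a, 'b) gen \<Rightarrow>\<^sub>0 'a) \<Rightarrow> 'c) set"
where
  "coboundaries s t 0 = {\<lambda>p\<in>free_res s 0. 0}"
| "coboundaries s t (Suc n) =
    (\<lambda>f. \<lambda>p\<in>free_res s (Suc n). f (boundary p)) ` cochains s t n"

definition Ext ::
    "nat \<Rightarrow> ('a::comm_ring_1 \<Rightarrow> 'b::ab_group_add \<Rightarrow> 'b) \<Rightarrow> ('a \<Rightarrow> 'c::ab_group_add \<Rightarrow> 'c) \<Rightarrow>
      ((('a, 'b) gen \<Rightarrow>\<^sub>0 'a) \<Rightarrow> 'c) set set"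
  where "Ext n s t = cocycles s t n //
    {(f, g). f \<in> cocycles s t n \<and> g \<in> cocycles s t n \<and>
       (\<lambda>p\<in>free_res s n. f p - g p) \<in> coboundaries s t n}"

text \<open>Ext is the zero module iff the class of \<open>0\<close>, which is the set of all coboundaries, is its
  only element.\<close>

definition Ext_zero ::
    "nat \<Rightarrow> ('a::comm_ring_1 \<Rightarrow> 'b::ab_group_add \<Rightarrow> 'b) \<Rightarrow> ('a \<Rightarrow> 'c::ab_group_add \<Rightarrow> 'c) \<Rightarrow> bool"
  where "Ext_zero n s t \<longleftrightarrow> Ext n s t = {coboundaries s t n}"


section \<open>Basic facts: exactness of the standard resolution, and vanishing of Ext\<close>

lemma lookup_scale_free [simp]:
  "Poly_Mapping.lookup (scale_free r p) g = r * Poly_Mapping.lookup p g"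
  by (simp add: scale_free_def map.rep_eq when_def)

lemma module_scale_free: "module (scale_free :: 'a::comm_ring_1 \<Rightarrow> ('g \<Rightarrow>\<^sub>0 'a) \<Rightarrow> _)"
  by standard (auto intro!: poly_mapping_eqI simp: lookup_add algebra_simps)

lemma keys_scale_free: "Poly_Mapping.keys (scale_free r p) \<subseteq> Poly_Mapping.keys p"
  by (auto simp: in_keys_iff)

context module
begin

lemma linear_extension_superset:
  assumes "finite A" "Poly_Mapping.keys p \<subseteq> A"
  shows "linear_extension scale \<phi> p = (\<Sum>g\<in>A. scale (Poly_Mapping.lookup p g) (\<phi> g))"
  unfolding linear_extension_def
  by (rule sum.mono_neutral_left) (use assms in \<open>auto simp: in_keys_iff\<close>)

lemma module_hom_linear_extension: "module_hom scale_free scale (linear_extension scale \<phi>)"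
proof -
  interpret F: module scale_free by (rule module_scale_free)
  show ?thesis
  proof
    fix p q :: "'c \<Rightarrow>\<^sub>0 'a" and r
    let ?A = "Poly_Mapping.keys p \<union> Poly_Mapping.keys q"
    have "Poly_Mapping.keys (p + q) \<subseteq> ?A" by (rule keys_add)
    then show "linear_extension scale \<phi> (p + q) = linear_extension scale \<phi> p + linear_extension scale \<phi> q"
      by (simp add: linear_extension_superset[of ?A] lookup_add scale_left_distrib sum.distrib)
    show "linear_extension scale \<phi> (scale_free r p) = scale r (linear_extension scale \<phi> p)"
      by (simp add: linear_extension_superset[OF finite_keys keys_scale_free]
          linear_extension_def[of scale \<phi> p] scale_sum_right)
  qed
qed

lemma linear_extension_single [simp]:
  "linear_extension scale \<phi> (Poly_Mapping.single g a) = scale a (\<phi> g)"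
  by (simp add: linear_extension_superset[of "{g}"])

end

lemma module_hom_boundary: "module_hom scale_free scale_free boundary"
  unfolding boundary_def by (rule module.module_hom_linear_extension[OF module_scale_free])

lemma free_res_subspace: "module.subspace scale_free (free_res s n)"
proof -
  interpret F: module scale_free by (rule module_scale_free)
  show ?thesis
  proof (rule F.subspaceI)
    show "0 \<in> free_res s n" by (simp add: free_res_def)
  next
    fix p q assume "p \<in> free_res s n" "q \<in> free_res s n"
    with keys_add[of p q] show "p + q \<in> free_res s n" unfolding free_res_def by blast
  next
    fix r p assume "p \<in> free_res s n"
    with keys_scale_free[of r p] show "scale_free r p \<in> free_res s n"
      unfolding free_res_def by blast
  qed
qed

lemmas free_res_add = module.subspace_add[OF module_scale_free free_res_subspace]
  and free_res_scale = module.subspace_scale[OF module_scale_free free_res_subspace]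
  and free_res_0 = module.subspace_0[OF module_scale_free free_res_subspace]

lemma combination_keys:
  obtains xs where "combination xs = p" "snd ` set xs \<subseteq> Poly_Mapping.keys p"
proof -
  obtain gs where gs: "set gs = Poly_Mapping.keys p" "distinct gs"
    using finite_distinct_list[OF finite_keys, of p] by auto
  let ?xs = "map (\<lambda>g. (Poly_Mapping.lookup p g, g)) gs"
  have "combination ?xs = (\<Sum>g\<in>Poly_Mapping.keys p. Poly_Mapping.single g (Poly_Mapping.lookup p g))"
    using gs by (simp add: combination_def comp_def sum_list_distinct_conv_sum_set)
  also have "\<dots> = p"
    by (rule poly_mapping_eqI)
      (auto simp: lookup_sum lookup_single when_def sum.delta' in_keys_iff)
  finally have "combination ?xs = p" .
  moreover have "snd ` set ?xs \<subseteq> Poly_Mapping.keys p" by (simp add: gs(1) image_image)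
  ultimately show ?thesis by (rule that)
qed

lemma combination_in_free_res:
  assumes "snd ` set xs \<subseteq> gens s n"
  shows "combination xs \<in> free_res s n"
  using assms
proof (induction xs)
  case Nil
  then show ?case by (simp add: combination_def free_res_def)
next
  case (Cons x xs)
  obtain a g where x: "x = (a, g)" by (cases x)
  interpret F: module "scale_free :: 'a \<Rightarrow> (('a, 'b) gen \<Rightarrow>\<^sub>0 'a) \<Rightarrow> _"
    by (rule module_scale_free)
  have "Poly_Mapping.single g a \<in> free_res s n"
    using Cons.prems by (simp add: x free_res_def)
  moreover have "combination xs \<in> free_res s n"
    using Cons by simp
  ultimately have "Poly_Mapping.single g a + combination xs \<in> free_res s n"
    by (rule F.subspace_add[OF free_res_subspace])
  then show ?case by (simp add: x combination_def)
qed

theorem resolution_exact: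
  assumes "module s"
  shows "augmentation s ` free_res s 0 = UNIV"
    and "boundary ` free_res s (Suc n) =
      {p \<in> free_res s n. if n = 0 then augmentation s p = 0 else boundary p = 0}" (is "_ = ?Z")
proof -
  interpret M: module s by fact
  interpret F: module "scale_free :: 'a \<Rightarrow> (('a, 'b) gen \<Rightarrow>\<^sub>0 'a) \<Rightarrow> _"
    by (rule module_scale_free)
  interpret b: module_hom scale_free scale_free "boundary :: (('a, 'b) gen \<Rightarrow>\<^sub>0 'a) \<Rightarrow> _"
    by (rule module_hom_boundary)
  interpret e: module_hom scale_free s "augmentation s"
    unfolding augmentation_def by (rule M.module_hom_linear_extension)
  have "x \<in> augmentation s ` free_res s 0" for x
    by (rule image_eqI[of _ _ "Poly_Mapping.single (Elem x) 1"])
      (auto simp: augmentation_def free_res_def)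
  then show "augmentation s ` free_res s 0 = UNIV" by auto
  have Z: "F.subspace ?Z"
    using free_res_subspace[of s n]
    by (auto simp: F.subspace_def b.add b.scale e.add e.scale)
  show "boundary ` free_res s (Suc n) = ?Z"
  proof (intro equalityI subsetI)
    fix q assume "q \<in> boundary ` free_res s (Suc n)"
    then obtain p where p: "Poly_Mapping.keys p \<subseteq> gens s (Suc n)" "q = boundary p"
      by (auto simp: free_res_def)
    have "(\<Sum>g\<in>Poly_Mapping.keys p. scale_free (Poly_Mapping.lookup p g)
        (case g of Elem x \<Rightarrow> 0 | Rel xs \<Rightarrow> combination xs)) \<in> ?Z"
    proof (intro F.subspace_sum[OF Z] F.subspace_scale[OF Z])
      fix g assume "g \<in> Poly_Mapping.keys p"
      with p(1) have "g \<in> gens s (Suc n)" by blast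
      then show "(case g of Elem x \<Rightarrow> 0 | Rel xs \<Rightarrow> combination xs) \<in> ?Z"
        by (auto simp: combination_in_free_res split: if_splits)
    qed
    also have "(\<Sum>g\<in>Poly_Mapping.keys p. scale_free (Poly_Mapping.lookup p g)
        (case g of Elem x \<Rightarrow> 0 | Rel xs \<Rightarrow> combination xs)) = q"
      by (simp only: p(2) boundary_def linear_extension_def)
    finally show "q \<in> ?Z" .
  next
    fix p assume p: "p \<in> ?Z"
    obtain xs where xs: "combination xs = p" "snd ` set xs \<subseteq> Poly_Mapping.keys p"
      by (rule combination_keys)
    have "snd ` set xs \<subseteq> gens s n"
      using p xs(2) unfolding free_res_def by blast
    then have "Rel xs \<in> gens s (Suc n)"
      using p xs(1) by simp
    then show "p \<in> boundary ` free_res s (Suc n)"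
      by (intro image_eqI[of _ _ "Poly_Mapping.single (Rel xs) 1"])
        (auto simp: boundary_def free_res_def F.linear_extension_single xs(1))
  qed
qed

lemma boundary_in_free_res:
  assumes "module s" "p \<in> free_res s (Suc n)"
  shows "boundary p \<in> free_res s n"
  using resolution_exact(2)[OF assms(1), of n] assms(2) by blast

lemma boundary_boundary:
  assumes "module s" "p \<in> free_res s (Suc (Suc n))"
  shows "boundary (boundary p) = 0"
proof -
  have "boundary p \<in> boundary ` free_res s (Suc (Suc n))" using assms(2) by blast
  then show ?thesis unfolding resolution_exact(2)[OF assms(1), of "Suc n"] by simp
qed

lemma cochains_diff:
  assumes "module t" "f \<in> cochains s t n" "g \<in> cochains s t n"
  shows "(\<lambda>p\<in>free_res s n. f p - g p) \<in> cochains s t n"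
proof -
  interpret N: module t by fact
  show ?thesis
    using assms(2,3)
    by (simp add: cochains_def N.scale_right_diff_distrib free_res_add free_res_scale)
qed

lemma zero_in_coboundaries:
  assumes "module s" "module t"
  shows "(\<lambda>p\<in>free_res s n. 0) \<in> coboundaries s t n"
proof (cases n)
  case (Suc k)
  interpret N: module t by fact
  have "(\<lambda>p\<in>free_res s k. 0) \<in> cochains s t k"
    by (simp add: cochains_def free_res_add free_res_scale)
  then show ?thesis
    unfolding Suc coboundaries.simps
    by (rule rev_image_eqI) (auto simp: boundary_in_free_res[OF assms(1)] restrict_def)
qed simp

lemma coboundaries_diff:
  assumes "module s" "module t" "f \<in> coboundaries s t n" "g \<in> coboundaries s t n"
  shows "(\<lambda>p\<in>free_res s n. f p - g p) \<in> coboundaries s t n"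
proof (cases n)
  case (Suc k)
  then obtain f' g' where f': "f' \<in> cochains s t k" "f = (\<lambda>p\<in>free_res s n. f' (boundary p))"
    and g': "g' \<in> cochains s t k" "g = (\<lambda>p\<in>free_res s n. g' (boundary p))"
    using assms(3,4) by auto
  show ?thesis
    unfolding Suc coboundaries.simps
    by (rule rev_image_eqI[OF cochains_diff[OF assms(2) f'(1) g'(1)]])
      (auto simp: Suc f'(2) g'(2) boundary_in_free_res[OF assms(1)] restrict_def)
qed (use assms in \<open>auto simp: restrict_def\<close>)

lemma coboundaries_subset_cocycles:
  assumes "module s" "module t"
  shows "coboundaries s t n \<subseteq> cocycles s t n"
proof
  fix f assume f: "f \<in> coboundaries s t n"
  interpret N: module t by fact
  interpret b: module_hom scale_free scale_free "boundary :: (('a, 'b) gen \<Rightarrow>\<^sub>0 'a) \<Rightarrow> _"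
    by (rule module_hom_boundary)
  note sub = free_res_add free_res_scale free_res_0 boundary_in_free_res[OF assms(1)]
  show "f \<in> cocycles s t n"
  proof (cases n)
    case 0
    then show ?thesis using f by (simp add: cocycles_def cochains_def sub)
  next
    case (Suc k)
    then obtain g where g: "g \<in> cochains s t k" "f = (\<lambda>p\<in>free_res s n. g (boundary p))"
      using f by auto
    have "g (0 + 0) = g 0 + g 0"
      using g(1) free_res_0[of s k] unfolding cochains_def by blast
    then have "g 0 = 0" by simp
    then show ?thesis
      using g(1)
      by (simp add: Suc g(2) sub cocycles_def cochains_def b.add b.scale boundary_boundary[OF assms(1)])
  qed
qed

theorem Ext_zero_iff:
  assumes "module s" "module t"
  shows "Ext_zero n s t \<longleftrightarrow> cocycles s t n = coboundaries s t n"
proof -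
  define Z where "Z = cocycles s t n"
  define B where "B = coboundaries s t n"
  define d where "d f g = (\<lambda>p\<in>free_res s n. f p - g p)" for f g :: "(('a, 'b) gen \<Rightarrow>\<^sub>0 'a) \<Rightarrow> 'c"
  have BZ: "B \<subseteq> Z" unfolding B_def Z_def by (rule coboundaries_subset_cocycles[OF assms])
  have dB: "d f g \<in> B" if "f \<in> B" "g \<in> B" for f g
    using coboundaries_diff[OF assms] that unfolding B_def d_def by blast
  have zero: "(\<lambda>p\<in>free_res s n. 0) \<in> B"
    unfolding B_def by (rule zero_in_coboundaries[OF assms])
  have refl: "d f f \<in> B" for f using zero by (simp add: d_def)
  have E: "Ext_zero n s t \<longleftrightarrow> (\<lambda>f. {g. f \<in> Z \<and> g \<in> Z \<and> d f g \<in> B}) ` Z = {B}"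
    unfolding Ext_zero_def Ext_def quotient_def Z_def[symmetric] B_def[symmetric] d_def[symmetric]
    by (simp add: Image_singleton UNION_singleton_eq_range)
  show ?thesis
    unfolding E Z_def[symmetric] B_def[symmetric]
  proof
    assume *: "(\<lambda>f. {g. f \<in> Z \<and> g \<in> Z \<and> d f g \<in> B}) ` Z = {B}"
    have "f \<in> B" if "f \<in> Z" for f
    proof -
      have "{g. f \<in> Z \<and> g \<in> Z \<and> d f g \<in> B} \<in> {B}" unfolding *[symmetric] using that by (rule imageI)
      then show ?thesis using that refl by blast
    qed
    then show "Z = B" using BZ by blast
  next
    assume "Z = B"
    then have "{g. f \<in> Z \<and> g \<in> Z \<and> d f g \<in> B} = B" if "f \<in> Z" for f
      using that dB by blast
    moreover have "Z \<noteq> {}" using zero \<open>Z = B\<close> by blast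
    ultimately show "(\<lambda>f. {g. f \<in> Z \<and> g \<in> Z \<and> d f g \<in> B}) ` Z = {B}"
      by (simp add: image_constant_conv cong: image_cong)
  qed
qed

end

theory Submission
  imports Defs "HOL-Library.Function_Algebras"
begin

text \<open>
  Put \<open>a = \<nu>(M)\<close> and \<open>b = \<nu>(\<mm> M)\<close>, and let \<open>F = R\<^sup>a \<rightarrow> M\<close> be a minimal cover with kernel \<open>U\<close>, so
  that \<open>\<mm>\<^sup>2 F \<subseteq> U \<subseteq> \<mm> F\<close>; the goal is \<open>U = \<mm> U\<close>.

  If \<open>a < b\<close>, the long exact sequence of \<open>0 \<rightarrow> \<mm> M \<rightarrow> M \<rightarrow> M/\<mm> M \<rightarrow> 0\<close> turns \<open>Ext\<^sup>i(M, M) = 0\<close> into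
  \<open>b \<beta>\<^bsub>i+1\<^esub> \<le> a \<beta>\<^sub>i\<close> for \<open>\<beta>\<^sub>i = dim Ext\<^sup>i(M, R/\<mm>)\<close>.  As \<open>\<beta>\<^sub>0 = a\<close>, these numbers decrease strictly
  until \<open>\<beta>\<^sub>i = 0\<close> for some \<open>i \<le> a\<close>, and the same sequence then gives \<open>\<beta>\<^sub>1 = 0\<close>.

  If \<open>b \<le> a\<close>, only \<open>Ext\<^sup>1\<close> is needed: homomorphisms from \<open>U\<close> to \<open>M\<close> or \<open>R\<close> extend to \<open>F\<close>.  For
  \<open>p = dim U/\<mm> U > 0\<close> this yields \<open>b p < a\<^sup>2\<close> (the identity of \<open>M\<close> restricts to \<open>0\<close> on \<open>U\<close>) and a lower
  bound for the number of relations between the generators of \<open>U\<close>.  Comparing dimensions along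
  \<open>\<mm> F \<supseteq> U \<supseteq> \<mm>\<^sup>2 F \<supseteq> \<mm> U \<supseteq> \<mm>\<^sup>3 F\<close> forces \<open>\<mm>\<^sup>2 = \<mm>\<^sup>3\<close>, so \<open>\<mm>\<^sup>2 = 0\<close>; then \<open>Ext\<^sup>1(M, R) = 0\<close> bounds
  \<open>p dim \<mm>\<close> by \<open>a\<close>, which is impossible.
\<close>

section \<open>Linear algebra modulo the maximal ideal\<close>

locale local_ring =
  fixes \<mm> :: "'a::comm_ring_1 set"
  assumes ideal_maximal: "ideal \<mm>"
    and one_notin: "1 \<notin> \<mm>"
    and unit: "x \<notin> \<mm> \<Longrightarrow> x dvd 1"

lemma module_mult: "module ((*) :: 'a::comm_ring_1 \<Rightarrow> 'a \<Rightarrow> 'a)"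
  by standard (auto simp: algebra_simps)

interpretation ring_module: module "(*) :: 'a::comm_ring_1 \<Rightarrow> 'a \<Rightarrow> 'a"
  by (rule module_mult)

text \<open>As a rewrite rule, this instance loops with \<open>mult.assoc\<close>.\<close>

declare ring_module.scale_scale [simp del]

context local_ring
begin

lemma zero_in: "0 \<in> \<mm>"
  and add_in: "x \<in> \<mm> \<Longrightarrow> y \<in> \<mm> \<Longrightarrow> x + y \<in> \<mm>"
  and diff_in: "x \<in> \<mm> \<Longrightarrow> y \<in> \<mm> \<Longrightarrow> x - y \<in> \<mm>"
  and mult_in: "y \<in> \<mm> \<Longrightarrow> x * y \<in> \<mm>"
  and mult_in': "x \<in> \<mm> \<Longrightarrow> x * y \<in> \<mm>"
  using ring_module.subspace_0[OF ideal_maximal] ring_module.subspace_add[OF ideal_maximal]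
    ring_module.subspace_diff[OF ideal_maximal]
    ring_module.subspace_scale[OF ideal_maximal, of y x]
    ring_module.subspace_scale[OF ideal_maximal, of x y]
  by (simp_all add: mult.commute)

lemmas sum_in = ring_module.subspace_sum[OF ideal_maximal]

lemma unitE:
  assumes "x \<notin> \<mm>"
  obtains u where "u * x = 1"
  using unit[OF assms] by (metis dvdE mult.commute)

text \<open>Gaussian elimination over the residue field \<open>R/\<mm>\<close>, done on
  representatives in \<open>R\<close>: an equation with all coefficients in \<open>\<mm>\<close>
  holds automatically, and otherwise a unit pivot eliminates one unknown. The dimension bounds below
  rest on this.\<close>

lemma underdetermined:
  assumes "finite I" "finite J" "card I < card J"
  shows "\<exists>r. (\<exists>j\<in>J. r j \<notin> \<mm>) \<and> (\<forall>i\<in>I. (\<Sum>j\<in>J. c i j * r j) \<in> \<mm>)"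
  using assms
proof (induction I arbitrary: J c rule: finite_induct)
  case empty
  then have "J \<noteq> {}" by auto
  then show ?case using one_notin by (intro exI[of _ "\<lambda>_. 1"]) auto
next
  case (insert i0 I)
  show ?case
  proof (cases "\<forall>j\<in>J. c i0 j \<in> \<mm>")
    case True
    obtain r where "\<exists>j\<in>J. r j \<notin> \<mm>" "\<forall>i\<in>I. (\<Sum>j\<in>J. c i j * r j) \<in> \<mm>"
      using insert.IH[of J c] insert.prems insert.hyps by auto
    then show ?thesis using True by (intro exI[of _ r]) (auto intro!: sum_in mult_in')
  next
    case False
    then obtain j0 where j0: "j0 \<in> J" "c i0 j0 \<notin> \<mm>" by auto
    obtain u where u: "u * c i0 j0 = 1" by (rule unitE[OF j0(2)])
    define J' where "J' = J - {j0}"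
    have J: "J = insert j0 J'" "j0 \<notin> J'" "finite J'"
      using j0 insert.prems by (auto simp: J'_def)
    \<comment> \<open>Subtracting multiples of row \<open>i0\<close> clears column
      \<open>j0\<close>; \<open>r'\<close> below substitutes back, so that equation
      \<open>i0\<close> holds exactly.\<close>
    define c' where "c' i j = c i j - c i j0 * u * c i0 j" for i j
    have "card I < card J'" using insert.prems insert.hyps J by simp
    then obtain r where r: "\<exists>j\<in>J'. r j \<notin> \<mm>" "\<forall>i\<in>I. (\<Sum>j\<in>J'. c' i j * r j) \<in> \<mm>"
      using insert.IH[of J' c'] J(3) by auto
    define r' where "r' = r(j0 := - u * (\<Sum>j\<in>J'. c i0 j * r j))"
    have s: "(\<Sum>j\<in>J. c i j * r' j) = (\<Sum>j\<in>J'. c i j * r j) - c i j0 * u * (\<Sum>j\<in>J'. c i0 j * r j)" for i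
    proof -
      have "(\<Sum>j\<in>J'. c i j * r' j) = (\<Sum>j\<in>J'. c i j * r j)"
        by (rule sum.cong) (use J in \<open>auto simp: r'_def\<close>)
      moreover have "c i j0 * r' j0 = - (c i j0 * u * (\<Sum>j\<in>J'. c i0 j * r j))"
        unfolding r'_def fun_upd_same by (simp only: mult_minus_left mult_minus_right mult.assoc)
      ultimately show ?thesis unfolding J(1) sum.insert[OF J(3,2)] by (simp only: uminus_add_conv_diff)
    qed
    have "(\<Sum>j\<in>J. c i j * r' j) = (\<Sum>j\<in>J'. c' i j * r j)" for i
      unfolding s c'_def left_diff_distrib sum_subtractf mult.assoc sum_distrib_left ..
    moreover have "(\<Sum>j\<in>J. c i0 j * r' j) = 0"
      unfolding s using u by (simp add: mult.commute[of "c i0 j0" u])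
    moreover have "\<exists>j\<in>J. r' j \<notin> \<mm>" using r(1) J by (auto simp: r'_def)
    ultimately show ?thesis using r(2) zero_in by (intro exI[of _ r']) auto
  qed
qed

end

section \<open>Bases of subquotients over the residue field\<close>

locale local_module = local_ring \<mm> + module scale
  for \<mm> :: "'a::comm_ring_1 set"
    and scale :: "'a \<Rightarrow> 'b::ab_group_add \<Rightarrow> 'b" (infixr \<open>*s\<close> 75)
begin

text \<open>\<open>indep\<close>, \<open>spans\<close> and \<open>basis\<close> describe the classes
  of a family in \<open>A/B\<close> through representatives. With \<open>kills A B\<close>, the
  quotient is a vector space over \<open>R/\<mm>\<close>, and coefficients count only modulo
  \<open>\<mm>\<close>.\<close>

definition indep :: "'b set \<Rightarrow> 'i set \<Rightarrow> ('i \<Rightarrow> 'b) \<Rightarrow> bool"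
  where "indep B J x \<longleftrightarrow> (\<forall>r. (\<Sum>j\<in>J. r j *s x j) \<in> B \<longrightarrow> (\<forall>j\<in>J. r j \<in> \<mm>))"

definition spans :: "'b set \<Rightarrow> 'b set \<Rightarrow> 'i set \<Rightarrow> ('i \<Rightarrow> 'b) \<Rightarrow> bool"
  where "spans A B J x \<longleftrightarrow> (\<forall>v\<in>A. \<exists>r. v - (\<Sum>j\<in>J. r j *s x j) \<in> B)"

definition basis :: "'b set \<Rightarrow> 'b set \<Rightarrow> 'i set \<Rightarrow> ('i \<Rightarrow> 'b) \<Rightarrow> bool"
  where "basis A B J x \<longleftrightarrow> (\<forall>j\<in>J. x j \<in> A) \<and> indep B J x \<and> spans A B J x"

definition kills :: "'b set \<Rightarrow> 'b set \<Rightarrow> bool"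
  where "kills A B \<longleftrightarrow> (\<forall>r\<in>\<mm>. \<forall>x\<in>A. r *s x \<in> B)"

lemma indepD: "indep B J x \<Longrightarrow> (\<Sum>j\<in>J. r j *s x j) \<in> B \<Longrightarrow> j \<in> J \<Longrightarrow> r j \<in> \<mm>"
  unfolding indep_def by blast

lemma spansE:
  assumes "spans A B J x" "v \<in> A"
  obtains r where "v - (\<Sum>j\<in>J. r j *s x j) \<in> B"
  using assms unfolding spans_def by blast

lemma spans_mono: "spans A B J x \<Longrightarrow> A' \<subseteq> A \<Longrightarrow> B \<subseteq> B' \<Longrightarrow> spans A' B' J x"
  unfolding spans_def by blast

lemma killsD: "kills A B \<Longrightarrow> r \<in> \<mm> \<Longrightarrow> x \<in> A \<Longrightarrow> r *s x \<in> B"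
  unfolding kills_def by blast

lemma kills_mono: "kills A B \<Longrightarrow> A' \<subseteq> A \<Longrightarrow> B \<subseteq> B' \<Longrightarrow> kills A' B'"
  unfolding kills_def by blast

text \<open>If \<open>J\<close> were larger, the matrix of the \<open>y j\<close> in terms of the
  \<open>x i\<close> would have a kernel vector modulo \<open>\<mm>\<close> with a unit entry, which
  is a dependence of \<open>y\<close> modulo \<open>B\<close>.\<close>

lemma indep_card_le:
  assumes B: "subspace B" and fin: "finite I" "finite J"
    and x: "spans A B I x" "\<And>r i. r \<in> \<mm> \<Longrightarrow> i \<in> I \<Longrightarrow> r *s x i \<in> B"
    and y: "\<And>j. j \<in> J \<Longrightarrow> y j \<in> A" "indep B J y"
  shows "card J \<le> card I"
proof (rule ccontr)
  assume "\<not> ?thesis"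
  then have less: "card I < card J" by simp
  have "\<forall>j\<in>J. \<exists>c. y j - (\<Sum>i\<in>I. c i *s x i) \<in> B"
    using x(1) y(1) unfolding spans_def by blast
  then obtain c where c: "\<And>j. j \<in> J \<Longrightarrow> y j - (\<Sum>i\<in>I. c j i *s x i) \<in> B" by metis
  obtain r where r: "\<exists>j\<in>J. r j \<notin> \<mm>" "\<forall>i\<in>I. (\<Sum>j\<in>J. c j i * r j) \<in> \<mm>"
    using underdetermined[OF fin less, of "\<lambda>i j. c j i"] by auto
  have "(\<Sum>j\<in>J. r j *s y j) =
      (\<Sum>j\<in>J. r j *s (y j - (\<Sum>i\<in>I. c j i *s x i))) + (\<Sum>j\<in>J. \<Sum>i\<in>I. (c j i * r j) *s x i)"
    by (simp add: scale_right_diff_distrib scale_sum_right sum_subtractf mult.commute)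
  also have "(\<Sum>j\<in>J. \<Sum>i\<in>I. (c j i * r j) *s x i) = (\<Sum>i\<in>I. (\<Sum>j\<in>J. c j i * r j) *s x i)"
    by (subst sum.swap) (simp add: scale_sum_left)
  finally have "(\<Sum>j\<in>J. r j *s y j) \<in> B"
    using c r(2) x(2) by (auto intro!: subspace_add[OF B] subspace_sum[OF B] subspace_scale[OF B c])
  then show False using indepD[OF y(2)] r(1) by blast
qed

lemma basis_card_eq:
  assumes "subspace B" "kills A B" "finite I" "finite J" "basis A B I x" "basis A B J y"
  shows "card I = card J"
  using assms indep_card_le[of B I J A x y] indep_card_le[of B J I A y x]
  unfolding basis_def kills_def by (intro antisym) auto

lemma indep_insert:
  assumes B: "subspace B" and J: "finite J" "j0 \<notin> J" and x: "indep B J x"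
    and out: "\<And>r. x j0 - (\<Sum>j\<in>J. r j *s x j) \<notin> B"
    and kill: "\<And>r. r \<in> \<mm> \<Longrightarrow> r *s x j0 \<in> B"
  shows "indep B (insert j0 J) x"
  unfolding indep_def
proof (intro allI impI)
  fix r assume "(\<Sum>j\<in>insert j0 J. r j *s x j) \<in> B"
  then have *: "r j0 *s x j0 + (\<Sum>j\<in>J. r j *s x j) \<in> B" using J by simp
  have r0: "r j0 \<in> \<mm>"
  proof (rule ccontr)
    assume "r j0 \<notin> \<mm>"
    then obtain u where u: "u * r j0 = 1" by (rule unitE)
    have "u *s (r j0 *s x j0 + (\<Sum>j\<in>J. r j *s x j)) \<in> B" using * B by (rule subspace_scale[rotated])
    also have "u *s (r j0 *s x j0 + (\<Sum>j\<in>J. r j *s x j)) = x j0 - (\<Sum>j\<in>J. (- u * r j) *s x j)"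
      using u by (simp add: scale_right_distrib scale_sum_right sum_negf)
    finally show False using out[of "\<lambda>j. - u * r j"] by blast
  qed
  have "(r j0 *s x j0 + (\<Sum>j\<in>J. r j *s x j)) - r j0 *s x j0 \<in> B"
    by (intro subspace_diff[OF B] * kill r0)
  then have "(\<Sum>j\<in>J. r j *s x j) \<in> B" by simp
  then show "\<forall>j\<in>insert j0 J. r j \<in> \<mm>" using r0 indepD[OF x] by blast
qed

lemma indep_cong: "(\<And>j. j \<in> J \<Longrightarrow> x j = y j) \<Longrightarrow> indep B J x \<longleftrightarrow> indep B J y"
  unfolding indep_def by (simp cong: sum.cong)

text \<open>An independent family of maximal length spans. The bound is put on independent families,
  so that finite dimension of an Ext group can be concluded from an inequality.\<close>

lemma basis_exists_bounded:
  assumes B: "subspace B" and k: "kills A B"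
    and bound: "\<And>n x. \<forall>i<n. x i \<in> A \<Longrightarrow> indep B {..<n} x \<Longrightarrow> n \<le> N"
  shows "\<exists>n x. n \<le> N \<and> basis A B {..<n::nat} x"
proof -
  define P where "P n \<longleftrightarrow> (\<exists>x. (\<forall>i<n. x i \<in> A) \<and> indep B {..<n} x)" for n :: nat
  have P0: "P 0" by (simp add: P_def indep_def)
  have PN: "n \<le> N" if "P n" for n using that bound unfolding P_def by blast
  define n where "n = (GREATEST n. P n)"
  have n: "P n" unfolding n_def using P0 PN by (rule GreatestI_nat)
  have max: "k \<le> n" if "P k" for k
    unfolding n_def using that PN by (rule Greatest_le_nat)
  obtain x where x: "\<forall>i<n. x i \<in> A" "indep B {..<n} x" using n unfolding P_def by blast
  have "spans A B {..<n} x"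
  proof (rule ccontr)
    assume "\<not> ?thesis"
    then obtain v where v: "v \<in> A" "\<And>r. v - (\<Sum>j<n. r j *s x j) \<notin> B" unfolding spans_def by blast
    let ?x = "x(n := v)"
    have "indep B (insert n {..<n}) ?x"
    proof (rule indep_insert[OF B])
      show "indep B {..<n} ?x" using x(2) by (subst indep_cong[of _ _ x]) auto
      show "?x n - (\<Sum>j<n. r j *s ?x j) \<notin> B" for r
        using v(2)[of r] by (simp cong: sum.cong_simp)
      show "r *s ?x n \<in> B" if "r \<in> \<mm>" for r using killsD[OF k that v(1)] by simp
    qed auto
    then have "indep B {..<Suc n} ?x" by (simp add: lessThan_Suc)
    moreover have "\<forall>i<Suc n. ?x i \<in> A" using x(1) v(1) by (simp add: less_Suc_eq)
    ultimately have "P (Suc n)" unfolding P_def by blast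
    then show False using max by fastforce
  qed
  then show ?thesis using x PN[OF n] unfolding basis_def by blast
qed

lemma basis_exists:
  assumes B: "subspace B" and k: "kills A B"
    and s: "finite I" "spans A' B I w" "\<And>r i. r \<in> \<mm> \<Longrightarrow> i \<in> I \<Longrightarrow> r *s w i \<in> B"
    and sub: "A \<subseteq> A'"
  obtains n x where "n \<le> card I" "basis A B {..<n::nat} x"
proof -
  have "\<exists>n x. n \<le> card I \<and> basis A B {..<n::nat} x"
  proof (rule basis_exists_bounded[OF B k])
    fix n and x :: "nat \<Rightarrow> 'b" assume x: "\<forall>i<n. x i \<in> A" "indep B {..<n} x"
    have "card {..<n} \<le> card I"
      by (rule indep_card_le[OF B s(1) _ s(2) s(3) _ x(2)]) (use x(1) sub in auto)
    then show "n \<le> card I" by simp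
  qed
  then show ?thesis using that by blast
qed

text \<open>Additivity of dimension along \<open>A \<supseteq> B \<supseteq> C\<close>: a relation
  read modulo \<open>B\<close> has its coefficients at \<open>x\<close> in \<open>\<mm>\<close>, and
  \<open>\<mm> A \<subseteq> C\<close> then removes these terms.\<close>

lemma basis_append:
  assumes B: "subspace B" and C: "subspace C" and CB: "C \<subseteq> B" and BA: "B \<subseteq> A"
    and k: "kills A C" and fin: "finite I" "finite J"
    and x: "basis A B I x" and y: "basis B C J y"
  shows "basis A C (I <+> J) (case_sum x y)"
proof -
  have split: "(\<Sum>j\<in>I <+> J. r j *s case_sum x y j) =
      (\<Sum>i\<in>I. r (Inl i) *s x i) + (\<Sum>j\<in>J. r (Inr j) *s y j)" for r
    using fin by (simp add: sum.Plus)
  have yB: "(\<Sum>j\<in>J. r j *s y j) \<in> B" for r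
    using y by (auto simp: basis_def intro!: subspace_sum[OF B] subspace_scale[OF B])
  have "indep C (I <+> J) (case_sum x y)"
    unfolding indep_def split
  proof (intro allI impI)
    fix r assume *: "(\<Sum>i\<in>I. r (Inl i) *s x i) + (\<Sum>j\<in>J. r (Inr j) *s y j) \<in> C"
    have "((\<Sum>i\<in>I. r (Inl i) *s x i) + (\<Sum>j\<in>J. r (Inr j) *s y j)) - (\<Sum>j\<in>J. r (Inr j) *s y j) \<in> B"
      using * CB by (intro subspace_diff[OF B] yB) auto
    then have i: "r (Inl i) \<in> \<mm>" if "i \<in> I" for i
      using that x indepD[of B I x "\<lambda>i. r (Inl i)"] by (simp add: basis_def)
    then have "(\<Sum>i\<in>I. r (Inl i) *s x i) \<in> C"
      using x k by (auto simp: basis_def intro!: subspace_sum[OF C] killsD[OF k])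
    with * have "((\<Sum>i\<in>I. r (Inl i) *s x i) + (\<Sum>j\<in>J. r (Inr j) *s y j)) - (\<Sum>i\<in>I. r (Inl i) *s x i) \<in> C"
      by (intro subspace_diff[OF C])
    then have "r (Inr j) \<in> \<mm>" if "j \<in> J" for j
      using that y indepD[of C J y "\<lambda>i. r (Inr i)"] by (simp add: basis_def)
    with i show "\<forall>j\<in>I <+> J. r j \<in> \<mm>" by auto
  qed
  moreover have "spans A C (I <+> J) (case_sum x y)"
    unfolding spans_def split
  proof
    fix v assume v: "v \<in> A"
    obtain r where r: "v - (\<Sum>i\<in>I. r i *s x i) \<in> B"
      using x v by (auto simp: basis_def elim: spansE)
    obtain q where q: "(v - (\<Sum>i\<in>I. r i *s x i)) - (\<Sum>j\<in>J. q j *s y j) \<in> C"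
      using y r by (auto simp: basis_def elim: spansE)
    show "\<exists>r. v - ((\<Sum>i\<in>I. r (Inl i) *s x i) + (\<Sum>j\<in>J. r (Inr j) *s y j)) \<in> C"
      using q by (intro exI[of _ "case_sum r q"]) (simp add: algebra_simps)
  qed
  moreover have "\<forall>j\<in>I <+> J. case_sum x y j \<in> A"
    using x y BA by (auto simp: basis_def)
  ultimately show ?thesis by (simp add: basis_def)
qed

lemma basis_card_add:
  assumes "subspace B" "subspace C" "C \<subseteq> B" "B \<subseteq> A" "kills A C" "finite I" "finite J" "finite K"
    and "basis A B I x" "basis B C J y" "basis A C K z"
  shows "card K = card I + card J"
  using basis_card_eq[OF assms(2,5) _ assms(8) basis_append[OF assms(1-7,9,10)] assms(11)] assms(6,7)
  by (simp add: card_Plus)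

lemma in_ideal_mult: "a \<in> I \<Longrightarrow> x \<in> N \<Longrightarrow> a *s x \<in> ideal_mult scale I N"
  unfolding ideal_mult_def by (intro span_base) blast

lemma subspace_ideal_mult: "subspace (ideal_mult scale I N)"
  unfolding ideal_mult_def by simp

lemma ideal_mult_minimal:
  assumes "\<And>a x. a \<in> I \<Longrightarrow> x \<in> N \<Longrightarrow> a *s x \<in> S" "subspace S"
  shows "ideal_mult scale I N \<subseteq> S"
  unfolding ideal_mult_def by (intro span_minimal) (use assms in auto)

lemma kills_ideal_mult: "kills A (ideal_mult scale \<mm> A)"
  by (simp add: kills_def in_ideal_mult)

text \<open>A unit coefficient in a relation modulo \<open>\<mm> N\<close> would make the corresponding generator redundant.\<close>

lemma minimal_generators:
  assumes N: "\<exists>G. finite G \<and> span G = N"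
  obtains G where "finite G" "span G = N" "card G = min_gens scale N"
    "indep (ideal_mult scale \<mm> N) G (\<lambda>y. y)"
proof -
  define Q where "Q n \<longleftrightarrow> (\<exists>B. finite B \<and> card B = n \<and> span B = N)" for n
  have mg: "min_gens scale N = (LEAST n. Q n)" by (simp add: min_gens_def Q_def)
  obtain n0 where "Q n0" using N by (auto simp: Q_def)
  then have "Q (min_gens scale N)" unfolding mg by (rule LeastI)
  then obtain G where G: "finite G" "span G = N" "card G = min_gens scale N"
    by (auto simp: Q_def)
  have min: "card G \<le> card H" if "finite H" "span H = N" for H
    unfolding G(3) mg using that by (intro Least_le) (auto simp: Q_def)
  have mN: "\<exists>r. (\<forall>y\<in>G. r y \<in> \<mm>) \<and> x = (\<Sum>y\<in>G. r y *s y)" if "x \<in> ideal_mult scale \<mm> N" for x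
  proof -
    let ?S = "{x. \<exists>r. (\<forall>y\<in>G. r y \<in> \<mm>) \<and> x = (\<Sum>y\<in>G. r y *s y)}"
    have "ideal_mult scale \<mm> N \<subseteq> ?S"
    proof (rule ideal_mult_minimal)
      fix a x assume a: "a \<in> \<mm>" and "x \<in> N"
      then obtain q where "x = (\<Sum>y\<in>G. q y *s y)"
        unfolding G(2)[symmetric] span_finite[OF G(1)] by auto
      then have "a *s x = (\<Sum>y\<in>G. (a * q y) *s y)" by (simp add: scale_sum_right)
      then show "a *s x \<in> ?S" using a mult_in'
        by (intro CollectI exI[of _ "\<lambda>y. a * q y"]) auto
    next
      show "subspace ?S"
      proof (rule subspaceI)
        show "0 \<in> ?S" using zero_in by (intro CollectI exI[of _ "\<lambda>_. 0"]) auto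
      next
        fix x y assume "x \<in> ?S" "y \<in> ?S"
        then obtain r q where "\<forall>y\<in>G. r y \<in> \<mm>" "x = (\<Sum>y\<in>G. r y *s y)"
          "\<forall>y\<in>G. q y \<in> \<mm>" "y = (\<Sum>y\<in>G. q y *s y)" by auto
        then show "x + y \<in> ?S" using add_in
          by (intro CollectI exI[of _ "\<lambda>y. r y + q y"]) (auto simp: scale_left_distrib sum.distrib)
      next
        fix x c assume "x \<in> ?S"
        then obtain r where "\<forall>y\<in>G. r y \<in> \<mm>" "x = (\<Sum>y\<in>G. r y *s y)" by auto
        then show "c *s x \<in> ?S" using mult_in
          by (intro CollectI exI[of _ "\<lambda>y. c * r y"]) (auto simp: scale_sum_right)
      qed
    qed
    then show ?thesis using that by blast
  qed
  have "indep (ideal_mult scale \<mm> N) G (\<lambda>y. y)"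
    unfolding indep_def
  proof (intro allI impI ballI, rule ccontr)
    fix r y0 assume "(\<Sum>y\<in>G. r y *s y) \<in> ideal_mult scale \<mm> N" and y0: "y0 \<in> G" "r y0 \<notin> \<mm>"
    then obtain q where q: "\<forall>y\<in>G. q y \<in> \<mm>" "(\<Sum>y\<in>G. r y *s y) = (\<Sum>y\<in>G. q y *s y)"
      using mN by blast
    have "r y0 - q y0 \<notin> \<mm>" using y0 q(1) add_in[of "r y0 - q y0" "q y0"] by auto
    then obtain u where u: "u * (r y0 - q y0) = 1" by (rule unitE)
    let ?H = "G - {y0}"
    have "(\<Sum>y\<in>G. (r y - q y) *s y) = 0"
      using q(2) by (simp add: scale_left_diff_distrib sum_subtractf)
    then have "(r y0 - q y0) *s y0 + (\<Sum>y\<in>?H. (r y - q y) *s y) = 0"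
      using G(1) y0(1) by (simp add: sum.remove)
    then have "(r y0 - q y0) *s y0 = - (\<Sum>y\<in>?H. (r y - q y) *s y)"
      by (simp add: eq_neg_iff_add_eq_0)
    moreover have "(\<Sum>y\<in>?H. (r y - q y) *s y) \<in> span ?H"
      by (intro span_sum span_scale span_base)
    ultimately have "u *s (r y0 - q y0) *s y0 \<in> span ?H"
      by (metis span_scale span_neg)
    then have "y0 \<in> span ?H" using u by simp
    then have "span ?H = span G"
      unfolding span_eq using span_base[of _ ?H] span_base[of _ G] by blast
    then have "span ?H = N" using G(2) by simp
    then have "card G \<le> card ?H" using G(1) by (intro min) auto
    then show False using card_Diff1_less[OF G(1) y0(1)] by linarith
  qed
  with G show ?thesis using that by blast
qed

end

section \<open>Artinian local rings\<close>

context artinian_local_ring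
begin

text \<open>Zorn's lemma gives an ideal above \<open>I\<close> that is maximal among those without
  \<open>1\<close>; it is a maximal ideal, hence equal to \<open>\<mm>\<close>.\<close>

lemma proper_ideal_subset:
  assumes I: "ideal I" "1 \<notin> I"
  shows "I \<subseteq> \<mm>"
proof -
  define A where "A = {J. ideal J \<and> I \<subseteq> J \<and> 1 \<notin> J}"
  have "\<exists>M\<in>A. \<forall>X\<in>A. M \<subseteq> X \<longrightarrow> X = M"
  proof (rule subset_Zorn_nonempty)
    show "A \<noteq> {}" using I by (auto simp: A_def)
  next
    fix C assume C: "C \<noteq> {}" "subset.chain A C"
    then have CA: "\<And>J. J \<in> C \<Longrightarrow> ideal J \<and> I \<subseteq> J \<and> 1 \<notin> J"
      and lin: "\<And>J K. J \<in> C \<Longrightarrow> K \<in> C \<Longrightarrow> J \<subseteq> K \<or> K \<subseteq> J"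
      by (auto simp: A_def subset.chain_def)
    have "ideal (\<Union>C)"
    proof (rule ring_module.subspaceI)
      show "0 \<in> \<Union>C" using C(1) CA ring_module.subspace_0 by blast
    next
      fix x y assume "x \<in> \<Union>C" "y \<in> \<Union>C"
      then obtain J where "J \<in> C" "x \<in> J" "y \<in> J" using lin by blast
      then show "x + y \<in> \<Union>C" using CA ring_module.subspace_add by blast
    next
      fix c x assume "x \<in> \<Union>C"
      then show "c * x \<in> \<Union>C" using CA ring_module.subspace_scale by blast
    qed
    then show "\<Union>C \<in> A" using C(1) CA by (auto simp: A_def)
  qed
  then obtain M where M: "M \<in> A" and max: "\<And>X. X \<in> A \<Longrightarrow> M \<subseteq> X \<Longrightarrow> X = M" by blast
  have full: "J = UNIV" if "ideal J" "1 \<in> J" for J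
    using ring_module.subspace_scale[OF that] by auto
  have "maximal_ideal M"
    unfolding maximal_ideal_def
  proof (intro conjI allI impI)
    fix J assume "ideal J \<and> M \<subseteq> J"
    then show "J = M \<or> J = UNIV" using max[of J] full[of J] M by (auto simp: A_def)
  qed (use M in \<open>auto simp: A_def\<close>)
  then show ?thesis using local M by (auto simp: A_def)
qed

lemma one_notin_maximal: "1 \<notin> \<mm>"
proof
  assume "1 \<in> \<mm>"
  then have "\<mm> = UNIV"
    using maximal ring_module.subspace_scale[of \<mm> 1] by (auto simp: maximal_ideal_def)
  then show False using maximal by (simp add: maximal_ideal_def)
qed

lemma unit_of_notin_maximal:
  assumes "x \<notin> \<mm>"
  shows "x dvd 1"
proof -
  have "ideal (range (\<lambda>r. r * x))"
  proof (rule ring_module.subspaceI)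
    show "0 \<in> range (\<lambda>r. r * x)" by (rule image_eqI[of _ _ 0]) auto
  next
    fix u v assume "u \<in> range (\<lambda>r. r * x)" "v \<in> range (\<lambda>r. r * x)"
    then show "u + v \<in> range (\<lambda>r. r * x)" by (auto simp: distrib_right[symmetric])
  next
    fix c u assume "u \<in> range (\<lambda>r. r * x)"
    then show "c * u \<in> range (\<lambda>r. r * x)" by (auto simp: mult.assoc[symmetric])
  qed
  moreover have "x \<in> range (\<lambda>r. r * x)" by (rule image_eqI[of _ _ 1]) auto
  ultimately have "1 \<in> range (\<lambda>r. r * x)" using proper_ideal_subset assms by blast
  then show ?thesis by (metis dvd_triv_right imageE)
qed

sublocale local_ring \<mm>
  by standard
    (use maximal one_notin_maximal unit_of_notin_maximal in \<open>auto simp: maximal_ideal_def\<close>)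

text \<open>The descending chain condition in the form that the induction in \<open>nakayama\<close>
  uses.\<close>

lemma wf_ideals: "wf {(I, J). ideal I \<and> ideal J \<and> I \<subset> (J :: 'a set)}"
  unfolding wf_iff_no_infinite_down_chain
proof
  assume "\<exists>f. \<forall>i. (f (Suc i), f i) \<in> {(I, J). ideal I \<and> ideal J \<and> I \<subset> (J :: 'a set)}"
  then obtain f :: "nat \<Rightarrow> 'a set"
    where "\<And>i. ideal (f (Suc i)) \<and> ideal (f i) \<and> f (Suc i) \<subset> f i" by auto
  then have f: "\<And>i. ideal (f i)" "\<And>i. f (Suc i) \<subset> f i" by blast+
  have "decseq f" using f(2) by (intro decseq_SucI) auto
  then obtain k where "\<forall>n\<ge>k. f n = f k" using artinian[of f] f(1) by blast
  then have "f (Suc k) = f k" by (blast intro: le_SucI)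
  then show False using f(2)[of k] by simp
qed

lemma local_module_ring: "local_module \<mm> (*)" ..

text \<open>If \<open>A/B\<close> had infinite dimension, an infinite independent sequence
  \<open>x\<close> could be chosen. The ideals \<open>I n\<close>, generated by \<open>B\<close> and
  the \<open>x i\<close> with \<open>i \<ge> n\<close>, decrease; where they become stationary,
  \<open>x k\<close> depends on later members.\<close>

lemma finite_basis_ideals:
  assumes B: "ideal B" and k: "local_module.kills \<mm> (*) A B"
  shows "\<exists>n x. local_module.basis \<mm> (*) A B {..<n::nat} x"
proof (rule ccontr)
  interpret ring: local_module \<mm> "(*)" by (rule local_module_ring)
  assume no: "\<not> ?thesis"
  \<comment> \<open>The condition for \<open>v\<close> to prolong the sequence \<open>f\<close> at
    position \<open>n\<close>; it looks at \<open>f\<close> only below \<open>n\<close>, as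
    dependent choice demands.\<close>
  define P where "P f n v \<longleftrightarrow> v \<in> A \<and> (\<forall>r. v - (\<Sum>i<n. r i * f i) \<notin> B)" for f and n :: nat and v
  have ind: "ring.indep B {..<n} f \<and> (\<forall>i<n. f i \<in> A)" if "\<And>i. i < n \<Longrightarrow> P f i (f i)" for f n
    using that
  proof (induction n)
    case 0
    then show ?case by (simp add: ring.indep_def)
  next
    case (Suc n)
    have "ring.indep B (insert n {..<n}) f"
      by (rule ring.indep_insert[OF B])
        (use Suc ring.killsD[OF k, of _ "f n"] in \<open>auto simp: P_def\<close>)
    then show ?case using Suc by (auto simp: lessThan_Suc P_def less_Suc_eq)
  qed
  have "\<exists>f. \<forall>n. P f n (f n)"
  proof (rule dependent_wf_choice[OF wf_less_than])
    fix f g :: "nat \<Rightarrow> 'a" and n v assume "\<And>z. (z, n) \<in> less_than \<Longrightarrow> f z = g z"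
    then show "P f n v = P g n v" by (simp add: P_def)
  next
    fix n f assume "\<And>y. (y, n) \<in> less_than \<Longrightarrow> P f y (f y)"
    then have f: "ring.indep B {..<n} f" "\<forall>i<n. f i \<in> A" using ind by auto
    then have "\<not> ring.spans A B {..<n} f" using no unfolding ring.basis_def by auto
    then show "\<exists>v. P f n v" unfolding ring.spans_def P_def by blast
  qed
  then obtain x where x: "\<And>n. P x n (x n)" by blast
  define I where "I n = {v. \<exists>N r. v - (\<Sum>i\<in>{n..<N}. r i * x i) \<in> B}" for n
  have Iideal: "ideal (I n)" for n
  proof (rule ring_module.subspaceI)
    show "0 \<in> I n"
      using ring_module.subspace_0[OF B] unfolding I_def by (auto intro!: exI[of _ 0])
  next
    fix u v assume "u \<in> I n" "v \<in> I n"
    then obtain N r M q where "u - (\<Sum>i\<in>{n..<N}. r i * x i) \<in> B" "v - (\<Sum>i\<in>{n..<M}. q i * x i) \<in> B"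
      unfolding I_def by blast
    then have "(u - (\<Sum>i\<in>{n..<N}. r i * x i)) + (v - (\<Sum>i\<in>{n..<M}. q i * x i)) \<in> B"
      by (rule ring_module.subspace_add[OF B])
    moreover have "(\<Sum>i\<in>{n..<N}. r i * x i) = (\<Sum>i\<in>{n..<N+M}. (if i < N then r i else 0) * x i)"
      by (rule sum.mono_neutral_cong_left) auto
    moreover have "(\<Sum>i\<in>{n..<M}. q i * x i) = (\<Sum>i\<in>{n..<N+M}. (if i < M then q i else 0) * x i)"
      by (rule sum.mono_neutral_cong_left) auto
    ultimately have "(u + v) - (\<Sum>i\<in>{n..<N+M}.
        ((if i < N then r i else 0) + (if i < M then q i else 0)) * x i) \<in> B"
      by (simp add: distrib_right sum.distrib algebra_simps)
    then show "u + v \<in> I n" unfolding I_def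
      by (intro CollectI exI[of _ "N + M"] exI[of _ "\<lambda>i. (if i < N then r i else 0) + (if i < M then q i else 0)"])
  next
    fix c v assume "v \<in> I n"
    then obtain N r where "v - (\<Sum>i\<in>{n..<N}. r i * x i) \<in> B" unfolding I_def by blast
    then have "c * (v - (\<Sum>i\<in>{n..<N}. r i * x i)) \<in> B" by (rule ring_module.subspace_scale[OF B])
    then have "c * v - (\<Sum>i\<in>{n..<N}. (c * r i) * x i) \<in> B"
      by (simp add: right_diff_distrib sum_distrib_left mult.assoc)
    then show "c * v \<in> I n" unfolding I_def
      by (intro CollectI exI[of _ N] exI[of _ "\<lambda>i. c * r i"])
  qed
  have "decseq I"
  proof (rule decseq_SucI, rule subsetI)
    fix n v assume "v \<in> I (Suc n)"
    then obtain N r where r: "v - (\<Sum>i\<in>{Suc n..<N}. r i * x i) \<in> B" unfolding I_def by blast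
    have "(\<Sum>i\<in>{Suc n..<N}. r i * x i) = (\<Sum>i\<in>{n..<N}. (if i = n then 0 else r i) * x i)"
      by (rule sum.mono_neutral_cong_left) auto
    with r show "v \<in> I n" unfolding I_def
      by (intro CollectI exI[of _ N] exI[of _ "\<lambda>i. if i = n then 0 else r i"]) simp
  qed
  then obtain k where k: "\<forall>n\<ge>k. I n = I k" using artinian[of I] Iideal by blast
  have "x k \<in> I k"
    unfolding I_def using ring_module.subspace_0[OF B]
    by (intro CollectI exI[of _ "Suc k"] exI[of _ "\<lambda>_. 1"]) simp
  moreover have "I (Suc k) = I k" using k by (blast intro: le_SucI)
  ultimately have "x k \<in> I (Suc k)" by (simp only:)
  then obtain N r where r: "x k - (\<Sum>i\<in>{Suc k..<N}. r i * x i) \<in> B" unfolding I_def by blast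
  \<comment> \<open>The relation as a coefficient family on an initial segment, with
    \<open>1\<close> at \<open>k\<close>. The length \<open>N + Suc k\<close> includes
    \<open>k\<close> even if \<open>N \<le> k\<close>.\<close>
  define q where "q i = (if i = k then 1 else if k < i \<and> i < N then - r i else 0)" for i
  have "(\<Sum>i<N + Suc k. q i * x i) = q k * x k + (\<Sum>i\<in>{..<N + Suc k} - {k}. q i * x i)"
    by (intro sum.remove) auto
  also have "(\<Sum>i\<in>{..<N + Suc k} - {k}. q i * x i) = (\<Sum>i\<in>{Suc k..<N}. - (r i * x i))"
    by (rule sum.mono_neutral_cong_right) (auto simp: q_def)
  also have "q k * x k + (\<Sum>i\<in>{Suc k..<N}. - (r i * x i)) = x k - (\<Sum>i\<in>{Suc k..<N}. r i * x i)"
    by (simp add: q_def sum_negf)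
  finally have "(\<Sum>i<N + Suc k. q i * x i) \<in> B" using r by simp
  with ind[of "N + Suc k" x] x have "\<forall>i\<in>{..<N + Suc k}. q i \<in> \<mm>" unfolding ring.indep_def by blast
  then have "q k \<in> \<mm>" by simp
  then show False using one_notin by (simp add: q_def)
qed

end

section \<open>Nakayama's lemma over an Artinian local ring\<close>

locale artinian_local_module = artinian_local_ring \<mm> + module scale
  for \<mm> :: "'a::comm_ring_1 set"
    and scale :: "'a \<Rightarrow> 'b::ab_group_add \<Rightarrow> 'b" (infixr \<open>*s\<close> 75)
begin

sublocale local_module \<mm> scale ..

text \<open>Noetherian induction on the principal ideals \<open>(r)\<close> shows \<open>r U \<subseteq> W\<close>: multiplying \<open>r \<noteq> 0\<close> by an
  element of \<open>\<mm>\<close> makes the ideal strictly smaller.\<close>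

lemma nakayama:
  assumes W: "subspace W" and U: "U \<subseteq> {w + v | w v. w \<in> W \<and> v \<in> ideal_mult scale \<mm> U}"
  shows "U \<subseteq> W"
proof -
  have "\<forall>u\<in>U. r *s u \<in> W" for r
  proof (induction r rule: wf_induct_rule[OF wf_inv_image[OF wf_ideals, of "\<lambda>r. range (\<lambda>c. c * r)"]])
    case (1 r)
    have principal: "ideal (range (\<lambda>c. c * q))" for q :: 'a
      using ring_module.subspace_span[of "{q}"] by (simp add: ring_module.span_singleton)
    have mU: "ideal_mult scale \<mm> U \<subseteq> {v. r *s v \<in> W}"
    proof (rule ideal_mult_minimal)
      fix x u assume x: "x \<in> \<mm>" and u: "u \<in> U"
      show "x *s u \<in> {v. r *s v \<in> W}"
      proof (cases "r = 0")
        case True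
        then show ?thesis using subspace_0[OF W] by simp
      next
        case False
        have "range (\<lambda>c. c * (r * x)) \<subset> range (\<lambda>c. c * r)"
        proof
          show "range (\<lambda>c. c * (r * x)) \<subseteq> range (\<lambda>c. c * r)"
            by (auto intro!: rangeI simp: image_iff) (metis mult.assoc mult.commute)
          show "range (\<lambda>c. c * (r * x)) \<noteq> range (\<lambda>c. c * r)"
          proof
            assume "range (\<lambda>c. c * (r * x)) = range (\<lambda>c. c * r)"
            moreover have "1 * r \<in> range (\<lambda>c. c * r)" by (rule rangeI)
            ultimately obtain c where c: "1 * r = c * (r * x)" by blast
            \<comment> \<open>From \<open>r = c * (r * x)\<close> follows
              \<open>(1 - c * x) * r = 0\<close>, where \<open>1 - c * x\<close> is a unit; this
              contradicts \<open>r \<noteq> 0\<close>.\<close>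
            have "1 - c * x \<notin> \<mm>"
              using one_notin add_in[of "1 - c * x" "c * x"] mult_in[OF x] by auto
            then obtain y where y: "y * (1 - c * x) = 1" by (rule unitE)
            have "r = (y * (1 - c * x)) * r" using y by simp
            also have "\<dots> = y * (r - c * (r * x))"
              by (simp only: mult.assoc left_diff_distrib mult_1_left mult.commute[of x r])
            also have "\<dots> = 0" unfolding c[symmetric] by simp
            finally show False using False by simp
          qed
        qed
        then have "\<forall>u\<in>U. (r * x) *s u \<in> W" using 1[of "r * x"] principal by (simp add: in_inv_image)
        then show ?thesis using u by simp
      qed
    next
      show "subspace {v. r *s v \<in> W}"
      proof (rule subspaceI)
        fix c v assume "v \<in> {v. r *s v \<in> W}"
        then show "c *s v \<in> {v. r *s v \<in> W}"
          using subspace_scale[OF W, of "r *s v" c] by (simp add: mult.commute)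
      qed (auto simp: scale_right_distrib intro: subspace_0[OF W] subspace_add[OF W])
    qed
    show ?case
    proof
      fix u assume "u \<in> U"
      then obtain w v where wv: "u = w + v" "w \<in> W" "v \<in> ideal_mult scale \<mm> U" using U by blast
      show "r *s u \<in> W"
        unfolding wv(1) scale_right_distrib
        using mU wv subspace_add[OF W] subspace_scale[OF W] by auto
    qed
  qed
  from this[of 1] show ?thesis by auto
qed

end

section \<open>Ext through cocycles on generators\<close>

text \<open>Generators \<open>Rel xs\<close> store lists, so a cochain given on generators is
  evaluated directly on these; by \<open>linear_extension_combination\<close> this agrees with its
  linear extension.\<close>

definition comb :: "('a::comm_ring_1 \<Rightarrow> 'c::ab_group_add \<Rightarrow> 'c) \<Rightarrow> ('g \<Rightarrow> 'c) \<Rightarrow> ('a \<times> 'g) list \<Rightarrow> 'c"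
  where "comb t \<phi> xs = (\<Sum>(c, g)\<leftarrow>xs. t c (\<phi> g))"

text \<open>The differential of the Hom complex, on generators. The value at \<open>Elem x\<close>
  reflects that there are no cochains in degree \<open>-1\<close>; hence \<open>BB 0\<close> below
  consists of the functions with values in \<open>\<mm>\<close> on
  \<open>gens scale 0\<close>.\<close>

definition codiff :: "('a::comm_ring_1 \<Rightarrow> 'c::ab_group_add \<Rightarrow> 'c) \<Rightarrow> (('a, 'b) gen \<Rightarrow> 'c) \<Rightarrow> ('a, 'b) gen \<Rightarrow> 'c"
  where "codiff t \<phi> g = (case g of Elem x \<Rightarrow> 0 | Rel xs \<Rightarrow> comb t \<phi> xs)"

lemma codiff_Rel [simp]: "codiff t \<phi> (Rel xs) = comb t \<phi> xs"
  by (simp add: codiff_def)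

lemma comb_Nil [simp]: "comb t \<phi> [] = 0"
  and comb_Cons [simp]: "comb t \<phi> ((c, g) # xs) = t c (\<phi> g) + comb t \<phi> xs"
  and comb_append [simp]: "comb t \<phi> (xs @ ys) = comb t \<phi> xs + comb t \<phi> ys"
  by (simp_all add: comb_def)

lemma comb_cong: "(\<And>c g. (c, g) \<in> set xs \<Longrightarrow> t c (\<phi> g) = t' c (\<psi> g)) \<Longrightarrow> comb t \<phi> xs = comb t' \<psi> xs"
  unfolding comb_def by (intro arg_cong[of _ _ sum_list] map_cong) auto

lemma comb_map: "comb t \<phi> (map (\<lambda>x. (f x, g x)) xs) = (\<Sum>x\<leftarrow>xs. t (f x) (\<phi> (g x)))"
  by (simp add: comb_def comp_def)

context module
begin

lemma comb_add: "comb scale (\<lambda>g. \<phi> g + \<psi> g) xs = comb scale \<phi> xs + comb scale \<psi> xs"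
  by (induction xs) (auto simp: scale_right_distrib)

lemma comb_diff: "comb scale (\<lambda>g. \<phi> g - \<psi> g) xs = comb scale \<phi> xs - comb scale \<psi> xs"
  by (induction xs) (auto simp: scale_right_diff_distrib)

lemma comb_scale: "comb scale (\<lambda>g. scale c (\<phi> g)) xs = scale c (comb scale \<phi> xs)"
  by (induction xs) (auto simp: scale_right_distrib mult.commute)

lemma comb_sum: "comb scale (\<lambda>g. \<Sum>i\<in>I. \<phi> i g) xs = (\<Sum>i\<in>I. comb scale (\<phi> i) xs)"
  by (induction xs) (auto simp: scale_sum_right sum.distrib)

lemma comb_scale_left: "comb scale (\<lambda>g. scale (f g) v) xs = scale (comb (*) f xs) v"
  by (induction xs) (auto simp: scale_left_distrib)

lemma linear_extension_combination:
  "linear_extension scale \<phi> (combination xs) = comb scale \<phi> xs"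
proof -
  interpret L: module_hom scale_free scale "linear_extension scale \<phi>"
    by (rule module_hom_linear_extension)
  show ?thesis
    by (induction xs) (auto simp: combination_def L.add)
qed

lemma linear_extension_boundary:
  "linear_extension scale \<phi> (boundary p) = linear_extension scale (codiff scale \<phi>) p"
proof -
  interpret L: module_hom scale_free scale "linear_extension scale \<phi>"
    by (rule module_hom_linear_extension)
  show ?thesis
    unfolding boundary_def linear_extension_def[of scale_free] L.sum L.scale
    unfolding linear_extension_def[of scale "codiff scale \<phi>"]
    by (intro sum.cong refl arg_cong[of _ _ "scale _"])
      (auto simp: codiff_def linear_extension_combination split: gen.split)
qed

text \<open>The square of the differential is zero. In the lowest degree the entries have the form
  \<open>Elem x\<close>, where \<open>codiff\<close> is \<open>0\<close>; above it,
  \<open>combination ys\<close> is a cycle for \<open>boundary\<close>.\<close>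

lemma comb_codiff:
  assumes "Rel ys \<in> gens s (Suc n)"
  shows "comb scale (codiff scale \<psi>) ys = 0"
proof (cases n)
  case 0
  then have "codiff scale \<psi> g = 0" if "(c, g) \<in> set ys" for c g
    using assms that by (auto simp: codiff_def)
  then have "comb scale (codiff scale \<psi>) ys = comb scale (\<lambda>_. 0) ys" by (intro comb_cong) auto
  also have "\<dots> = 0" by (induction ys) auto
  finally show ?thesis .
next
  case (Suc m)
  interpret L: module_hom scale_free scale "linear_extension scale \<psi>"
    by (rule module_hom_linear_extension)
  have "comb scale (codiff scale \<psi>) ys = linear_extension scale \<psi> (boundary (combination ys))"
    by (simp add: linear_extension_boundary linear_extension_combination)
  also have "boundary (combination ys) = 0" using assms Suc by simp
  finally show ?thesis by simp
qed

end

lemma comb_augmentation: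
  assumes "module s" "Rel xs \<in> gens s (Suc 0)"
  shows "comb s (\<lambda>g. case g of Elem x \<Rightarrow> x | Rel xs \<Rightarrow> 0) xs = 0"
  using assms by (simp add: augmentation_def module.linear_extension_combination)

text \<open>\<open>exact_at s t n\<close> expresses that \<open>Ext\<^sup>n\<close> vanishes, with cochains written as functions on the
  generators.\<close>

definition exact_at ::
    "('a::comm_ring_1 \<Rightarrow> 'b::ab_group_add \<Rightarrow> 'b) \<Rightarrow> ('a \<Rightarrow> 'c::ab_group_add \<Rightarrow> 'c) \<Rightarrow> nat \<Rightarrow> bool"
  where "exact_at s t n \<longleftrightarrow> (\<forall>\<phi>. (\<forall>ys. Rel ys \<in> gens s (Suc n) \<longrightarrow> comb t \<phi> ys = 0) \<longrightarrow>
    (\<exists>\<psi>. \<forall>xs. Rel xs \<in> gens s n \<longrightarrow> \<phi> (Rel xs) = comb t \<psi> xs))"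

lemma exact_atE:
  assumes "exact_at s t n" "\<And>ys. Rel ys \<in> gens s (Suc n) \<Longrightarrow> comb t \<phi> ys = 0"
  obtains \<psi> where "\<And>xs. Rel xs \<in> gens s n \<Longrightarrow> \<phi> (Rel xs) = comb t \<psi> xs"
  using assms unfolding exact_at_def by metis

text \<open>\<open>\<phi>\<close> extends linearly to a cocycle, and a cochain bounding it is
  recovered from its values on the basis elements \<open>Poly_Mapping.single g 1\<close>.\<close>

lemma Ext_zero_imp_exact_at:
  assumes s: "module s" and t: "module t" and zero: "Ext_zero (Suc n) s t"
  shows "exact_at s t (Suc n)"
  unfolding exact_at_def
proof (intro allI impI)
  fix \<phi> assume "\<forall>ys. Rel ys \<in> gens s (Suc (Suc n)) \<longrightarrow> comb t \<phi> ys = 0"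
  then have \<phi>: "\<And>ys. Rel ys \<in> gens s (Suc (Suc n)) \<Longrightarrow> comb t \<phi> ys = 0" by blast
  interpret N: module t by fact
  interpret L: module_hom scale_free t "linear_extension t \<phi>"
    by (rule N.module_hom_linear_extension)
  define f where "f = (\<lambda>p\<in>free_res s (Suc n). linear_extension t \<phi> p)"
  have "f \<in> cocycles s t (Suc n)"
    unfolding cocycles_def
  proof (intro CollectI conjI ballI)
    show "f \<in> cochains s t (Suc n)"
      by (simp add: cochains_def f_def free_res_add free_res_scale L.add L.scale)
  next
    fix p assume p: "p \<in> free_res s (Suc (Suc n))"
    have "codiff t \<phi> g = 0" if "g \<in> Poly_Mapping.keys p" for g
    proof -
      have g: "g \<in> gens s (Suc (Suc n))" using that p unfolding free_res_def by blast
      then obtain ys where ys: "g = Rel ys" by auto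
      show ?thesis using \<phi>[of ys] g unfolding ys codiff_Rel by blast
    qed
    then have "linear_extension t \<phi> (boundary p) = 0"
      unfolding N.linear_extension_boundary by (simp add: linear_extension_def)
    then show "f (boundary p) = 0"
      using boundary_in_free_res[OF s p] by (simp add: f_def)
  qed
  then have "f \<in> coboundaries s t (Suc n)"
    using zero unfolding Ext_zero_iff[OF s t] by simp
  then obtain h where h: "h \<in> cochains s t n" "f = (\<lambda>p\<in>free_res s (Suc n). h (boundary p))"
    by auto
  have add: "h (p + q) = h p + h q" if "p \<in> free_res s n" "q \<in> free_res s n" for p q
    using h(1) that by (simp add: cochains_def)
  have sc: "h (scale_free r p) = t r (h p)" if "p \<in> free_res s n" for r p
    using h(1) that by (simp add: cochains_def)
  have h_comb: "h (combination xs) = comb t (\<lambda>g. h (Poly_Mapping.single g 1)) xs"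
    if "snd ` set xs \<subseteq> gens s n" for xs
    using that
  proof (induction xs)
    case Nil
    have "h (scale_free 0 0) = t 0 (h 0)" by (rule sc) (rule free_res_0)
    then show ?case
      by (simp add: combination_def module.scale_zero_left[OF module_scale_free])
  next
    case (Cons x xs)
    obtain c g where x: "x = (c, g)" by (cases x)
    have g: "Poly_Mapping.single g a \<in> free_res s n" for a
      using Cons.prems by (simp add: x free_res_def)
    have "Poly_Mapping.single g c = scale_free c (Poly_Mapping.single g 1)"
      by (rule poly_mapping_eqI) (simp add: lookup_single when_def)
    then have "h (Poly_Mapping.single g c) = t c (h (Poly_Mapping.single g 1))"
      using sc[OF g] by simp
    moreover have "combination (x # xs) = Poly_Mapping.single g c + combination xs"
      by (simp add: x combination_def)
    moreover have "combination xs \<in> free_res s n"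
      using Cons.prems by (intro combination_in_free_res) auto
    ultimately show ?case using Cons g by (simp add: x add)
  qed
  show "\<exists>\<psi>. \<forall>xs. Rel xs \<in> gens s (Suc n) \<longrightarrow> \<phi> (Rel xs) = comb t \<psi> xs"
  proof (intro exI[of _ "\<lambda>g. h (Poly_Mapping.single g 1)"] allI impI)
    fix xs assume xs: "Rel xs \<in> gens s (Suc n)"
    let ?p = "Poly_Mapping.single (Rel xs) 1"
    have p: "?p \<in> free_res s (Suc n)" using xs by (simp add: free_res_def)
    have "\<phi> (Rel xs) = f ?p" using p by (simp add: f_def)
    also have "\<dots> = h (boundary ?p)" using p by (simp add: h(2))
    also have "boundary ?p = combination xs"
      by (simp add: boundary_def module.linear_extension_single[OF module_scale_free]
          module.scale_one[OF module_scale_free])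
    also have "h \<dots> = comb t (\<lambda>g. h (Poly_Mapping.single g 1)) xs"
      using xs by (intro h_comb) auto
    finally show "\<phi> (Rel xs) = comb t (\<lambda>g. h (Poly_Mapping.single g 1)) xs" .
  qed
qed

text \<open>A cocycle in one factor is padded with \<open>0\<close> in the other, and the bounding
  cochain is projected.\<close>

lemma Ext_zero_prod_imp_exact_at:
  assumes s: "module s" and t: "module t" "module u"
    and zero: "Ext_zero (Suc n) s (module_prod.scale t u)"
  shows "exact_at s t (Suc n)" "exact_at s u (Suc n)"
proof -
  interpret P: module_prod t u using t by (simp add: module_prod_def module_pair_def)
  have c: "comb P.scale \<psi> xs = (comb t (\<lambda>g. fst (\<psi> g)) xs, comb u (\<lambda>g. snd (\<psi> g)) xs)"
    for \<psi> :: "'e \<Rightarrow> _" and xs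
    by (induction xs) (auto simp: P.scale_def zero_prod_def)
  have c0: "comb t (\<lambda>g. 0) xs = 0" "comb u (\<lambda>g. 0) xs = 0" for xs :: "('a \<times> 'e) list"
    by (induction xs) auto
  have ex: "exact_at s P.scale (Suc n)"
    by (rule Ext_zero_imp_exact_at[OF s P.p.module_axioms zero])
  show "exact_at s t (Suc n)"
    unfolding exact_at_def
  proof (intro allI impI)
    fix \<phi> assume "\<forall>ys. Rel ys \<in> gens s (Suc (Suc n)) \<longrightarrow> comb t \<phi> ys = 0"
    then obtain \<psi> where \<psi>: "\<And>xs. Rel xs \<in> gens s (Suc n) \<Longrightarrow> (\<phi> (Rel xs), 0) = comb P.scale \<psi> xs"
      by (rule_tac exact_atE[OF ex, of "\<lambda>g. (\<phi> g, 0)"]) (auto simp only: c c0 zero_prod_def fst_conv snd_conv)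
    show "\<exists>\<psi>. \<forall>xs. Rel xs \<in> gens s (Suc n) \<longrightarrow> \<phi> (Rel xs) = comb t \<psi> xs"
      using \<psi> by (intro exI[of _ "\<lambda>g. fst (\<psi> g)"]) (simp only: c prod.inject, blast)
  qed
  show "exact_at s u (Suc n)"
    unfolding exact_at_def
  proof (intro allI impI)
    fix \<phi> assume "\<forall>ys. Rel ys \<in> gens s (Suc (Suc n)) \<longrightarrow> comb u \<phi> ys = 0"
    then obtain \<psi> where \<psi>: "\<And>xs. Rel xs \<in> gens s (Suc n) \<Longrightarrow> (0, \<phi> (Rel xs)) = comb P.scale \<psi> xs"
      by (rule_tac exact_atE[OF ex, of "\<lambda>g. (0, \<phi> g)"]) (auto simp only: c c0 zero_prod_def fst_conv snd_conv)
    show "\<exists>\<psi>. \<forall>xs. Rel xs \<in> gens s (Suc n) \<longrightarrow> \<phi> (Rel xs) = comb u \<psi> xs"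
      using \<psi> by (intro exI[of _ "\<lambda>g. snd (\<psi> g)"]) (simp only: c prod.inject, blast)
  qed
qed

section \<open>The first syzygy\<close>

definition vscale :: "'a::comm_ring_1 \<Rightarrow> ('x \<Rightarrow> 'a) \<Rightarrow> 'x \<Rightarrow> 'a"
  where "vscale r f = (\<lambda>x. r * f x)"

lemma vscale_apply [simp]: "vscale r f x = r * f x"
  by (simp add: vscale_def)

lemma module_vscale: "module vscale"
  by standard (auto simp: fun_eq_iff algebra_simps)

lemma minus_fun_apply [simp]: "(f - g) x = f x - (g x :: 'c::ab_group_add)"
  by (simp add: fun_diff_def)

lemma sum_fun_apply [simp]: "(\<Sum>i\<in>I. f i) x = (\<Sum>i\<in>I. f i x :: 'c::comm_monoid_add)"
  by (induction I rule: infinite_finite_induct) auto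

lemma (in module) comb_in_subspace:
  assumes "subspace S" "\<And>g. g \<in> snd ` set xs \<Longrightarrow> \<phi> g \<in> S"
  shows "comb scale \<phi> xs \<in> S"
  using assms(2)
  by (induction xs) (auto intro!: subspace_0[OF assms(1)] subspace_add[OF assms(1)] subspace_scale[OF assms(1)])

text \<open>\<open>Y\<close> is a minimal generating set of \<open>M\<close>; its independence
  modulo \<open>\<mm> M\<close> is what keeps the syzygies inside \<open>\<mm> F\<close>.\<close>

locale syzygy = artinian_local_module \<mm> scale
  for \<mm> :: "'a::comm_ring_1 set"
    and scale :: "'a \<Rightarrow> 'b::ab_group_add \<Rightarrow> 'b" (infixr \<open>*s\<close> 75) +
  fixes Y :: "'b set"
  assumes finite_Y: "finite Y"
    and span_Y: "span Y = UNIV"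
    and indep_Y: "indep (ideal_mult scale \<mm> UNIV) Y (\<lambda>y. y)"
    and square_zero: "ideal_mult scale (ideal_mult (*) \<mm> \<mm>) UNIV = {0}"
begin

sublocale vec: local_module \<mm> "vscale :: 'a \<Rightarrow> ('b \<Rightarrow> 'a) \<Rightarrow> 'b \<Rightarrow> 'a"
  by (intro local_module.intro module_vscale) unfold_locales

abbreviation mM :: "'b set" where "mM \<equiv> ideal_mult scale \<mm> UNIV"
abbreviation m2 :: "'a set" where "m2 \<equiv> ideal_mult (*) \<mm> \<mm>"
abbreviation m3 :: "'a set" where "m3 \<equiv> ideal_mult (*) \<mm> m2"

text \<open>The free module \<open>F = R\<^sup>Y\<close> consists of the functions that vanish outside \<open>Y\<close>; \<open>FF I\<close> is \<open>I F\<close>, and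
  \<open>U\<close> is the kernel of \<open>F \<rightarrow> M\<close>.\<close>

definition FF :: "'a set \<Rightarrow> ('b \<Rightarrow> 'a) set"
  where "FF I = {v. (\<forall>y. v y \<in> I) \<and> (\<forall>y. y \<notin> Y \<longrightarrow> v y = 0)}"

definition ev :: "('b \<Rightarrow> 'a) \<Rightarrow> 'b"
  where "ev v = (\<Sum>y\<in>Y. v y *s y)"

definition U :: "('b \<Rightarrow> 'a) set"
  where "U = {v \<in> FF UNIV. ev v = 0}"

abbreviation mU :: "('b \<Rightarrow> 'a) set" where "mU \<equiv> ideal_mult vscale \<mm> U"

definition unit_vec :: "'b \<Rightarrow> 'b \<Rightarrow> 'a"
  where "unit_vec y = (\<lambda>x. if x = y then 1 else 0)"

lemma ideal_mult_ring: "ideal (ideal_mult (*) I J)"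
  unfolding ideal_mult_def by simp

lemma in_ideal_mult_ring: "a \<in> I \<Longrightarrow> b \<in> J \<Longrightarrow> a * b \<in> ideal_mult (*) I J"
  unfolding ideal_mult_def by (intro ring_module.span_base) blast

lemma ideal_mult_ring_minimal:
  assumes "\<And>a x. a \<in> I \<Longrightarrow> x \<in> J \<Longrightarrow> a * x \<in> S" "ideal S"
  shows "ideal_mult (*) I J \<subseteq> S"
  unfolding ideal_mult_def by (intro ring_module.span_minimal) (use assms in auto)

lemma m2_scale: "r \<in> m2 \<Longrightarrow> r *s x = 0"
  using in_ideal_mult[of r m2 x UNIV] square_zero by blast

lemma m_mM:
  assumes "r \<in> \<mm>" "x \<in> mM"
  shows "r *s x = 0"
proof -
  have "mM \<subseteq> {x. r *s x = 0}"
  proof (rule ideal_mult_minimal)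
    fix a x assume "a \<in> \<mm>"
    then show "a *s x \<in> {x. r *s x = 0}"
      using m2_scale[OF in_ideal_mult_ring[OF assms(1)], of a x] by simp
  next
    show "subspace {x. r *s x = 0}"
      by (rule subspaceI) (simp_all add: scale_right_distrib scale_left_commute[of r] del: scale_scale)
  qed
  then show ?thesis using assms(2) by blast
qed

lemma subspace_mM: "subspace mM"
  by (rule subspace_ideal_mult)

lemma ev_add: "ev (u + v) = ev u + ev v"
  and ev_scale: "ev (vscale r u) = r *s ev u"
  and ev_diff: "ev (u - v) = ev u - ev v"
  by (simp_all add: ev_def scale_left_distrib scale_left_diff_distrib sum.distrib sum_subtractf scale_sum_right)

lemma ev_sum: "ev (\<Sum>i\<in>I. f i) = (\<Sum>i\<in>I. ev (f i))"
  unfolding ev_def sum_fun_apply scale_sum_left by (rule sum.swap)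

lemma subspace_FF: "ideal I \<Longrightarrow> vec.subspace (FF I)"
  by (rule vec.subspaceI)
    (auto simp: FF_def ring_module.subspace_0 ring_module.subspace_add ring_module.subspace_scale)

lemma FF_mono: "I \<subseteq> J \<Longrightarrow> FF I \<subseteq> FF J"
  by (auto simp: FF_def)

lemma subspace_U: "vec.subspace U"
proof (rule vec.subspaceI)
  show "0 \<in> U" by (simp add: U_def FF_def ev_def)
qed (auto simp: U_def ev_add ev_scale FF_def)

lemma U_le: "U \<subseteq> FF \<mm>"
proof
  fix u assume u: "u \<in> U"
  then have "(\<Sum>y\<in>Y. u y *s y) \<in> mM" using subspace_0[OF subspace_mM] by (simp add: U_def ev_def)
  then have "u y \<in> \<mm>" if "y \<in> Y" for y using indepD[OF indep_Y] that by blast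
  moreover have 0: "u y = 0" if "y \<notin> Y" for y using u that by (simp add: U_def FF_def)
  ultimately have "u y \<in> \<mm>" for y using zero_in by (cases "y \<in> Y") simp_all
  then show "u \<in> FF \<mm>" using 0 by (simp add: FF_def)
qed

lemma FF_m2_le: "FF m2 \<subseteq> U"
  by (auto simp: U_def FF_def ev_def m2_scale)

lemma kills_FF: "vec.kills (FF I) (FF (ideal_mult (*) \<mm> I))"
  unfolding vec.kills_def by (auto simp: FF_def in_ideal_mult_ring)

lemma mU_le: "mU \<subseteq> FF m2"
  by (rule vec.ideal_mult_minimal[OF _ subspace_FF[OF ideal_mult_ring]])
    (use U_le vec.killsD[OF kills_FF] in blast)

lemma FF_decompose:
  assumes "v \<in> FF I"
  shows "v = (\<Sum>y\<in>Y. vscale (v y) (unit_vec y))"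
proof
  fix x
  have "(\<Sum>y\<in>Y. v y * unit_vec y x) = (\<Sum>y\<in>Y. if x = y then v y else 0)"
    by (intro sum.cong) (auto simp: unit_vec_def)
  also have "\<dots> = v x" using assms finite_Y by (auto simp: FF_def)
  finally show "v x = (\<Sum>y\<in>Y. vscale (v y) (unit_vec y)) x" by simp
qed

lemma scale_unit_vec: "ideal I \<Longrightarrow> r \<in> I \<Longrightarrow> y \<in> Y \<Longrightarrow> vscale r (unit_vec y) \<in> FF I"
  by (auto simp: FF_def unit_vec_def ring_module.subspace_0)

text \<open>Multiply \<open>FF m2 \<subseteq> U\<close> by \<open>\<mm>\<close>, one basis vector of
  \<open>F\<close> at a time.\<close>

lemma FF_m3_le: "FF m3 \<subseteq> mU"
proof
  fix v assume v: "v \<in> FF m3"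
  have "m3 \<subseteq> {r. vscale r (unit_vec y) \<in> mU}" if y: "y \<in> Y" for y
  proof (rule ideal_mult_ring_minimal)
    fix a x assume a: "a \<in> \<mm>" and "x \<in> m2"
    then have "vscale x (unit_vec y) \<in> U"
      using FF_m2_le scale_unit_vec[OF ideal_mult_ring _ y] by blast
    from vec.in_ideal_mult[OF a this] show "a * x \<in> {r. vscale r (unit_vec y) \<in> mU}" by simp
  next
    note S = vec.subspace_ideal_mult[of \<mm> U]
    show "ideal {r. vscale r (unit_vec y) \<in> mU}"
    proof (rule ring_module.subspaceI)
      fix c r assume "r \<in> {r. vscale r (unit_vec y) \<in> mU}"
      then show "c * r \<in> {r. vscale r (unit_vec y) \<in> mU}"
        using vec.subspace_scale[OF S, of "vscale r (unit_vec y)" c] by simp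
    qed (auto simp: vec.scale_left_distrib intro: vec.subspace_0[OF S] vec.subspace_add[OF S])
  qed
  then have "vscale (v y) (unit_vec y) \<in> mU" if "y \<in> Y" for y using v that by (auto simp: FF_def)
  then have "(\<Sum>y\<in>Y. vscale (v y) (unit_vec y)) \<in> mU"
    by (intro vec.subspace_sum[OF vec.subspace_ideal_mult])
  then show "v \<in> mU" using FF_decompose[OF v] by simp
qed

section \<open>Comparison of the standard resolution with the minimal cover\<close>

lemma ex_coord: "\<exists>v. v \<in> FF UNIV \<and> ev v = x"
proof -
  have "x \<in> span Y" using span_Y by simp
  then obtain r where r: "x = (\<Sum>y\<in>Y. r y *s y)" unfolding span_finite[OF finite_Y] by auto
  show ?thesis
    by (rule exI[of _ "\<lambda>y. if y \<in> Y then r y else 0"])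
      (auto simp: FF_def ev_def r intro!: sum.cong)
qed

text \<open>A section of \<open>ev\<close>. It is prescribed on \<open>Y\<close> so that
  \<open>rel_vec\<close> sends the relation built from a syzygy \<open>u\<close> back to
  \<open>u\<close> itself.\<close>

definition coord :: "'b \<Rightarrow> 'b \<Rightarrow> 'a"
  where "coord x = (if x \<in> Y then unit_vec x else (SOME v. v \<in> FF UNIV \<and> ev v = x))"

lemma ev_unit_vec: "y \<in> Y \<Longrightarrow> ev (unit_vec y) = y"
proof -
  assume "y \<in> Y"
  have "(\<Sum>x\<in>Y. unit_vec y x *s x) = (\<Sum>x\<in>Y. if x = y then x else 0)"
    by (intro sum.cong) (auto simp: unit_vec_def)
  then show ?thesis using \<open>y \<in> Y\<close> finite_Y by (simp add: ev_def)
qed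

lemma coord_in: "coord x \<in> FF UNIV" and ev_coord: "ev (coord x) = x"
  using someI_ex[OF ex_coord[of x]] ev_unit_vec[of x]
  by (auto simp: coord_def) (auto simp: FF_def unit_vec_def)

text \<open>\<open>gen_coord\<close> lifts the identity of \<open>M\<close> to a map from
  \<open>F\<^sub>0\<close> to \<open>F\<close>, and \<open>rel_vec\<close> is the induced map from
  \<open>F\<^sub>1\<close> onto \<open>U\<close>. The latter vanishes on boundaries from
  \<open>F\<^sub>2\<close>, so composing it with a homomorphism on \<open>U\<close> gives a
  1-cocycle.\<close>

definition gen_coord :: "('a, 'b) gen \<Rightarrow> 'b \<Rightarrow> 'a"
  where "gen_coord g = (case g of Elem x \<Rightarrow> coord x | Rel xs \<Rightarrow> 0)"

definition rel_vec :: "('a, 'b) gen \<Rightarrow> 'b \<Rightarrow> 'a"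
  where "rel_vec = codiff vscale gen_coord"

lemma ev_comb: "ev (comb vscale \<phi> xs) = comb scale (\<lambda>g. ev (\<phi> g)) xs"
proof (induction xs)
  case Nil
  then show ?case by (simp add: ev_def)
next
  case (Cons x xs)
  then show ?case by (cases x) (simp only: comb_Cons ev_add ev_scale)
qed

lemma rel_vec_in:
  assumes "g \<in> gens scale (Suc 0)"
  shows "rel_vec g \<in> U"
proof -
  obtain xs where g: "g = Rel xs" using assms by auto
  have "gen_coord h \<in> FF UNIV" for h
    by (cases h) (auto simp: gen_coord_def coord_in, auto simp: FF_def)
  then have "comb vscale gen_coord xs \<in> FF UNIV"
    by (intro vec.comb_in_subspace subspace_FF) auto
  moreover have "(\<lambda>h. ev (gen_coord h)) = (\<lambda>h. case h of Elem x \<Rightarrow> x | Rel xs \<Rightarrow> 0)"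
    by (auto simp: gen_coord_def ev_coord fun_eq_iff split: gen.split) (simp add: ev_def)
  then have "ev (comb vscale gen_coord xs) = 0"
    using comb_augmentation[OF module_axioms assms[unfolded g]] by (simp add: ev_comb)
  ultimately show ?thesis by (simp add: U_def rel_vec_def g)
qed

lemma comb_rel_vec: "Rel ys \<in> gens scale (Suc (Suc 0)) \<Longrightarrow> comb vscale rel_vec ys = 0"
  unfolding rel_vec_def by (rule vec.comb_codiff)

definition Y_list :: "'b list"
  where "Y_list = (SOME ys. set ys = Y \<and> distinct ys)"

lemma Y_list: "set Y_list = Y" "distinct Y_list"
  using someI_ex[OF finite_distinct_list[OF finite_Y]] by (auto simp: Y_list_def)

text \<open>For a syzygy \<open>u\<close>, the generator \<open>Rel (combo u)\<close> of
  \<open>F\<^sub>1\<close> represents it; \<open>Y_list\<close> fixes an order because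
  \<open>Rel\<close> takes a list.\<close>

definition combo :: "('b \<Rightarrow> 'a) \<Rightarrow> ('a \<times> ('a, 'b) gen) list"
  where "combo u = map (\<lambda>y. (u y, Elem y)) Y_list"

lemma comb_combo: "comb t \<phi> (combo u) = (\<Sum>y\<in>Y. t (u y) (\<phi> (Elem y)))"
  by (simp add: combo_def comb_map sum_list_distinct_conv_sum_set Y_list)

lemma augmentation_comb:
  "augmentation scale (combination xs) = comb scale (\<lambda>g. case g of Elem x \<Rightarrow> x | Rel xs \<Rightarrow> 0) xs"
  by (simp add: augmentation_def linear_extension_combination)

lemma combo_in_gens:
  assumes "u \<in> U"
  shows "Rel (combo u) \<in> gens scale (Suc 0)"
proof -
  have "augmentation scale (combination (combo u)) = 0"
    using assms unfolding augmentation_comb comb_combo by (simp add: U_def ev_def)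
  then show ?thesis by (auto simp: combo_def)
qed

lemma rel_vec_combo:
  assumes "u \<in> U"
  shows "rel_vec (Rel (combo u)) = u"
proof -
  have "rel_vec (Rel (combo u)) = (\<Sum>y\<in>Y. vscale (u y) (unit_vec y))"
    by (simp add: rel_vec_def comb_combo gen_coord_def coord_def)
  also have "\<dots> = u" by (rule FF_decompose[of _ UNIV, symmetric]) (use assms in \<open>simp add: U_def\<close>)
  finally show ?thesis .
qed

text \<open>When \<open>Ext\<^sup>1(M, N) = 0\<close>, restriction from \<open>Hom(F, N)\<close> to
  \<open>Hom(U, N)\<close> is onto: the pullback of \<open>\<theta>\<close> along
  \<open>rel_vec\<close> is a cocycle, and a bounding cochain, read at the generators
  \<open>Elem y\<close>, gives the images \<open>n y\<close> of the basis vectors.\<close>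

lemma extend_hom:
  assumes t: "module t" and ex: "exact_at scale t (Suc 0)"
    and add: "\<And>u v. u \<in> U \<Longrightarrow> v \<in> U \<Longrightarrow> \<theta> (u + v) = \<theta> u + \<theta> v"
    and sc: "\<And>r u. u \<in> U \<Longrightarrow> \<theta> (vscale r u) = t r (\<theta> u)"
  obtains n where "\<And>u. u \<in> U \<Longrightarrow> \<theta> u = (\<Sum>y\<in>Y. t (u y) (n y))"
proof -
  interpret N: module t by fact
  have U0: "0 \<in> U" by (rule vec.subspace_0[OF subspace_U])
  have \<theta>0: "\<theta> 0 = 0" using add[OF U0 U0] by simp
  have comb: "comb t (\<lambda>g. \<theta> (rel_vec g)) ys = \<theta> (comb vscale rel_vec ys)
      \<and> comb vscale rel_vec ys \<in> U" if "snd ` set ys \<subseteq> gens scale (Suc 0)" for ys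
    using that
  proof (induction ys)
    case Nil
    then show ?case using U0 \<theta>0 by (simp only: comb_Nil)
  next
    case (Cons x ys)
    obtain c g where x: "x = (c, g)" by (cases x)
    have g: "rel_vec g \<in> U" using Cons.prems by (intro rel_vec_in) (auto simp: x)
    have IH: "comb t (\<lambda>g. \<theta> (rel_vec g)) ys = \<theta> (comb vscale rel_vec ys)"
      "comb vscale rel_vec ys \<in> U"
      using Cons.IH Cons.prems by (simp_all only: list.set image_insert insert_subset)
    have "vscale c (rel_vec g) \<in> U" by (rule vec.subspace_scale[OF subspace_U g])
    then show ?case
      unfolding x comb_Cons add[OF _ IH(2)] sc[OF g] IH(1)
      using IH(2) vec.subspace_add[OF subspace_U] by (simp only: add sc[OF g] simp_thms)
  qed
  obtain \<psi> where \<psi>: "\<And>xs. Rel xs \<in> gens scale (Suc 0) \<Longrightarrow> \<theta> (rel_vec (Rel xs)) = comb t \<psi> xs"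
  proof (rule exact_atE[OF ex, of "\<lambda>g. \<theta> (rel_vec g)"])
    fix ys :: "('a \<times> ('a, 'b) gen) list" assume ys: "Rel ys \<in> gens scale (Suc (Suc 0))"
    then have "snd ` set ys \<subseteq> gens scale (Suc 0)" by auto
    then show "comb t (\<lambda>g. \<theta> (rel_vec g)) ys = 0"
      using comb comb_rel_vec[OF ys] \<theta>0 by simp
  qed blast
  show thesis
  proof (rule that[of "\<lambda>y. \<psi> (Elem y)"])
    fix u assume u: "u \<in> U"
    show "\<theta> u = (\<Sum>y\<in>Y. t (u y) (\<psi> (Elem y)))"
      using \<psi>[OF combo_in_gens[OF u]] by (simp only: rel_vec_combo[OF u] comb_combo)
  qed
qed

lemma free_if_syzygy_zero:
  assumes "U \<subseteq> {0}"
  shows "free_module scale"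
proof -
  have "\<not> dependent Y"
  proof
    assume "dependent Y"
    then obtain r y0 where r: "(\<Sum>y\<in>Y. r y *s y) = 0" "y0 \<in> Y" "r y0 \<noteq> 0"
      using dependent_finite[OF finite_Y] by auto
    have "(\<lambda>y. if y \<in> Y then r y else 0) \<in> U"
      using r(1) by (auto simp: U_def FF_def ev_def cong: sum.cong_simp)
    then have "(\<lambda>y. if y \<in> Y then r y else 0) = 0" using assms by blast
    from fun_cong[OF this, of y0] show False using r by simp
  qed
  then show ?thesis using span_Y by (auto simp: free_module_def)
qed

lemma free_if_U_eq_mU:
  assumes "U \<subseteq> mU"
  shows "free_module scale"
proof -
  interpret V: artinian_local_module \<mm> "vscale :: 'a \<Rightarrow> ('b \<Rightarrow> 'a) \<Rightarrow> 'b \<Rightarrow> 'a"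
    by (intro artinian_local_module.intro artinian_local_ring_axioms module_vscale)
  have "U \<subseteq> {0}"
    by (rule V.nakayama) (use assms in auto)
  then show ?thesis by (rule free_if_syzygy_zero)
qed

end

section \<open>Dimension counts\<close>

text \<open>As \<open>\<mm>\<close> annihilates \<open>\<mm> M\<close>, independence modulo
  \<open>{0}\<close> makes \<open>Z\<close> a basis of \<open>\<mm> M\<close> over the residue
  field.\<close>

locale syzygy_socle = syzygy +
  fixes Z :: "'b set"
  assumes finite_Z: "finite Z"
    and span_Z: "span Z = mM"
    and indep_Z: "indep {0} Z (\<lambda>z. z)"
begin

lemma Z_sub: "z \<in> Z \<Longrightarrow> z \<in> mM"
  using span_base[of z Z] span_Z by simp

lemma Z_combination:
  assumes "x \<in> mM"
  obtains r where "x = (\<Sum>z\<in>Z. r z *s z)"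
  using assms unfolding span_Z[symmetric] span_finite[OF finite_Z] by auto

text \<open>Images of generators of \<open>U\<close> that respect all relations define a
  homomorphism \<open>\<theta>\<close> independent of the chosen coefficients, and
  \<open>extend_hom\<close> applies to it.\<close>

lemma extend_hom_gens:
  assumes t: "module t" and ex: "exact_at scale t (Suc 0)"
    and u: "\<And>i. i \<in> P \<Longrightarrow> u i \<in> U" "\<And>v. v \<in> U \<Longrightarrow> \<exists>r. v = (\<Sum>i\<in>P. vscale (r i) (u i))"
    and rel: "\<And>r. (\<Sum>i\<in>P. vscale (r i) (u i)) = 0 \<Longrightarrow> (\<Sum>i\<in>P. t (r i) (\<phi> i)) = 0"
    and P: "finite P"
  obtains n where "\<And>i. i \<in> P \<Longrightarrow> \<phi> i = (\<Sum>y\<in>Y. t (u i y) (n y))"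
proof -
  interpret N: module t by fact
  have "\<exists>c. \<forall>v\<in>U. v = (\<Sum>i\<in>P. vscale (c v i) (u i))"
    using u(2) by (intro bchoice) blast
  then obtain c where c: "\<And>v. v \<in> U \<Longrightarrow> v = (\<Sum>i\<in>P. vscale (c v i) (u i))" by blast
  define \<theta> where "\<theta> v = (\<Sum>i\<in>P. t (c v i) (\<phi> i))" for v
  have \<theta>: "\<theta> v = (\<Sum>i\<in>P. t (r i) (\<phi> i))" if "v \<in> U" "v = (\<Sum>i\<in>P. vscale (r i) (u i))" for v r
  proof -
    have "(\<Sum>i\<in>P. vscale (c v i - r i) (u i)) = 0"
      unfolding vec.scale_left_diff_distrib sum_subtractf c[OF that(1), symmetric] that(2)[symmetric] by (rule diff_self)
    from rel[OF this] show ?thesis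
      by (simp add: \<theta>_def N.scale_left_diff_distrib sum_subtractf)
  qed
  obtain n where n: "\<And>v. v \<in> U \<Longrightarrow> \<theta> v = (\<Sum>y\<in>Y. t (v y) (n y))"
  proof (rule extend_hom[OF t ex, of \<theta>])
    fix v w assume vw: "v \<in> U" "w \<in> U"
    have "v + w = (\<Sum>i\<in>P. vscale (c v i + c w i) (u i))"
      unfolding vec.scale_left_distrib sum.distrib c[OF vw(1), symmetric] c[OF vw(2), symmetric] ..
    from \<theta>[OF vec.subspace_add[OF subspace_U vw] this] show "\<theta> (v + w) = \<theta> v + \<theta> w"
      by (simp add: \<theta>_def N.scale_left_distrib sum.distrib)
  next
    fix r v assume v: "v \<in> U"
    have "vscale r v = (\<Sum>i\<in>P. vscale (r * c v i) (u i))"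
      unfolding vec.scale_scale[symmetric] vec.scale_sum_right[symmetric] c[OF v, symmetric] ..
    from \<theta>[OF vec.subspace_scale[OF subspace_U v] this] show "\<theta> (vscale r v) = t r (\<theta> v)"
      by (simp add: \<theta>_def N.scale_sum_right)
  qed blast
  show thesis
  proof (rule that[of n])
    fix i assume i: "i \<in> P"
    have "(\<Sum>j\<in>P. vscale (if j = i then 1 else 0) (u j)) = (\<Sum>j\<in>P. if j = i then u j else 0)"
    proof (intro sum.cong refl)
      fix j show "vscale (if j = i then 1 else 0) (u j) = (if j = i then u j else 0)"
        by (cases "j = i") (simp_all only: simp_thms if_True if_False vec.scale_one vec.scale_zero_left)
    qed
    also have "\<dots> = u i" using i P by (simp only: sum.delta if_True)
    finally have "\<theta> (u i) = (\<Sum>j\<in>P. t (if j = i then 1 else 0) (\<phi> j))"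
      by (intro \<theta> u(1)[OF i]) (rule sym)
    also have "\<dots> = (\<Sum>j\<in>P. if j = i then \<phi> j else 0)"
      by (intro sum.cong) auto
    finally show "\<phi> i = (\<Sum>y\<in>Y. t (u i y) (n y))" using n[OF u(1)[OF i]] i P by simp
  qed
qed

text \<open>Nakayama's lemma, applied to the submodule generated by the \<open>u i\<close>.\<close>

lemma basis_U_spans:
  assumes "vec.basis U mU P u" "finite P" "v \<in> U"
  shows "\<exists>r. v = (\<Sum>i\<in>P. vscale (r i) (u i))"
proof -
  interpret V: artinian_local_module \<mm> "vscale :: 'a \<Rightarrow> ('b \<Rightarrow> 'a) \<Rightarrow> 'b \<Rightarrow> 'a"
    by (intro artinian_local_module.intro artinian_local_ring_axioms module_vscale)
  let ?W = "range (\<lambda>r. \<Sum>i\<in>P. vscale (r i) (u i))"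
  have "U \<subseteq> ?W"
  proof (rule V.nakayama)
    show "vec.subspace ?W"
    proof (rule vec.subspaceI)
      show "0 \<in> ?W" by (rule image_eqI[of _ _ "\<lambda>_. 0"]) (simp_all only: vec.scale_zero_left sum.neutral_const UNIV_I)
    next
      fix v w assume "v \<in> ?W" "w \<in> ?W"
      then obtain r q where "v = (\<Sum>i\<in>P. vscale (r i) (u i))" "w = (\<Sum>i\<in>P. vscale (q i) (u i))" by blast
      then have "v + w = (\<Sum>i\<in>P. vscale (r i + q i) (u i))"
        by (simp only: vec.scale_left_distrib sum.distrib)
      then show "v + w \<in> ?W" by (rule image_eqI[where x = "\<lambda>i. r i + q i"]) (rule UNIV_I)
    next
      fix c v assume "v \<in> ?W"
      then obtain r where "v = (\<Sum>i\<in>P. vscale (r i) (u i))" by blast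
      then have "vscale c v = (\<Sum>i\<in>P. vscale (c * r i) (u i))"
        by (simp only: vec.scale_scale vec.scale_sum_right)
      then show "vscale c v \<in> ?W" by (rule image_eqI[where x = "\<lambda>i. c * r i"]) (rule UNIV_I)
    qed
    show "U \<subseteq> {w + v | w v. w \<in> ?W \<and> v \<in> mU}"
    proof
      fix v assume "v \<in> U"
      then obtain r where r: "v - (\<Sum>i\<in>P. vscale (r i) (u i)) \<in> mU"
        using assms(1) unfolding vec.basis_def by (blast elim: vec.spansE)
      show "v \<in> {w + v | w v. w \<in> ?W \<and> v \<in> mU}"
        by (intro CollectI exI[of _ "\<Sum>i\<in>P. vscale (r i) (u i)"] exI[of _ "v - (\<Sum>i\<in>P. vscale (r i) (u i))"])
          (use r in \<open>auto simp only: algebra_simps\<close>)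
    qed
  qed
  then show ?thesis using assms(3) by blast
qed

lemma basis_U_relation:
  assumes "vec.basis U mU P u" "(\<Sum>i\<in>P. vscale (r i) (u i)) = 0" "i \<in> P"
  shows "r i \<in> \<mm>"
  using assms vec.indepD[of mU P u r i] vec.subspace_0[OF vec.subspace_ideal_mult]
  unfolding vec.basis_def by simp

section \<open>Upper bounds from extending homomorphisms on the syzygy\<close>

lemma sum_scale_delta:
  assumes "module t" "finite P" "i \<in> P"
  shows "(\<Sum>j\<in>P. t (r j) (if j = i then x else 0)) = t (r i) x"
proof -
  interpret N: module t by fact
  have "(\<Sum>j\<in>P. t (r j) (if j = i then x else 0)) = (\<Sum>j\<in>P. if j = i then t (r j) x else 0)"
    by (intro sum.cong) auto
  then show ?thesis using assms by simp
qed

text \<open>Each map sending one \<open>u i\<close> to \<open>z\<close> and the other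
  \<open>u j\<close> to \<open>0\<close> extends to \<open>F\<close>. Together with
  \<open>ev\<close> these are \<open>card Z * card P + 1\<close> maps; if the bound failed, they
  would be dependent in \<open>Hom(F, M/mM)\<close>, of dimension \<open>card Y * card Y\<close>.
  The dependent combination maps \<open>F\<close> into \<open>mM\<close>, so it vanishes on
  \<open>U \<subseteq> \<mm> F\<close>. Since \<open>ev\<close> is \<open>0\<close> on
  \<open>U\<close>, the other coefficients lie in \<open>\<mm>\<close>, and then \<open>ev\<close>
  would map \<open>F\<close> into \<open>mM\<close>.\<close>

lemma card_Z_times_syzygy:
  assumes ex: "exact_at scale scale (Suc 0)" and B: "vec.basis U mU P u" and P: "finite P"
    and Y: "Y \<noteq> {}"
  shows "card Z * card P < card Y * card Y"
proof (rule ccontr)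
  assume neg: "\<not> ?thesis"
  have u: "\<And>i. i \<in> P \<Longrightarrow> u i \<in> U" using B by (simp add: vec.basis_def)
  have "\<exists>n. \<forall>j\<in>P. (if j = i then z else 0) = (\<Sum>y\<in>Y. u j y *s n y)" if i: "i \<in> P" and z: "z \<in> Z" for i z
  proof -
    show ?thesis
    proof (rule extend_hom_gens[OF module_axioms ex u basis_U_spans[OF B P] _ P, of "\<lambda>j. if j = i then z else 0"])
      fix r assume "(\<Sum>i\<in>P. vscale (r i) (u i)) = 0"
      \<comment> \<open>Relations between minimal generators of \<open>U\<close> have coefficients
        in \<open>\<mm>\<close>, so arbitrary values in \<open>mM\<close> respect them.\<close>
      then have "r i \<in> \<mm>" by (rule basis_U_relation[OF B _ i])
      then have "r i *s z = 0" using m_mM Z_sub z by blast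
      then show "(\<Sum>j\<in>P. r j *s (if j = i then z else 0)) = 0"
        by (simp only: sum_scale_delta[OF module_axioms P i])
    next
      fix n assume n: "\<And>j. j \<in> P \<Longrightarrow> (if j = i then z else 0) = (\<Sum>y\<in>Y. u j y *s n y)"
      show "\<exists>n. \<forall>j\<in>P. (if j = i then z else 0) = (\<Sum>y\<in>Y. u j y *s n y)"
        by (intro exI[of _ n] ballI n)
    qed
  qed
  then have "\<forall>p\<in>P \<times> Z. \<exists>n. \<forall>j\<in>P. (if j = fst p then snd p else 0) = (\<Sum>y\<in>Y. u j y *s n y)" by auto
  from bchoice[OF this] obtain n where
    n': "\<forall>p\<in>P \<times> Z. \<forall>j\<in>P. (if j = fst p then snd p else 0) = (\<Sum>y\<in>Y. u j y *s n p y)"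
    by blast
  have n: "(if j = i then z else 0) = (\<Sum>y\<in>Y. u j y *s n (i, z) y)"
    if "i \<in> P" "z \<in> Z" "j \<in> P" for i z j
    using bspec[OF bspec[OF n', of "(i, z)"], of j] that
    by (simp only: fst_conv snd_conv mem_Sigma_iff simp_thms)
  \<comment> \<open>\<open>None\<close> stands for \<open>ev\<close> and \<open>Some (i, z)\<close>
    for the extension \<open>n (i, z)\<close>; \<open>c\<close> collects coordinates of the images
    of \<open>Y\<close> under these maps.\<close>
  define J where "J = insert None (Some ` (P \<times> Z))"
  define c where "c p q = (case q of None \<Rightarrow> unit_vec (fst p) (snd p) | Some iz \<Rightarrow> coord (n iz (fst p)) (snd p))"
    for p :: "'b \<times> 'b" and q
  have fin: "finite (Some ` (P \<times> Z))" using P finite_Z by simp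
  have "card J = Suc (card P * card Z)"
    unfolding J_def using fin by (subst card_insert_disjoint) (auto simp: card_image card_cartesian_product)
  then have "card (Y \<times> Y) < card J" using neg by (simp add: card_cartesian_product mult.commute)
  then obtain r where r: "\<exists>j\<in>J. r j \<notin> \<mm>" "\<forall>p\<in>Y \<times> Y. (\<Sum>j\<in>J. c p j * r j) \<in> \<mm>"
    using underdetermined[of "Y \<times> Y" J c] finite_Y fin by (auto simp: J_def)
  have sumJ: "(\<Sum>j\<in>J. c p j * r j) =
      unit_vec (fst p) (snd p) * r None + (\<Sum>q\<in>P \<times> Z. coord (n q (fst p)) (snd p) * r (Some q))" for p
    unfolding J_def using fin by (subst sum.insert) (auto simp: c_def sum.reindex)
  define w where "w y = r None *s y + (\<Sum>q\<in>P \<times> Z. r (Some q) *s n q y)" for y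
  have w: "w y \<in> mM" if y: "y \<in> Y" for y
  proof -
    have "w y = ev (vscale (r None) (unit_vec y) + (\<Sum>q\<in>P \<times> Z. vscale (r (Some q)) (coord (n q y))))"
      by (simp only: w_def ev_add ev_sum ev_scale ev_coord ev_unit_vec[OF y])
    also have "\<dots> = (\<Sum>x\<in>Y. (\<Sum>j\<in>J. c (y, x) j * r j) *s x)"
      unfolding ev_def sumJ by (simp add: mult.commute)
    also have "\<dots> \<in> mM"
      by (intro subspace_sum[OF subspace_mM] in_ideal_mult) (use r(2) y in auto)
    finally show ?thesis .
  qed
  \<comment> \<open>As a map on \<open>F\<close>, \<open>w\<close> vanishes on \<open>U\<close>,
    while its value at \<open>u i\<close> is the combination of \<open>Z\<close> with coefficients
    \<open>r (Some (i, z))\<close>.\<close>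
  have rS: "r (Some (i, z)) \<in> \<mm>" if i: "i \<in> P" and z: "z \<in> Z" for i z
  proof -
    have "(\<Sum>y\<in>Y. u i y *s w y) = 0"
      using u[OF i] U_le by (intro sum.neutral ballI m_mM w) (auto simp: FF_def)
    moreover have "(\<Sum>y\<in>Y. u i y *s w y) = r None *s ev (u i) +
        (\<Sum>q\<in>P \<times> Z. r (Some q) *s (\<Sum>y\<in>Y. u i y *s n q y))"
    proof -
      have "(\<Sum>y\<in>Y. u i y *s w y) = (\<Sum>y\<in>Y. r None *s u i y *s y) +
          (\<Sum>y\<in>Y. \<Sum>q\<in>P \<times> Z. r (Some q) *s u i y *s n q y)"
        by (simp add: w_def scale_right_distrib scale_sum_right sum.distrib mult.commute)
      then show ?thesis
        unfolding ev_def scale_sum_right by (simp only: sum.swap[of _ Y])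
    qed
    moreover have "ev (u i) = 0" using u[OF i] by (simp add: U_def)
    moreover have "(\<Sum>q\<in>P \<times> Z. r (Some q) *s (\<Sum>y\<in>Y. u i y *s n q y)) =
        (\<Sum>q\<in>P \<times> Z. r (Some q) *s (if i = fst q then snd q else 0))"
      using n[OF _ _ i] by (intro sum.cong refl) force
    moreover have "\<dots> = (\<Sum>j\<in>P. if j = i then (\<Sum>z\<in>Z. r (Some (i, z)) *s z) else 0)"
      unfolding sum.cartesian_product' by (intro sum.cong) auto
    ultimately have "(\<Sum>z\<in>Z. r (Some (i, z)) *s z) = 0" using i P by simp
    then show ?thesis using indepD[OF indep_Z, of "\<lambda>z. r (Some (i, z))"] z by simp
  qed
  then have rN: "r None \<notin> \<mm>" using r(1) by (auto simp: J_def)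
  obtain y where y: "y \<in> Y" using Y by blast
  have "r None + (\<Sum>q\<in>P \<times> Z. coord (n q y) y * r (Some q)) \<in> \<mm>"
    using bspec[OF r(2), of "(y, y)"] y unfolding sumJ by (simp add: unit_vec_def)
  moreover have "(\<Sum>q\<in>P \<times> Z. coord (n q y) y * r (Some q)) \<in> \<mm>"
    using rS by (intro sum_in mult_in) auto
  ultimately have "r None \<in> \<mm>" using diff_in by fastforce
  then show False using rN by blast
qed

text \<open>The same idea with values in the ring: \<open>card E * card P\<close> maps send one
  \<open>u i\<close> to one \<open>x k\<close>. If these were more than \<open>card Y\<close>, the
  dimension of \<open>Hom(F, R/\<mm>)\<close>, a combination with a unit coefficient would map
  \<open>F\<close> into \<open>\<mm>\<close>, hence \<open>U \<subseteq> \<mm> F\<close> to zero as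
  \<open>m2 = {0}\<close>, against the independence of the \<open>x k\<close>.\<close>

lemma card_ring_bound:
  assumes ex: "exact_at scale (*) (Suc 0)" and B: "vec.basis U mU P u" and P: "finite P"
    and m2: "m2 = {0}" and x: "local_module.basis \<mm> (*) \<mm> m2 E x" and E: "finite E"
  shows "card E * card P \<le> card Y"
proof (rule ccontr)
  interpret ring: local_module \<mm> "(*)" by (rule local_module_ring)
  assume neg: "\<not> ?thesis"
  have u: "\<And>i. i \<in> P \<Longrightarrow> u i \<in> U" using B by (simp add: vec.basis_def)
  have xm: "\<And>k. k \<in> E \<Longrightarrow> x k \<in> \<mm>" using x by (simp add: ring.basis_def)
  have mm: "a * b = 0" if "a \<in> \<mm>" "b \<in> \<mm>" for a b
    using in_ideal_mult_ring[OF that] m2 by blast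
  have "\<exists>n. \<forall>j\<in>P. (if j = i then x k else 0) = (\<Sum>y\<in>Y. u j y * n y)" if i: "i \<in> P" and k: "k \<in> E" for i k
  proof -
    show ?thesis
    proof (rule extend_hom_gens[OF module_mult ex u basis_U_spans[OF B P] _ P, of "\<lambda>j. if j = i then x k else 0"])
      fix r assume "(\<Sum>i\<in>P. vscale (r i) (u i)) = 0"
      then have "r i \<in> \<mm>" by (rule basis_U_relation[OF B _ i])
      then have "r i * x k = 0" using mm xm k by blast
      then show "(\<Sum>j\<in>P. r j * (if j = i then x k else 0)) = 0"
        by (simp only: sum_scale_delta[OF module_mult P i])
    next
      fix n assume n: "\<And>j. j \<in> P \<Longrightarrow> (if j = i then x k else 0) = (\<Sum>y\<in>Y. u j y * n y)"
      show "\<exists>n. \<forall>j\<in>P. (if j = i then x k else 0) = (\<Sum>y\<in>Y. u j y * n y)"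
        by (intro exI[of _ n] ballI n)
    qed
  qed
  then have "\<forall>p\<in>P \<times> E. \<exists>n. \<forall>j\<in>P. (if j = fst p then x (snd p) else 0) = (\<Sum>y\<in>Y. u j y * n y)" by auto
  from bchoice[OF this] obtain n where
    n': "\<forall>p\<in>P \<times> E. \<forall>j\<in>P. (if j = fst p then x (snd p) else 0) = (\<Sum>y\<in>Y. u j y * n p y)"
    by blast
  have n: "(if j = i then x k else 0) = (\<Sum>y\<in>Y. u j y * n (i, k) y)"
    if "i \<in> P" "k \<in> E" "j \<in> P" for i k j
    using bspec[OF bspec[OF n', of "(i, k)"], of j] that
    by (simp only: fst_conv snd_conv mem_Sigma_iff simp_thms)
  have "card Y < card (P \<times> E)" using neg by (simp add: card_cartesian_product mult.commute)
  then obtain r where r: "\<exists>j\<in>P \<times> E. r j \<notin> \<mm>" "\<forall>y\<in>Y. (\<Sum>j\<in>P \<times> E. n j y * r j) \<in> \<mm>"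
    using underdetermined[of Y "P \<times> E" "\<lambda>y j. n j y"] finite_Y P E by auto
  have "r (i, k) \<in> \<mm>" if i: "i \<in> P" and k: "k \<in> E" for i k
  proof -
    have "0 = (\<Sum>y\<in>Y. u i y * (\<Sum>j\<in>P \<times> E. n j y * r j))"
      using u[OF i] U_le r(2) by (intro sum.neutral[symmetric] ballI mm) (auto simp: FF_def)
    also have "\<dots> = (\<Sum>j\<in>P \<times> E. r j * (\<Sum>y\<in>Y. u i y * n j y))"
      unfolding sum_distrib_left by (subst sum.swap) (intro sum.cong refl, simp add: mult.commute mult.left_commute)
    also have "\<dots> = (\<Sum>j\<in>P \<times> E. r j * (if i = fst j then x (snd j) else 0))"
      using n[OF _ _ i] by (intro sum.cong refl) force
    also have "\<dots> = (\<Sum>j\<in>P. if j = i then (\<Sum>k\<in>E. r (i, k) * x k) else 0)"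
      unfolding sum.cartesian_product' by (intro sum.cong) auto
    finally have "(\<Sum>k\<in>E. r (i, k) * x k) \<in> m2" using i P m2 by simp
    then show ?thesis using x k ring.indepD[of m2 E x "\<lambda>k. r (i, k)"] by (simp add: ring.basis_def)
  qed
  then show False using r(1) by auto
qed

end

section \<open>Relations between the generators of the syzygy\<close>

context syzygy_socle
begin

lemma mU_combination:
  assumes B: "vec.basis U mU P u" and P: "finite P" and v: "v \<in> mU"
  obtains a where "\<forall>i\<in>P. a i \<in> \<mm>" "v = (\<Sum>i\<in>P. vscale (a i) (u i))"
proof -
  let ?S = "{v. \<exists>a. (\<forall>i\<in>P. a i \<in> \<mm>) \<and> v = (\<Sum>i\<in>P. vscale (a i) (u i))}"
  have "mU \<subseteq> ?S"
  proof (rule vec.ideal_mult_minimal)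
    fix r v assume r: "r \<in> \<mm>" and "v \<in> U"
    then obtain c where "v = (\<Sum>i\<in>P. vscale (c i) (u i))" using basis_U_spans[OF B P] by blast
    then have "vscale r v = (\<Sum>i\<in>P. vscale (r * c i) (u i))"
      by (simp only: vec.scale_scale vec.scale_sum_right)
    then show "vscale r v \<in> ?S"
      by (intro CollectI exI[of _ "\<lambda>i. r * c i"] conjI ballI mult_in'[OF r])
  next
    show "vec.subspace ?S"
    proof (rule vec.subspaceI)
      have "0 = (\<Sum>i\<in>P. vscale 0 (u i))" by (simp only: vec.scale_zero_left sum.neutral_const)
      then show "0 \<in> ?S" by (intro CollectI exI[of _ "\<lambda>_. 0"] conjI ballI zero_in)
    next
      fix v w assume "v \<in> ?S" "w \<in> ?S"
      then obtain a c where ac: "\<forall>i\<in>P. a i \<in> \<mm>" "v = (\<Sum>i\<in>P. vscale (a i) (u i))"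
        "\<forall>i\<in>P. c i \<in> \<mm>" "w = (\<Sum>i\<in>P. vscale (c i) (u i))" by blast
      then have "v + w = (\<Sum>i\<in>P. vscale (a i + c i) (u i))"
        by (simp only: vec.scale_left_distrib sum.distrib)
      then show "v + w \<in> ?S" using ac add_in
        by (intro CollectI exI[of _ "\<lambda>i. a i + c i"] conjI ballI) blast+
    next
      fix c v assume "v \<in> ?S"
      then obtain a where a: "\<forall>i\<in>P. a i \<in> \<mm>" "v = (\<Sum>i\<in>P. vscale (a i) (u i))" by blast
      then have "vscale c v = (\<Sum>i\<in>P. vscale (c * a i) (u i))"
        by (simp only: vec.scale_scale vec.scale_sum_right)
      then show "vscale c v \<in> ?S" using a mult_in
        by (intro CollectI exI[of _ "\<lambda>i. c * a i"] conjI ballI) blast+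
    qed
  qed
  then show ?thesis using v that by blast
qed

text \<open>A family \<open>\<phi>\<close> in \<open>M\<close> kills all relations between the \<open>u\<^sub>i\<close> as soon as \<open>(a, i) \<mapsto> a \<phi>\<^sub>i\<close> factors
  through \<open>\<mm> U / \<mm>\<^sup>3 F\<close>; such a \<open>\<phi>\<close> extends to \<open>F\<close> and hence has values in \<open>\<mm> M\<close>.  The bound counts
  the unknowns and equations of this factorization problem.\<close>

lemma card_syzygy_bound:
  assumes ex: "exact_at scale scale (Suc 0)" and B: "vec.basis U mU P u" and P: "finite P"
    and W: "vec.basis mU (FF m3) V w" and V: "finite V"
    and x: "local_module.basis \<mm> (*) \<mm> m2 E x" and E: "finite E"
  shows "card Y * card P + card Z * card V \<le> card E * card P * card Z"
proof (rule ccontr)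
  interpret ring: local_module \<mm> "(*)" by (rule local_module_ring)
  assume neg: "\<not> ?thesis"
  have u: "\<And>i. i \<in> P \<Longrightarrow> u i \<in> U" using B by (simp add: vec.basis_def)
  have xm: "\<And>k. k \<in> E \<Longrightarrow> x k \<in> \<mm>" using x by (simp add: ring.basis_def)
  have w: "\<And>v. v \<in> V \<Longrightarrow> w v \<in> mU" using W by (simp add: vec.basis_def)
  have F3: "vec.subspace (FF m3)" by (rule subspace_FF[OF ideal_mult_ring])
  \<comment> \<open>Coordinates of \<open>vscale (x k) (u i)\<close> in \<open>mU / FF m3\<close>;
    \<open>\<gamma>\<close> below holds those of \<open>x k *s y\<close> in
    \<open>mM\<close>.\<close>
  define \<kappa> where "\<kappa> i k = (SOME q. vscale (x k) (u i) - (\<Sum>v\<in>V. vscale (q v) (w v)) \<in> FF m3)" for i k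
  have \<kappa>: "vscale (x k) (u i) - (\<Sum>v\<in>V. vscale (\<kappa> i k v) (w v)) \<in> FF m3" if "i \<in> P" "k \<in> E" for i k
  proof -
    have "vscale (x k) (u i) \<in> mU" using that by (intro vec.in_ideal_mult xm u)
    then have "\<exists>q. vscale (x k) (u i) - (\<Sum>v\<in>V. vscale (q v) (w v)) \<in> FF m3"
      using W unfolding vec.basis_def vec.spans_def by blast
    then show ?thesis unfolding \<kappa>_def by (rule someI_ex)
  qed
  define \<gamma> where "\<gamma> k y = (SOME q. x k *s y = (\<Sum>z\<in>Z. q z *s z))" for k y
  have \<gamma>: "x k *s y = (\<Sum>z\<in>Z. \<gamma> k y z *s z)" if "k \<in> E" for k y
  proof -
    have "x k *s y \<in> mM" by (rule in_ideal_mult[OF xm[OF that] UNIV_I])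
    then have "\<exists>q. x k *s y = (\<Sum>z\<in>Z. q z *s z)" by (rule Z_combination) blast
    then show ?thesis unfolding \<gamma>_def by (rule someI_ex)
  qed
  \<comment> \<open>The unknowns \<open>Inl (i, y)\<close> are coordinates of
    \<open>\<phi> i\<close> modulo \<open>mM\<close>; the unknowns \<open>Inr (v, z)\<close> are
    those of \<open>\<eta> v\<close>, the image of \<open>w v\<close> under the sought map from
    \<open>mU / FF m3\<close> to \<open>mM\<close>. The equations are the
    \<open>z\<close>-coordinates of the identity \<open>key\<close>.\<close>
  define I where "I = (P \<times> E) \<times> Z"
  define J where "J = (P \<times> Y) <+> (V \<times> Z)"
  define c where "c p q = (case q of
      Inl iy \<Rightarrow> if fst iy = fst (fst p) then \<gamma> (snd (fst p)) (snd iy) (snd p) else 0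
    | Inr vz \<Rightarrow> if snd vz = snd p then - \<kappa> (fst (fst p)) (snd (fst p)) (fst vz) else 0)" for p q
  have fin: "finite I" "finite J" using P V E finite_Y finite_Z by (simp_all add: I_def J_def)
  have "card I < card J"
    using neg P V finite_Y finite_Z
    by (simp add: I_def J_def card_cartesian_product card_Plus mult.commute mult.left_commute)
  from underdetermined[OF fin this, of c]
  obtain r where r: "\<exists>j\<in>J. r j \<notin> \<mm>" "\<forall>p\<in>I. (\<Sum>j\<in>J. c p j * r j) \<in> \<mm>" by blast
  have eq: "(\<Sum>y\<in>Y. \<gamma> k y z * r (Inl (i, y))) - (\<Sum>v\<in>V. \<kappa> i k v * r (Inr (v, z))) \<in> \<mm>"
    if i: "i \<in> P" and k: "k \<in> E" and z: "z \<in> Z" for i k z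
  proof -
    have "(\<Sum>j\<in>J. c ((i, k), z) j * r j) =
        (\<Sum>p\<in>P \<times> Y. c ((i, k), z) (Inl p) * r (Inl p)) + (\<Sum>p\<in>V \<times> Z. c ((i, k), z) (Inr p) * r (Inr p))"
      unfolding J_def using P V finite_Y finite_Z by (simp add: sum.Plus)
    also have "(\<Sum>p\<in>P \<times> Y. c ((i, k), z) (Inl p) * r (Inl p)) =
        (\<Sum>j\<in>P. if j = i then (\<Sum>y\<in>Y. \<gamma> k y z * r (Inl (i, y))) else 0)"
      unfolding sum.cartesian_product' by (intro sum.cong refl) (auto simp: c_def)
    also have "\<dots> = (\<Sum>y\<in>Y. \<gamma> k y z * r (Inl (i, y)))" using i P by simp
    also have "(\<Sum>p\<in>V \<times> Z. c ((i, k), z) (Inr p) * r (Inr p)) =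
        (\<Sum>v\<in>V. \<Sum>z'\<in>Z. if z' = z then - \<kappa> i k v * r (Inr (v, z)) else 0)"
      unfolding sum.cartesian_product' by (intro sum.cong refl) (auto simp: c_def)
    also have "\<dots> = - (\<Sum>v\<in>V. \<kappa> i k v * r (Inr (v, z)))" using z finite_Z by (simp add: sum_negf)
    finally show ?thesis using bspec[OF r(2), of "((i, k), z)"] i k z by (simp add: I_def)
  qed
  define \<phi> where "\<phi> i = (\<Sum>y\<in>Y. r (Inl (i, y)) *s y)" for i
  define \<eta> where "\<eta> v = (\<Sum>z\<in>Z. r (Inr (v, z)) *s z)" for v
  have \<eta>: "\<eta> v \<in> mM" for v
    unfolding \<eta>_def by (intro subspace_sum[OF subspace_mM] subspace_scale[OF subspace_mM] Z_sub)
  have key: "x k *s \<phi> i = (\<Sum>v\<in>V. \<kappa> i k v *s \<eta> v)" if i: "i \<in> P" and k: "k \<in> E" for i k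
  proof -
    have "x k *s \<phi> i = (\<Sum>y\<in>Y. r (Inl (i, y)) *s x k *s y)"
      unfolding \<phi>_def scale_sum_right by (intro sum.cong refl scale_left_commute)
    also have "\<dots> = (\<Sum>y\<in>Y. \<Sum>z\<in>Z. (\<gamma> k y z * r (Inl (i, y))) *s z)"
      unfolding \<gamma>[OF k] scale_sum_right scale_scale by (simp only: mult.commute)
    also have "\<dots> = (\<Sum>z\<in>Z. (\<Sum>y\<in>Y. \<gamma> k y z * r (Inl (i, y))) *s z)"
      unfolding scale_sum_left by (rule sum.swap)
    finally have 1: "x k *s \<phi> i = (\<Sum>z\<in>Z. (\<Sum>y\<in>Y. \<gamma> k y z * r (Inl (i, y))) *s z)" .
    have 2: "(\<Sum>v\<in>V. \<kappa> i k v *s \<eta> v) = (\<Sum>z\<in>Z. (\<Sum>v\<in>V. \<kappa> i k v * r (Inr (v, z))) *s z)"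
      unfolding \<eta>_def scale_sum_right scale_sum_left scale_scale by (rule sum.swap)
    have "x k *s \<phi> i - (\<Sum>v\<in>V. \<kappa> i k v *s \<eta> v) = (\<Sum>z\<in>Z.
        ((\<Sum>y\<in>Y. \<gamma> k y z * r (Inl (i, y))) - (\<Sum>v\<in>V. \<kappa> i k v * r (Inr (v, z)))) *s z)"
      unfolding 1 2 scale_left_diff_distrib sum_subtractf ..
    also have "\<dots> = 0" by (intro sum.neutral ballI m_mM eq i k Z_sub)
    finally show ?thesis by simp
  qed
  \<comment> \<open>The \<open>x k\<close> span \<open>\<mm>\<close> modulo \<open>m2\<close>, and
    \<open>m2\<close> kills \<open>M\<close> and maps \<open>U \<subseteq> \<mm> F\<close> into
    \<open>FF m3\<close>. So \<open>key\<close> carries over to all coefficient families in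
    \<open>\<mm>\<close>.\<close>
  have expand: "\<exists>q. (\<Sum>i\<in>P. vscale (a i) (u i)) - (\<Sum>v\<in>V. vscale (q v) (w v)) \<in> FF m3
      \<and> (\<Sum>i\<in>P. a i *s \<phi> i) = (\<Sum>v\<in>V. q v *s \<eta> v)" if a: "\<forall>i\<in>P. a i \<in> \<mm>" for a
  proof -
    have "\<forall>i\<in>P. \<exists>d. a i - (\<Sum>k\<in>E. d k * x k) \<in> m2"
      using x a unfolding ring.basis_def ring.spans_def by blast
    from bchoice[OF this] obtain d where d: "\<And>i. i \<in> P \<Longrightarrow> a i - (\<Sum>k\<in>E. d i k * x k) \<in> m2" by blast
    define q where "q v = (\<Sum>i\<in>P. \<Sum>k\<in>E. d i k * \<kappa> i k v)" for v
    have "(\<Sum>i\<in>P. vscale (a i) (u i)) - (\<Sum>v\<in>V. vscale (q v) (w v)) =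
        (\<Sum>i\<in>P. vscale (a i - (\<Sum>k\<in>E. d i k * x k)) (u i)) +
        (\<Sum>i\<in>P. \<Sum>k\<in>E. vscale (d i k) (vscale (x k) (u i) - (\<Sum>v\<in>V. vscale (\<kappa> i k v) (w v))))"
    proof -
      have "(\<Sum>v\<in>V. vscale (q v) (w v)) = (\<Sum>i\<in>P. \<Sum>k\<in>E. \<Sum>v\<in>V. vscale (d i k * \<kappa> i k v) (w v))"
        unfolding q_def vec.scale_sum_left
        by (subst sum.swap, intro sum.cong refl, rule sum.swap)
      then show ?thesis
        by (simp only: vec.scale_left_diff_distrib vec.scale_right_diff_distrib vec.scale_sum_left
            vec.scale_sum_right vec.scale_scale sum_subtractf add_diff_eq diff_add_cancel)
    qed
    also have "\<dots> \<in> FF m3"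
    proof (rule vec.subspace_add[OF F3])
      show "(\<Sum>i\<in>P. vscale (a i - (\<Sum>k\<in>E. d i k * x k)) (u i)) \<in> FF m3"
      proof (rule vec.subspace_sum[OF F3])
        fix i assume i: "i \<in> P"
        have "u i \<in> FF \<mm>" using u[OF i] U_le by blast
        then show "vscale (a i - (\<Sum>k\<in>E. d i k * x k)) (u i) \<in> FF m3"
          using d[OF i] in_ideal_mult_ring[of _ \<mm> _ m2] by (auto simp: FF_def mult.commute)
      qed
      show "(\<Sum>i\<in>P. \<Sum>k\<in>E. vscale (d i k) (vscale (x k) (u i) -
          (\<Sum>v\<in>V. vscale (\<kappa> i k v) (w v)))) \<in> FF m3"
        by (intro vec.subspace_sum[OF F3] vec.subspace_scale[OF F3] \<kappa>)
    qed
    finally have 1: "(\<Sum>i\<in>P. vscale (a i) (u i)) - (\<Sum>v\<in>V. vscale (q v) (w v)) \<in> FF m3" .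
    have "(\<Sum>i\<in>P. a i *s \<phi> i) = (\<Sum>i\<in>P. \<Sum>k\<in>E. d i k *s x k *s \<phi> i)"
    proof (intro sum.cong refl)
      fix i assume "i \<in> P"
      then have "(a i - (\<Sum>k\<in>E. d i k * x k)) *s \<phi> i = 0" by (intro m2_scale d)
      then show "a i *s \<phi> i = (\<Sum>k\<in>E. d i k *s x k *s \<phi> i)"
        by (simp add: scale_left_diff_distrib scale_sum_left)
    qed
    also have "\<dots> = (\<Sum>i\<in>P. \<Sum>k\<in>E. \<Sum>v\<in>V. (d i k * \<kappa> i k v) *s \<eta> v)"
      by (intro sum.cong refl) (simp only: key scale_sum_right scale_scale)
    also have "\<dots> = (\<Sum>v\<in>V. q v *s \<eta> v)"
      unfolding q_def scale_sum_left
      by (subst (2) sum.swap, intro sum.cong refl, rule sum.swap)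
    finally show ?thesis using 1 by blast
  qed
  \<comment> \<open>For a relation, independence of \<open>w\<close> modulo \<open>FF m3\<close>
    puts the \<open>q v\<close> into \<open>\<mm>\<close>, where they kill the
    \<open>\<eta> v\<close>; so \<open>\<phi>\<close> respects all relations.\<close>
  have "\<exists>n. \<forall>i\<in>P. \<phi> i = (\<Sum>y\<in>Y. u i y *s n y)"
  proof (rule extend_hom_gens[OF module_axioms ex u basis_U_spans[OF B P] _ P, of \<phi>])
    fix a assume a: "(\<Sum>i\<in>P. vscale (a i) (u i)) = 0"
    then have "\<forall>i\<in>P. a i \<in> \<mm>" using basis_U_relation[OF B] by blast
    then obtain q where q: "(\<Sum>i\<in>P. vscale (a i) (u i)) - (\<Sum>v\<in>V. vscale (q v) (w v)) \<in> FF m3"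
      "(\<Sum>i\<in>P. a i *s \<phi> i) = (\<Sum>v\<in>V. q v *s \<eta> v)" using expand by blast
    have "- (0 - (\<Sum>v\<in>V. vscale (q v) (w v))) \<in> FF m3"
      using q(1) unfolding a by (rule vec.subspace_neg[OF F3])
    then have "(\<Sum>v\<in>V. vscale (q v) (w v)) \<in> FF m3" by (simp only: diff_0 minus_minus)
    then have "q v \<in> \<mm>" if "v \<in> V" for v
      using W that unfolding vec.basis_def by (blast dest: vec.indepD)
    then show "(\<Sum>i\<in>P. a i *s \<phi> i) = 0" unfolding q(2) by (intro sum.neutral ballI m_mM \<eta>)
  next
    fix n assume n: "\<And>i. i \<in> P \<Longrightarrow> \<phi> i = (\<Sum>y\<in>Y. u i y *s n y)"
    show "\<exists>n. \<forall>i\<in>P. \<phi> i = (\<Sum>y\<in>Y. u i y *s n y)" by (intro exI[of _ n] ballI n)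
  qed
  then obtain n where n: "\<And>i. i \<in> P \<Longrightarrow> \<phi> i = (\<Sum>y\<in>Y. u i y *s n y)" by blast
  have \<phi>: "\<phi> i \<in> mM" if "i \<in> P" for i
    unfolding n[OF that] using u[OF that] U_le
    by (intro subspace_sum[OF subspace_mM] in_ideal_mult) (auto simp: FF_def)
  then have rl: "r (Inl (i, y)) \<in> \<mm>" if "i \<in> P" "y \<in> Y" for i y
    using indepD[OF indep_Y, of "\<lambda>y. r (Inl (i, y))"] that unfolding \<phi>_def by blast
  \<comment> \<open>Write \<open>w v\<close> through the \<open>u i\<close> with coefficients
    \<open>a i \<in> \<mm>\<close>. The sum of the \<open>a i *s \<phi> i\<close> is
    \<open>0\<close>, as the \<open>\<phi> i\<close> now lie in \<open>mM\<close>; on the other hand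
    it is \<open>\<eta> v\<close>, since \<open>q\<close> agrees with \<open>\<delta>\<close> modulo
    \<open>\<mm>\<close>.\<close>
  have "\<eta> v = 0" if v: "v \<in> V" for v
  proof -
    obtain a where a: "\<forall>i\<in>P. a i \<in> \<mm>" "w v = (\<Sum>i\<in>P. vscale (a i) (u i))"
      using mU_combination[OF B P w[OF v]] .
    obtain q where q: "w v - (\<Sum>v\<in>V. vscale (q v) (w v)) \<in> FF m3"
      "(\<Sum>i\<in>P. a i *s \<phi> i) = (\<Sum>v\<in>V. q v *s \<eta> v)" using expand[OF a(1)] unfolding a(2) by blast
    define \<delta> where "\<delta> v' = (if v' = v then 1 else 0 :: 'a)" for v'
    have d: "(\<Sum>v'\<in>V. vscale (\<delta> v') (w v')) = w v"
    proof -
      have "(\<Sum>v'\<in>V. vscale (\<delta> v') (w v')) = (\<Sum>v'\<in>V. if v' = v then w v' else 0)"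
      proof (intro sum.cong refl)
        fix j show "vscale (\<delta> j) (w j) = (if j = v then w j else 0)" unfolding \<delta>_def
          by (cases "j = v") (simp_all only: simp_thms if_True if_False vec.scale_one vec.scale_zero_left)
      qed
      also have "\<dots> = w v" using v V by (simp only: sum.delta if_True)
      finally show ?thesis .
    qed
    have "(\<Sum>v'\<in>V. vscale (\<delta> v' - q v') (w v')) \<in> FF m3"
      using q(1) by (simp only: vec.scale_left_diff_distrib sum_subtractf d)
    then have "\<delta> v' - q v' \<in> \<mm>" if "v' \<in> V" for v'
      using W that vec.indepD[of "FF m3" V w "\<lambda>v'. \<delta> v' - q v'"] unfolding vec.basis_def by blast
    then have "(\<Sum>v'\<in>V. (\<delta> v' - q v') *s \<eta> v') = 0" by (intro sum.neutral ballI m_mM \<eta>)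
    moreover have "(\<Sum>v'\<in>V. q v' *s \<eta> v') = 0"
      unfolding q(2)[symmetric] by (intro sum.neutral ballI m_mM \<phi> bspec[OF a(1)])
    moreover have "(\<Sum>v'\<in>V. \<delta> v' *s \<eta> v') = (\<Sum>v'\<in>V. if v' = v then \<eta> v' else 0)"
      by (intro sum.cong) (auto simp: \<delta>_def)
    ultimately show ?thesis using v V by (simp add: scale_left_diff_distrib sum_subtractf)
  qed
  then have "r (Inr (v, z)) \<in> \<mm>" if "v \<in> V" "z \<in> Z" for v z
    using indepD[OF indep_Z, of "\<lambda>z. r (Inr (v, z))"] that unfolding \<eta>_def by blast
  then show False using r(1) rl by (auto simp: J_def)
qed

section \<open>Dimensions along the filtration of \<open>\<mm> F\<close>\<close>

lemma basis_FF:
  assumes I: "ideal I" and J: "ideal J" and K: "finite K"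
    and x: "local_module.basis \<mm> (*) I J K x"
  shows "vec.basis (FF I) (FF J) (K \<times> Y) (\<lambda>p. vscale (x (fst p)) (unit_vec (snd p)))"
proof -
  interpret ring: local_module \<mm> "(*)" by (rule local_module_ring)
  have ap: "(\<Sum>p\<in>K \<times> Y. vscale (r p) (vscale (x (fst p)) (unit_vec (snd p)))) y =
      (if y \<in> Y then (\<Sum>k\<in>K. r (k, y) * x k) else 0)" for r y
  proof -
    have "(\<Sum>p\<in>K \<times> Y. vscale (r p) (vscale (x (fst p)) (unit_vec (snd p)))) y =
        (\<Sum>k\<in>K. \<Sum>y'\<in>Y. if y' = y then r (k, y) * x k else 0)"
      unfolding sum_fun_apply vscale_apply sum.cartesian_product'
      by (intro sum.cong refl) (auto simp: unit_vec_def)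
    then show ?thesis using finite_Y by simp
  qed
  have "vec.indep (FF J) (K \<times> Y) (\<lambda>p. vscale (x (fst p)) (unit_vec (snd p)))"
    unfolding vec.indep_def
  proof (intro allI impI ballI)
    fix r p assume *: "(\<Sum>p\<in>K \<times> Y. vscale (r p) (vscale (x (fst p)) (unit_vec (snd p)))) \<in> FF J"
      and p: "p \<in> K \<times> Y"
    have "(\<Sum>p\<in>K \<times> Y. vscale (r p) (vscale (x (fst p)) (unit_vec (snd p)))) (snd p) \<in> J"
      using * unfolding FF_def by blast
    then have "(\<Sum>k\<in>K. r (k, snd p) * x k) \<in> J" unfolding ap using p by auto
    then have "r (fst p, snd p) \<in> \<mm>"
      using x p ring.indepD[of J K x "\<lambda>k. r (k, snd p)" "fst p"] by (auto simp: ring.basis_def)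
    then show "r p \<in> \<mm>" by simp
  qed
  moreover have "vec.spans (FF I) (FF J) (K \<times> Y) (\<lambda>p. vscale (x (fst p)) (unit_vec (snd p)))"
    unfolding vec.spans_def
  proof
    fix v assume v: "v \<in> FF I"
    then have "\<forall>y. \<exists>r. v y - (\<Sum>k\<in>K. r k * x k) \<in> J"
      using x unfolding FF_def ring.basis_def ring.spans_def by blast
    then obtain r where r: "\<And>y. v y - (\<Sum>k\<in>K. r y k * x k) \<in> J" by metis
    have "v - (\<Sum>p\<in>K \<times> Y. vscale (r (snd p) (fst p)) (vscale (x (fst p)) (unit_vec (snd p)))) \<in> FF J"
      unfolding FF_def mem_Collect_eq minus_fun_apply ap
      using r v ring_module.subspace_0[OF J] by (auto simp: FF_def)
    then show "\<exists>r. v - (\<Sum>p\<in>K \<times> Y. vscale (r p) (vscale (x (fst p)) (unit_vec (snd p)))) \<in> FF J"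
      by (rule exI[where x = "\<lambda>p. r (snd p) (fst p)"])
  qed
  moreover have "\<forall>p\<in>K \<times> Y. vscale (x (fst p)) (unit_vec (snd p)) \<in> FF I"
    using x by (auto simp: ring.basis_def intro!: scale_unit_vec[OF I])
  ultimately show ?thesis by (simp add: vec.basis_def)
qed

lemma mM_lift:
  assumes "z \<in> mM"
  obtains v where "v \<in> FF \<mm>" "ev v = z"
proof -
  have FF: "vec.subspace (FF \<mm>)" by (rule subspace_FF[OF ideal_maximal])
  have "mM \<subseteq> ev ` FF \<mm>"
  proof (rule ideal_mult_minimal)
    fix a x assume "a \<in> \<mm>"
    then have "vscale a (coord x) \<in> FF \<mm>" using coord_in[of x] mult_in' by (auto simp: FF_def)
    then show "a *s x \<in> ev ` FF \<mm>" by (rule rev_image_eqI) (simp add: ev_scale ev_coord)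
  next
    show "subspace (ev ` FF \<mm>)"
    proof (rule subspaceI)
      show "0 \<in> ev ` FF \<mm>" by (rule rev_image_eqI[OF vec.subspace_0[OF FF]]) (simp add: ev_def)
    next
      fix x y assume "x \<in> ev ` FF \<mm>" "y \<in> ev ` FF \<mm>"
      then show "x + y \<in> ev ` FF \<mm>" using vec.subspace_add[OF FF] by (force simp: ev_add[symmetric])
    next
      fix c x assume "x \<in> ev ` FF \<mm>"
      then show "c *s x \<in> ev ` FF \<mm>" using vec.subspace_scale[OF FF] by (force simp: ev_scale[symmetric])
    qed
  qed
  then show ?thesis using assms that by blast
qed

lemma ev_mM: "v \<in> FF \<mm> \<Longrightarrow> ev v \<in> mM"
  unfolding ev_def by (intro subspace_sum[OF subspace_mM] in_ideal_mult) (auto simp: FF_def)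

text \<open>\<open>ev\<close> induces an isomorphism of \<open>FF \<mm> / U\<close> with
  \<open>mM\<close>, so any lifts of \<open>Z\<close> to \<open>FF \<mm>\<close> will do.\<close>

lemma basis_Z: "\<exists>\<zeta>. vec.basis (FF \<mm>) U Z \<zeta>"
proof -
  have "\<forall>z\<in>Z. \<exists>v. v \<in> FF \<mm> \<and> ev v = z" using mM_lift Z_sub by metis
  from bchoice[OF this] obtain \<zeta> where \<zeta>: "\<And>z. z \<in> Z \<Longrightarrow> \<zeta> z \<in> FF \<mm>" "\<And>z. z \<in> Z \<Longrightarrow> ev (\<zeta> z) = z"
    by blast
  have ev: "ev (\<Sum>z\<in>Z. vscale (r z) (\<zeta> z)) = (\<Sum>z\<in>Z. r z *s z)" for r
    by (simp only: ev_sum ev_scale) (intro sum.cong refl, simp only: \<zeta>(2))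
  have FF: "vec.subspace (FF \<mm>)" by (rule subspace_FF[OF ideal_maximal])
  have "vec.indep U Z \<zeta>"
    unfolding vec.indep_def
  proof (intro allI impI ballI)
    fix r z assume "(\<Sum>z\<in>Z. vscale (r z) (\<zeta> z)) \<in> U" and z: "z \<in> Z"
    then have "(\<Sum>z\<in>Z. r z *s z) \<in> {0}" using ev by (simp only: U_def mem_Collect_eq) simp
    then show "r z \<in> \<mm>" using indepD[OF indep_Z] z by blast
  qed
  moreover have "vec.spans (FF \<mm>) U Z \<zeta>"
    unfolding vec.spans_def
  proof
    fix v assume v: "v \<in> FF \<mm>"
    obtain r where r: "ev v = (\<Sum>z\<in>Z. r z *s z)" using Z_combination[OF ev_mM[OF v]] .
    have "v - (\<Sum>z\<in>Z. vscale (r z) (\<zeta> z)) \<in> FF \<mm>"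
      by (intro vec.subspace_diff[OF FF] v vec.subspace_sum[OF FF] vec.subspace_scale[OF FF] \<zeta>)
    then have "v - (\<Sum>z\<in>Z. vscale (r z) (\<zeta> z)) \<in> FF UNIV" using FF_mono[of \<mm> UNIV] by blast
    moreover have "ev (v - (\<Sum>z\<in>Z. vscale (r z) (\<zeta> z))) = 0" by (simp only: ev_diff ev r diff_self)
    ultimately have "v - (\<Sum>z\<in>Z. vscale (r z) (\<zeta> z)) \<in> U" unfolding U_def by blast
    then show "\<exists>r. v - (\<Sum>z\<in>Z. vscale (r z) (\<zeta> z)) \<in> U" by blast
  qed
  ultimately show ?thesis using \<zeta>(1) by (auto simp: vec.basis_def)
qed

end

text \<open>To be read with \<open>a = \<nu>(M)\<close>, \<open>b = \<nu>(\<mm> M)\<close>, \<open>e = dim \<mm>/\<mm>\<^sup>2\<close>, \<open>f = dim \<mm>\<^sup>2/\<mm>\<^sup>3\<close>, \<open>p = dim U/\<mm> U\<close>,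
  \<open>p0 = dim U/\<mm>\<^sup>2 F\<close>, \<open>t = dim \<mm>\<^sup>2 F/\<mm> U\<close> and \<open>v = dim \<mm> U/\<mm>\<^sup>3 F\<close>.\<close>

lemma no_cubes:
  fixes a b e f p p0 t v :: nat
  assumes ea: "e * a = b + p0" and p: "p = p0 + t" and fa: "f * a = t + v"
    and bp: "b * p < a * a" and main: "a * p + b * v \<le> e * p * b" and ba: "b \<le> a" and p0: "0 < p"
  shows "f = 0"
proof (rule ccontr)
  assume "f \<noteq> 0"
  have a: "0 < a" using bp by (cases a) auto
  then have "1 * a \<le> f * a" using \<open>f \<noteq> 0\<close> by (intro mult_right_mono) auto
  then have v: "int a \<le> int t + int v" using fa by linarith
  have ba': "int b \<le> int a" using ba by simp
  have b: "0 < b" using main a p0 by (cases b) auto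
  have ea': "int e * int a = int b + int p - int t"
    using ea p by (simp flip: of_nat_mult of_nat_add add: of_nat_diff)
  \<comment> \<open>Multiplying \<open>main\<close> by \<open>a\<close> lets \<open>e * a\<close> be
    replaced by \<open>b + p - t\<close>; with \<open>b * p < a * a\<close> and division by
    \<open>b\<close> this leaves \<open>a * v < p * (b - t)\<close>.\<close>
  have "int a * (int a * int p + int b * int v) \<le> int a * (int e * int p * int b)"
    using main by (intro mult_left_mono) (simp_all flip: of_nat_mult of_nat_add)
  also have "\<dots> = (int e * int a) * (int p * int b)" by (simp add: algebra_simps)
  also have "\<dots> = (int b + int p - int t) * (int p * int b)" unfolding ea' ..
  finally have "int a * int b * int v \<le> int p * (int b * int p + int b * int b - int b * int t - int a * int a)"
    by (simp add: algebra_simps)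
  also have "\<dots> < int p * (int b * (int b - int t))"
  proof -
    have "int b * int p < int a * int a" using bp by (simp flip: of_nat_mult)
    then show ?thesis using p0 by (intro mult_strict_left_mono) (simp_all add: algebra_simps)
  qed
  finally have "int b * (int a * int v) < int b * (int p * (int b - int t))" by (simp add: algebra_simps)
  then have av: "int a * int v < int p * (int b - int t)" using b by simp
  have bt: "0 < int b - int t"
  proof (rule ccontr)
    assume "\<not> ?thesis"
    then have "int p * (int b - int t) \<le> 0" by (simp add: mult_nonneg_nonpos)
    then show False using av by (smt (verit) mult_nonneg_nonneg of_nat_0_le_iff)
  qed
  \<comment> \<open>Multiplication by \<open>b\<close> makes \<open>b * p < a * a\<close> usable
    once more; with \<open>v \<ge> a - t\<close> the result is \<open>a * t < b * t\<close>, against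
    \<open>b \<le> a\<close>.\<close>
  have "int a * (int b * int v) < (int b * int p) * (int b - int t)"
    using mult_strict_left_mono[OF av, of "int b"] b by (simp add: algebra_simps)
  also have "\<dots> \<le> (int a * int a) * (int b - int t)"
    using bp bt by (intro mult_right_mono) (simp_all flip: of_nat_mult)
  finally have "int a * (int b * int v) < int a * (int a * (int b - int t))" by (simp add: algebra_simps)
  then have bv: "int b * int v < int a * (int b - int t)" using a by simp
  have "int b * (int a - int t) \<le> int b * int v" using v by (intro mult_left_mono) auto
  then have "int a * int t < int b * int t" using bv by (simp add: algebra_simps)
  moreover have "int b * int t \<le> int a * int t" using ba' by (intro mult_right_mono) auto
  ultimately show False by simp
qed

text \<open>These numbers belong to the case \<open>m2 = {0}\<close>. For \<open>e \<ge> 2\<close>,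
  multiplying \<open>ea\<close> by \<open>e\<close> and estimating gives
  \<open>2 * (e * a) \<le> e * a + a\<close>, which forces \<open>a = 0\<close>; for
  \<open>e \<le> 1\<close> the hypotheses contradict \<open>0 < p\<close> directly.\<close>

lemma no_squares:
  fixes a b e p :: nat
  assumes ea: "e * a = b + p" and ep: "e * p \<le> a" and ap: "a \<le> e * b" and ba: "b \<le> a" and p: "0 < p"
  shows False
proof -
  consider "e = 0" | "e = 1" | "2 \<le> e" by linarith
  then show False
  proof cases
    case 3
    have "2 * (e * a) \<le> e * (e * a)" using 3 by (intro mult_right_mono) auto
    also have "\<dots> = e * b + e * p" unfolding ea by (simp add: distrib_left)
    also have "\<dots> \<le> e * a + a" using ep ba by (intro add_mono mult_left_mono) auto
    finally have "e * a \<le> a" by simp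
    then have "2 * a \<le> a" using 3 mult_right_mono[of 2 e a] by simp
    then have "a = 0" by simp
    then show False using ea p by simp
  qed (use assms in auto)
qed

section \<open>The case \<open>\<nu>(\<mm> M) \<le> \<nu>(M)\<close>\<close>

context syzygy_socle
begin

text \<open>The equations count dimensions in
  \<open>FF \<mm> \<supseteq> U \<supseteq> FF m2\<close> and
  \<open>FF m2 \<supseteq> mU \<supseteq> FF m3\<close>. The index type of \<open>P\<close> is a sum
  because a basis of \<open>U / mU\<close> is put together from bases of \<open>U / FF m2\<close>
  and \<open>FF m2 / mU\<close>.\<close>

lemma presentation_bases:
  obtains e f p t v :: nat and x g :: "nat \<Rightarrow> 'a" and P :: "(nat + nat) set"
    and u :: "nat + nat \<Rightarrow> 'b \<Rightarrow> 'a" and w :: "nat \<Rightarrow> 'b \<Rightarrow> 'a"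
  where "local_module.basis \<mm> (*) \<mm> m2 {..<e} x" "local_module.basis \<mm> (*) m2 m3 {..<f} g"
    "finite P" "vec.basis U mU P u" "vec.basis mU (FF m3) {..<v} w"
    "e * card Y = card Z + p" "card P = p + t" "f * card Y = t + v"
proof -
  interpret ring: local_module \<mm> "(*)" by (rule local_module_ring)
  obtain e :: nat and x where x: "ring.basis \<mm> m2 {..<e} x"
    using finite_basis_ideals[OF ideal_mult_ring, of \<mm> \<mm> \<mm>] in_ideal_mult_ring
    unfolding ring.kills_def by blast
  obtain f :: nat and g where g: "ring.basis m2 m3 {..<f} g"
    using finite_basis_ideals[OF ideal_mult_ring, of m2 \<mm> m2] in_ideal_mult_ring
    unfolding ring.kills_def by blast
  have sub: "vec.subspace (FF m2)" "vec.subspace (FF m3)" "vec.subspace mU"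
    by (intro subspace_FF ideal_mult_ring vec.subspace_ideal_mult)+
  have k: "vec.kills (FF \<mm>) (FF m2)" "vec.kills (FF m2) (FF m3)" by (rule kills_FF)+
  have kU: "vec.kills U (FF m2)" "vec.kills (FF m2) mU" "vec.kills mU (FF m3)" "vec.kills U mU"
    using vec.kills_mono[OF k(1) U_le] vec.kills_mono[OF k(2) _ FF_m3_le]
      vec.kills_mono[OF k(2) mU_le] vec.kills_ideal_mult by auto
  have basis1: "vec.basis (FF \<mm>) (FF m2) ({..<e} \<times> Y) (\<lambda>p. vscale (x (fst p)) (unit_vec (snd p)))"
    by (rule basis_FF[OF ideal_maximal ideal_mult_ring _ x]) simp
  have basis2: "vec.basis (FF m2) (FF m3) ({..<f} \<times> Y) (\<lambda>p. vscale (g (fst p)) (unit_vec (snd p)))"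
    by (rule basis_FF[OF ideal_mult_ring ideal_mult_ring _ g]) simp
  have fin: "finite ({..<e} \<times> Y)" "finite ({..<f} \<times> Y)" using finite_Y by auto
  obtain p :: nat and u0 where u0: "vec.basis U (FF m2) {..<p} u0"
  proof (rule vec.basis_exists[OF sub(1) kU(1) fin(1)])
    show "vec.spans (FF \<mm>) (FF m2) ({..<e} \<times> Y) (\<lambda>p. vscale (x (fst p)) (unit_vec (snd p)))"
      using basis1 by (simp only: vec.basis_def)
    show "U \<subseteq> FF \<mm>" by (rule U_le)
    show "vscale r (vscale (x (fst i)) (unit_vec (snd i))) \<in> FF m2"
      if "r \<in> \<mm>" "i \<in> {..<e} \<times> Y" for r i
      using basis1 that vec.killsD[OF k(1)] unfolding vec.basis_def by blast
  qed blast
  have s2: "vec.spans (FF m2) (FF m3) ({..<f} \<times> Y) (\<lambda>p. vscale (g (fst p)) (unit_vec (snd p)))"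
    using basis2 by (simp only: vec.basis_def)
  have m2: "vscale r (vscale (g (fst i)) (unit_vec (snd i))) \<in> FF m3"
    if "r \<in> \<mm>" "i \<in> {..<f} \<times> Y" for r i
    using basis2 that vec.killsD[OF k(2)] unfolding vec.basis_def by blast
  obtain t :: nat and u1 where u1: "vec.basis (FF m2) mU {..<t} u1"
    by (rule vec.basis_exists[OF sub(3) kU(2) fin(2) vec.spans_mono[OF s2 subset_refl FF_m3_le] _ subset_refl])
      (use m2 FF_m3_le in blast)+
  obtain v :: nat and w where w: "vec.basis mU (FF m3) {..<v} w"
    by (rule vec.basis_exists[OF sub(2) kU(3) fin(2) s2 m2 mU_le])
  obtain \<zeta> where \<zeta>: "vec.basis (FF \<mm>) U Z \<zeta>" using basis_Z by blast
  have "card ({..<e} \<times> Y) = card Z + card {..<p}"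
    by (rule vec.basis_card_add[OF subspace_U sub(1) FF_m2_le U_le k(1) finite_Z _ fin(1) \<zeta> u0 basis1]) simp
  then have 1: "e * card Y = card Z + p" by (simp add: card_cartesian_product)
  have "card ({..<f} \<times> Y) = card {..<t} + card {..<v}"
    by (rule vec.basis_card_add[OF sub(3,2) FF_m3_le mU_le k(2) _ _ fin(2) u1 w basis2]) auto
  then have 2: "f * card Y = t + v" by (simp add: card_cartesian_product)
  have "vec.basis U mU ({..<p} <+> {..<t}) (case_sum u0 u1)"
    by (rule vec.basis_append[OF sub(1,3) mU_le FF_m2_le kU(4) _ _ u0 u1]) auto
  from that[OF x g _ this w 1 _ 2] show ?thesis by (simp add: card_Plus)
qed

lemma free_if_basis_empty:
  assumes "vec.basis U mU P u" "P = {}"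
  shows "free_module scale"
proof (rule free_if_U_eq_mU)
  show "U \<subseteq> mU" using assms unfolding vec.basis_def vec.spans_def by (simp add: subset_iff)
qed

lemma free_if_Y_empty:
  assumes "Y = {}"
  shows "free_module scale"
proof (rule free_if_syzygy_zero, rule subsetI)
  fix v assume "v \<in> U"
  then have "v y = 0" for y using assms unfolding U_def FF_def by blast
  then show "v \<in> {0}" by (simp add: fun_eq_iff)
qed

lemma free_if_socle_le:
  assumes exM: "exact_at scale scale (Suc 0)" and exR: "exact_at scale (*) (Suc 0)"
    and le: "card Z \<le> card Y"
  shows "free_module scale"
proof (rule ccontr)
  assume not_free: "\<not> ?thesis"
  interpret ring: local_module \<mm> "(*)" by (rule local_module_ring)
  interpret R: artinian_local_module \<mm> "(*)"
    by (intro artinian_local_module.intro artinian_local_ring_axioms module_mult)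
  obtain e f p t v :: nat and x g :: "nat \<Rightarrow> 'a" and P :: "(nat + nat) set" and u w
    where x: "ring.basis \<mm> m2 {..<e} x" and g: "ring.basis m2 m3 {..<f} g"
      and P: "finite P" and u: "vec.basis U mU P u" and w: "vec.basis mU (FF m3) {..<v::nat} w"
      and card: "e * card Y = card Z + p" "card P = p + t" "f * card Y = t + v"
    by (rule presentation_bases)
  have P0: "0 < card P" using free_if_basis_empty[OF u] not_free P by (auto simp: card_gt_0_iff)
  have Y0: "Y \<noteq> {}" using free_if_Y_empty not_free by blast
  note ZP = card_Z_times_syzygy[OF exM u P Y0]
  have main: "card Y * card P + card Z * v \<le> e * card P * card Z"
    using card_syzygy_bound[OF exM u P w _ x] by simp
  have f: "f = 0" by (rule no_cubes[OF card(1,2,3) ZP main le P0])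
  \<comment> \<open>The empty family spans \<open>m2 / m3\<close>, and Nakayama's lemma then makes
    \<open>m2\<close> zero.\<close>
  have "m2 \<subseteq> m3"
    using g unfolding f ring.basis_def ring.spans_def by (simp add: subset_iff)
  then have "m2 \<subseteq> {w + v | w v. w \<in> {0} \<and> v \<in> m3}" by (simp add: subset_iff)
  then have "m2 \<subseteq> {0}" by (rule R.nakayama[OF ring_module.subspace_single_0])
  then have m2: "m2 = {0}" using ring_module.subspace_0[OF ideal_mult_ring] by blast
  have t: "t = 0" "v = 0" using card(3) f by auto
  have "e * card P \<le> card Y" using card_ring_bound[OF exR u P m2 x] by simp
  moreover have "card Y * card P \<le> (e * card Z) * card P" using main t by (simp add: algebra_simps)
  then have "card Y \<le> e * card Z" using P0 by simp
  ultimately show False using no_squares[of e "card Y" "card Z" "card P"] card t le P0 by simp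
qed

end

section \<open>Ext with coefficients in the residue field\<close>

context syzygy_socle
begin

sublocale coch: local_module \<mm> "vscale :: 'a \<Rightarrow> (('a, 'b) gen \<Rightarrow> 'a) \<Rightarrow> ('a, 'b) gen \<Rightarrow> 'a"
  by (intro local_module.intro module_vscale) unfold_locales

text \<open>\<open>Ext\<^sup>i(M, R/\<mm>)\<close> is \<open>ZZ i / BB i\<close>; its cocycles and coboundaries are lifted to functions with
  values in \<open>R\<close>.\<close>

definition ZZ :: "nat \<Rightarrow> (('a, 'b) gen \<Rightarrow> 'a) set"
  where "ZZ i = {f. \<forall>xs. Rel xs \<in> gens scale (Suc i) \<longrightarrow> comb (*) f xs \<in> \<mm>}"

definition BB :: "nat \<Rightarrow> (('a, 'b) gen \<Rightarrow> 'a) set"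
  where "BB i = {f. \<exists>h. \<forall>g\<in>gens scale i. f g - codiff (*) h g \<in> \<mm>}"

lemma codiff_add: "codiff (*) (h + k) g = codiff (*) h g + (codiff (*) k g :: 'a)"
  by (cases g) (simp_all add: codiff_def plus_fun_def ring_module.comb_add)

lemma codiff_scale: "codiff (*) (vscale c h) g = c * (codiff (*) h g :: 'a)"
  by (cases g) (simp_all add: codiff_def vscale_def ring_module.comb_scale)

lemma codiff_zero: "codiff (*) (\<lambda>_. 0) g = (0 :: 'a)"
  using codiff_scale[of 0 "\<lambda>_. 0" g] by (simp add: vscale_def)

lemma BB_I: "(\<And>g. g \<in> gens scale i \<Longrightarrow> f g \<in> \<mm>) \<Longrightarrow> f \<in> BB i"
  unfolding BB_def by (intro CollectI exI[of _ "\<lambda>_. 0"]) (simp add: codiff_zero)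

lemma subspace_BB: "coch.subspace (BB i)"
proof (rule coch.subspaceI)
  show "0 \<in> BB i" by (rule BB_I) (simp add: zero_in)
next
  fix f k assume "f \<in> BB i" "k \<in> BB i"
  then obtain h j where hj: "\<And>g. g \<in> gens scale i \<Longrightarrow> f g - codiff (*) h g \<in> \<mm>"
    "\<And>g. g \<in> gens scale i \<Longrightarrow> k g - codiff (*) j g \<in> \<mm>" unfolding BB_def by blast
  have "(f + k) g - codiff (*) (h + j) g = (f g - codiff (*) h g) + (k g - codiff (*) j g)" for g
    unfolding codiff_add by simp
  then show "f + k \<in> BB i" using hj add_in unfolding BB_def
    by (intro CollectI exI[of _ "h + j"]) (simp only:, blast)
next
  fix c f assume "f \<in> BB i"
  then obtain h where h: "\<And>g. g \<in> gens scale i \<Longrightarrow> f g - codiff (*) h g \<in> \<mm>" unfolding BB_def by blast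
  have "(vscale c f) g - codiff (*) (vscale c h) g = c * (f g - codiff (*) h g)" for g
    unfolding codiff_scale by (simp add: right_diff_distrib)
  then show "vscale c f \<in> BB i" using h mult_in unfolding BB_def
    by (intro CollectI exI[of _ "vscale c h"]) (simp only:, blast)
qed

lemma kills_BB: "coch.kills A (BB i)"
  unfolding coch.kills_def by (intro ballI BB_I) (simp add: mult_in')

lemma comb_in_maximal_if:
  assumes "comb scale (\<lambda>g. \<Sum>y\<in>Y. f y g *s y) xs \<in> mM" "y \<in> Y"
  shows "comb (*) (f y) xs \<in> \<mm>"
proof -
  have "(\<Sum>y\<in>Y. comb (*) (f y) xs *s y) \<in> mM"
    using assms(1) by (simp add: comb_sum comb_scale_left)
  then show ?thesis using indepD[OF indep_Y, of "\<lambda>y. comb (*) (f y) xs"] assms(2) by simp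
qed

lemma comb_coord: "comb scale (\<lambda>g. \<Sum>y\<in>Y. coord (\<psi> g) y *s y) xs = comb scale \<psi> xs"
  using ev_coord by (simp add: ev_def)

text \<open>In the long exact sequence of \<open>0 \<rightarrow> mM \<rightarrow> M \<rightarrow>
  M/mM \<rightarrow> 0\<close>, the connecting map from degree \<open>i\<close> with values in
  \<open>M/mM\<close> to degree \<open>Suc i\<close> with values in \<open>mM\<close> is onto by
  \<open>ex\<close>. Its two sides are \<open>card Y\<close> and \<open>card Z\<close> copies of Ext
  into the residue field. The proof follows this map on cochains: \<open>\<psi>\<close> is a
  preimage of \<open>g c\<close> times \<open>z\<close>.\<close>

lemma Ext_residue_step:
  assumes ex: "exact_at scale scale (Suc i)"
    and f: "coch.spans (ZZ i) (BB i) {..<n::nat} f"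
    and g: "\<forall>c<k. g c \<in> ZZ (Suc i)" "coch.indep (BB (Suc i)) {..<k::nat} g"
  shows "card Z * k \<le> card Y * n"
proof (rule ccontr)
  assume neg: "\<not> ?thesis"
  have "\<forall>p\<in>{..<k} \<times> Z. \<exists>\<psi>. \<forall>xs. Rel xs \<in> gens scale (Suc i) \<longrightarrow>
      g (fst p) (Rel xs) *s snd p = comb scale \<psi> xs"
  proof
    fix p assume p: "p \<in> {..<k} \<times> Z"
    have *: "comb scale (\<lambda>h. g (fst p) h *s snd p) ys = 0" if "Rel ys \<in> gens scale (Suc (Suc i))" for ys
      unfolding comb_scale_left using g(1) p that Z_sub
      by (intro m_mM) (auto simp: ZZ_def simp del: gens.simps)
    show "\<exists>\<psi>. \<forall>xs. Rel xs \<in> gens scale (Suc i) \<longrightarrow> g (fst p) (Rel xs) *s snd p = comb scale \<psi> xs"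
      using ex * unfolding exact_at_def by (elim allE[of _ "\<lambda>h. g (fst p) h *s snd p"]) blast
  qed
  from bchoice[OF this] obtain \<psi> where \<psi>: "\<And>p xs. p \<in> {..<k} \<times> Z \<Longrightarrow> Rel xs \<in> gens scale (Suc i) \<Longrightarrow>
      g (fst p) (Rel xs) *s snd p = comb scale (\<psi> p) xs" by blast
  have sZ: "(\<lambda>h. coord (\<psi> p h) y) \<in> ZZ i" if p: "p \<in> {..<k} \<times> Z" and y: "y \<in> Y" for p y
    unfolding ZZ_def
  proof (intro CollectI allI impI)
    fix xs assume xs: "Rel xs \<in> gens scale (Suc i)"
    have "comb scale (\<psi> p) xs \<in> mM"
      unfolding \<psi>[OF p xs, symmetric] using p by (intro subspace_scale[OF subspace_mM] Z_sub) auto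
    then show "comb (*) (\<lambda>h. coord (\<psi> p h) y) xs \<in> \<mm>"
      using comb_in_maximal_if[of "\<lambda>y h. coord (\<psi> p h) y" xs y] y by (simp only: comb_coord)
  qed
  have "\<forall>p\<in>({..<k} \<times> Z) \<times> Y. \<exists>\<rho>. (\<lambda>h. coord (\<psi> (fst p) h) (snd p)) - (\<Sum>t<n. vscale (\<rho> t) (f t)) \<in> BB i"
  proof
    fix p assume "p \<in> ({..<k} \<times> Z) \<times> Y"
    then have "(\<lambda>h. coord (\<psi> (fst p) h) (snd p)) \<in> ZZ i" by (intro sZ) auto
    then show "\<exists>\<rho>. (\<lambda>h. coord (\<psi> (fst p) h) (snd p)) - (\<Sum>t<n. vscale (\<rho> t) (f t)) \<in> BB i"
      using f unfolding coch.spans_def by blast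
  qed
  from bchoice[OF this] obtain \<rho> where \<rho>': "\<forall>p\<in>({..<k} \<times> Z) \<times> Y.
      (\<lambda>h. coord (\<psi> (fst p) h) (snd p)) - (\<Sum>t<n. vscale (\<rho> p t) (f t)) \<in> BB i" by blast
  have \<rho>: "(\<lambda>h. coord (\<psi> p h) y) - (\<Sum>t<n. vscale (\<rho> (p, y) t) (f t)) \<in> BB i"
    if "p \<in> {..<k} \<times> Z" "y \<in> Y" for p y
    using bspec[OF \<rho>', of "(p, y)"] that by (simp only: fst_conv snd_conv mem_Sigma_iff simp_thms)
  have "card (Y \<times> {..<n}) < card ({..<k} \<times> Z)"
    using neg by (simp add: card_cartesian_product mult.commute)
  with underdetermined[of "Y \<times> {..<n}" "{..<k} \<times> Z" "\<lambda>q p. \<rho> (p, fst q) (snd q)"] finite_Y finite_Z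
  obtain r where r: "\<exists>p\<in>{..<k} \<times> Z. r p \<notin> \<mm>"
    "\<forall>q\<in>Y \<times> {..<n}. (\<Sum>p\<in>{..<k} \<times> Z. \<rho> (p, fst q) (snd q) * r p) \<in> \<mm>" by blast
  \<comment> \<open>The coordinate at \<open>y\<close> of a combination of the
    \<open>\<psi> p\<close>; by the choice of \<open>r\<close> its class in
    \<open>ZZ i / BB i\<close> is zero.\<close>
  define S where "S y = (\<Sum>p\<in>{..<k} \<times> Z. vscale (r p) (\<lambda>h. coord (\<psi> p h) y))" for y
  have "S y \<in> BB i" if y: "y \<in> Y" for y
  proof -
    have "S y = (\<Sum>p\<in>{..<k} \<times> Z. vscale (r p) ((\<lambda>h. coord (\<psi> p h) y) - (\<Sum>t<n. vscale (\<rho> (p, y) t) (f t)))) +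
        (\<Sum>t<n. vscale (\<Sum>p\<in>{..<k} \<times> Z. \<rho> (p, y) t * r p) (f t))"
    proof -
      have "(\<Sum>t<n. vscale (\<Sum>p\<in>{..<k} \<times> Z. \<rho> (p, y) t * r p) (f t)) =
          (\<Sum>p\<in>{..<k} \<times> Z. \<Sum>t<n. vscale (r p) (vscale (\<rho> (p, y) t) (f t)))"
        unfolding coch.scale_sum_left by (subst sum.swap) (simp only: coch.scale_scale mult.commute)
      then show ?thesis
        unfolding S_def by (simp only: coch.scale_right_diff_distrib coch.scale_sum_right sum_subtractf diff_add_cancel)
    qed
    moreover have "(\<Sum>p\<in>{..<k} \<times> Z. \<rho> (p, y) t * r p) \<in> \<mm>" if "t < n" for t
      using bspec[OF r(2), of "(y, t)"] y that by simp
    ultimately show ?thesis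
      using \<rho>[OF _ y] coch.killsD[OF kills_BB _ UNIV_I]
      by (simp only:) (intro coch.subspace_add[OF subspace_BB] coch.subspace_sum[OF subspace_BB], 
          auto intro!: coch.subspace_scale[OF subspace_BB])
  qed
  then have "\<forall>y\<in>Y. \<exists>h. \<forall>e\<in>gens scale i. S y e - codiff (*) h e \<in> \<mm>" unfolding BB_def by blast
  from bchoice[OF this] obtain h where h: "\<And>y e. y \<in> Y \<Longrightarrow> e \<in> gens scale i \<Longrightarrow> S y e - codiff (*) (h y) e \<in> \<mm>"
    by blast
  \<comment> \<open>Correcting the combination by a coboundary keeps its differential and brings its
    values into \<open>mM\<close>; the coordinates \<open>l\<close> of \<open>\<Psi>\<close> then
    bound the combinations of the \<open>g c\<close> modulo \<open>\<mm>\<close>.\<close>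
  define \<Psi> where "\<Psi> e = (\<Sum>y\<in>Y. (S y e - codiff (*) (h y) e) *s y)" for e
  have \<Psi>': "\<Psi> e = (\<Sum>p\<in>{..<k} \<times> Z. r p *s \<psi> p e) - (\<Sum>y\<in>Y. codiff (*) (h y) e *s y)" for e
  proof -
    have "(\<Sum>y\<in>Y. S y e *s y) = (\<Sum>p\<in>{..<k} \<times> Z. r p *s ev (coord (\<psi> p e)))"
      unfolding S_def ev_def sum_fun_apply vscale_apply scale_sum_left scale_sum_right scale_scale by (rule sum.swap)
    then show ?thesis by (simp only: \<Psi>_def scale_left_diff_distrib sum_subtractf ev_coord)
  qed
  have "\<forall>e\<in>gens scale i. \<exists>l. \<Psi> e = (\<Sum>z\<in>Z. l z *s z)"
  proof
    fix e assume "e \<in> gens scale i"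
    then have "\<Psi> e \<in> mM" unfolding \<Psi>_def by (intro subspace_sum[OF subspace_mM] in_ideal_mult h UNIV_I)
    then show "\<exists>l. \<Psi> e = (\<Sum>z\<in>Z. l z *s z)" by (rule Z_combination) blast
  qed
  from bchoice[OF this] obtain l where l: "\<And>e. e \<in> gens scale i \<Longrightarrow> \<Psi> e = (\<Sum>z\<in>Z. l e z *s z)" by blast
  have rel: "(\<Sum>c<k. r (c, z) * g c (Rel xs)) - comb (*) (\<lambda>e. l e z) xs \<in> \<mm>"
    if xs: "Rel xs \<in> gens scale (Suc i)" and z: "z \<in> Z" for xs z
  proof -
    have "comb scale \<Psi> xs = comb scale (\<lambda>e. \<Sum>z\<in>Z. l e z *s z) xs"
    proof (rule comb_cong)
      fix c e assume "(c, e) \<in> set xs"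
      then have "e \<in> gens scale i" using xs by force
      then show "c *s \<Psi> e = c *s (\<Sum>z\<in>Z. l e z *s z)" by (simp only: l)
    qed
    then have 1: "comb scale \<Psi> xs = (\<Sum>z\<in>Z. comb (*) (\<lambda>e. l e z) xs *s z)"
      by (simp only: comb_sum comb_scale_left)
    have "comb scale \<Psi> xs = (\<Sum>p\<in>{..<k} \<times> Z. r p *s comb scale (\<psi> p) xs) -
        (\<Sum>y\<in>Y. comb (*) (codiff (*) (h y)) xs *s y)"
      unfolding \<Psi>' by (simp only: comb_diff comb_sum comb_scale comb_scale_left)
    also have "(\<Sum>y\<in>Y. comb (*) (codiff (*) (h y)) xs *s y) = 0"
      using ring_module.comb_codiff[OF xs] by simp
    also have "(\<Sum>p\<in>{..<k} \<times> Z. r p *s comb scale (\<psi> p) xs) =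
        (\<Sum>p\<in>{..<k} \<times> Z. (r p * g (fst p) (Rel xs)) *s snd p)"
      by (intro sum.cong refl) (simp only: \<psi>[OF _ xs, symmetric] scale_scale)
    also have "\<dots> = (\<Sum>z\<in>Z. (\<Sum>c<k. r (c, z) * g c (Rel xs)) *s z)"
      unfolding sum.cartesian_product' scale_sum_left fst_conv snd_conv by (rule sum.swap)
    finally have "(\<Sum>z\<in>Z. ((\<Sum>c<k. r (c, z) * g c (Rel xs)) - comb (*) (\<lambda>e. l e z) xs) *s z) \<in> {0}"
      unfolding 1 by (simp add: scale_left_diff_distrib sum_subtractf)
    then show ?thesis
      using indepD[OF indep_Z, of "\<lambda>z. (\<Sum>c<k. r (c, z) * g c (Rel xs)) - comb (*) (\<lambda>e. l e z) xs"] z by blast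
  qed
  have "r (c, z) \<in> \<mm>" if c: "c < k" and z: "z \<in> Z" for c z
  proof -
    have "(\<Sum>c<k. vscale (r (c, z)) (g c)) \<in> BB (Suc i)"
      unfolding BB_def
    proof (intro CollectI exI[of _ "\<lambda>e. l e z"] ballI)
      fix e assume e: "e \<in> gens scale (Suc i)"
      then obtain xs where xs: "e = Rel xs" by auto
      show "(\<Sum>c<k. vscale (r (c, z)) (g c)) e - codiff (*) (\<lambda>e. l e z) e \<in> \<mm>"
        using rel[OF e[unfolded xs] z] by (simp add: xs)
    qed
    then show ?thesis using coch.indepD[OF g(2), of "\<lambda>c. r (c, z)" c] c by simp
  qed
  then show False using r(1) by auto
qed

text \<open>Since \<open>card Y < card Z\<close>, \<open>Ext_residue_step\<close> makes the
  dimension drop unless it is already \<open>0\<close>; the form \<open>n \<le> Suc q\<close> covers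
  both cases without subtraction.\<close>

lemma Ext_residue_decreasing:
  assumes ex: "exact_at scale scale (Suc i)" and less: "card Y < card Z"
    and n: "n \<le> Suc q" and f: "coch.spans (ZZ i) (BB i) {..<n::nat} f"
  shows "\<exists>n f. n \<le> q \<and> coch.spans (ZZ (Suc i)) (BB (Suc i)) {..<n::nat} f"
proof -
  have "k \<le> q" if g: "\<forall>c<k. g c \<in> ZZ (Suc i)" "coch.indep (BB (Suc i)) {..<k} g" for k g
  proof -
    have *: "card Z * k \<le> card Y * n" by (rule Ext_residue_step[OF ex f g])
    show ?thesis
    proof (rule ccontr)
      assume "\<not> ?thesis"
      then have "card Y * n \<le> card Y * k" using n by (intro mult_left_mono) auto
      also have "\<dots> < card Z * k" using less \<open>\<not> k \<le> q\<close> by (intro mult_strict_right_mono) auto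
      finally show False using * by simp
    qed
  qed
  then have "\<exists>n f. n \<le> q \<and> coch.basis (ZZ (Suc i)) (BB (Suc i)) {..<n::nat} f"
    by (intro coch.basis_exists_bounded[OF subspace_BB kills_BB])
  then show ?thesis unfolding coch.basis_def by blast
qed

text \<open>In degree \<open>0\<close>, Ext is \<open>Hom(M, R/\<mm>)\<close>, and a homomorphism is
  determined by its values on \<open>Y\<close>.\<close>

lemma Ext_residue_0:
  "\<exists>n f. n \<le> card Y \<and> coch.spans (ZZ 0) (BB 0) {..<n::nat} f"
proof -
  have "coch.spans (ZZ 0) (BB 0) Y (\<lambda>y g. gen_coord g y)"
    unfolding coch.spans_def
  proof
    fix f assume f: "f \<in> ZZ 0"
    have "f - (\<Sum>y\<in>Y. vscale (f (Elem y)) (\<lambda>g. gen_coord g y)) \<in> BB 0"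
    proof (rule BB_I)
      fix g assume "g \<in> gens scale 0"
      then obtain x where g: "g = Elem x" by auto
      let ?xs = "(1, Elem x) # combo (- coord x)"
      have "augmentation scale (combination ?xs) = 0"
        unfolding augmentation_comb comb_Cons comb_combo
        using ev_coord[of x] by (simp add: ev_def sum_negf fun_Compl_def)
      then have "Rel ?xs \<in> gens scale (Suc 0)" by (auto simp: combo_def)
      then have "comb (*) f ?xs \<in> \<mm>" using f unfolding ZZ_def by blast
      then show "(f - (\<Sum>y\<in>Y. vscale (f (Elem y)) (\<lambda>g. gen_coord g y))) g \<in> \<mm>"
        unfolding comb_Cons comb_combo
        by (simp add: g gen_coord_def sum_negf fun_Compl_def mult.commute)
    qed
    then show "\<exists>r. f - (\<Sum>y\<in>Y. vscale (r y) (\<lambda>g. gen_coord g y)) \<in> BB 0"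
      by (rule exI[where x = "\<lambda>y. f (Elem y)"])
  qed
  then obtain n f where "n \<le> card Y" "coch.basis (ZZ 0) (BB 0) {..<n::nat} f"
    using coch.basis_exists[OF subspace_BB kills_BB finite_Y _ coch.killsD[OF kills_BB _ UNIV_I] subset_refl]
    by blast
  then show ?thesis unfolding coch.basis_def by blast
qed

text \<open>Exactness one place further on: by \<open>ex\<close>, Ext in degree \<open>Suc i\<close>
  with values in \<open>M/mM\<close> embeds into degree \<open>Suc (Suc i)\<close> with values in
  \<open>mM\<close>, which is zero by \<open>zero\<close>. One generator \<open>y0\<close> suffices
  to place \<open>R/\<mm>\<close> inside \<open>M/mM\<close>.\<close>

lemma Ext_residue_back:
  assumes ex: "exact_at scale scale (Suc i)" and zero: "ZZ (Suc (Suc i)) \<subseteq> BB (Suc (Suc i))" and y0: "y0 \<in> Y"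
  shows "ZZ (Suc i) \<subseteq> BB (Suc i)"
proof
  fix f assume f: "f \<in> ZZ (Suc i)"
  have "\<forall>e\<in>gens scale (Suc (Suc i)). \<exists>l. codiff scale (\<lambda>g. f g *s y0) e = (\<Sum>z\<in>Z. l z *s z)"
  proof
    fix e assume e: "e \<in> gens scale (Suc (Suc i))"
    then obtain xs where xs: "e = Rel xs" by auto
    have "comb (*) f xs \<in> \<mm>" using f e unfolding ZZ_def xs by blast
    then have "codiff scale (\<lambda>g. f g *s y0) e \<in> mM"
      unfolding xs codiff_Rel comb_scale_left by (intro in_ideal_mult UNIV_I)
    then show "\<exists>l. codiff scale (\<lambda>g. f g *s y0) e = (\<Sum>z\<in>Z. l z *s z)" by (rule Z_combination) blast
  qed
  from bchoice[OF this] obtain l where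
    l: "\<And>e. e \<in> gens scale (Suc (Suc i)) \<Longrightarrow> codiff scale (\<lambda>g. f g *s y0) e = (\<Sum>z\<in>Z. l e z *s z)" by blast
  have "(\<lambda>e. l e z) \<in> ZZ (Suc (Suc i))" if z: "z \<in> Z" for z
    unfolding ZZ_def
  proof (intro CollectI allI impI)
    fix ys assume ys: "Rel ys \<in> gens scale (Suc (Suc (Suc i)))"
    have "comb scale (\<lambda>e. \<Sum>z\<in>Z. l e z *s z) ys = comb scale (codiff scale (\<lambda>g. f g *s y0)) ys"
    proof (rule comb_cong)
      fix c e assume "(c, e) \<in> set ys"
      then have "e \<in> snd ` set ys" by force
      then have "e \<in> gens scale (Suc (Suc i))" using ys by (subst (asm) gens.simps(2)) blast
      then show "c *s (\<Sum>z\<in>Z. l e z *s z) = c *s codiff scale (\<lambda>g. f g *s y0) e" by (simp only: l)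
    qed
    also have "\<dots> = 0" by (rule comb_codiff[OF ys])
    finally have "(\<Sum>z\<in>Z. comb (*) (\<lambda>e. l e z) ys *s z) \<in> {0}" by (simp only: comb_sum comb_scale_left singleton_iff)
    then show "comb (*) (\<lambda>e. l e z) ys \<in> \<mm>"
      using indepD[OF indep_Z, of "\<lambda>z. comb (*) (\<lambda>e. l e z) ys"] z by blast
  qed
  then have "\<forall>z\<in>Z. \<exists>h. \<forall>e\<in>gens scale (Suc (Suc i)). l e z - codiff (*) h e \<in> \<mm>"
    using zero unfolding BB_def by blast
  from bchoice[OF this] obtain h where
    h: "\<And>z e. z \<in> Z \<Longrightarrow> e \<in> gens scale (Suc (Suc i)) \<Longrightarrow> l e z - codiff (*) (h z) e \<in> \<mm>" by blast
  \<comment> \<open>\<open>f\<close> times \<open>y0\<close> is a cocycle only modulo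
    \<open>mM\<close>; the correction by \<open>h\<close> turns it into a cocycle with values in
    \<open>M\<close>.\<close>
  define \<Phi> where "\<Phi> g = f g *s y0 - (\<Sum>z\<in>Z. h z g *s z)" for g
  obtain \<psi> where \<psi>: "\<And>xs. Rel xs \<in> gens scale (Suc i) \<Longrightarrow> \<Phi> (Rel xs) = comb scale \<psi> xs"
  proof (rule exact_atE[OF ex, of \<Phi>])
    fix xs assume xs: "Rel xs \<in> gens scale (Suc (Suc i))"
    have "comb scale \<Phi> xs = codiff scale (\<lambda>g. f g *s y0) (Rel xs) - (\<Sum>z\<in>Z. comb (*) (h z) xs *s z)"
      unfolding \<Phi>_def by (simp only: comb_diff comb_sum comb_scale_left codiff_Rel)
    also have "\<dots> = (\<Sum>z\<in>Z. (l (Rel xs) z - codiff (*) (h z) (Rel xs)) *s z)"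
      unfolding l[OF xs] by (simp only: scale_left_diff_distrib sum_subtractf codiff_Rel)
    also have "\<dots> = 0" by (intro sum.neutral ballI m_mM h xs Z_sub)
    finally show "comb scale \<Phi> xs = 0" .
  qed blast
  show "f \<in> BB (Suc i)"
    unfolding BB_def
  proof (intro CollectI exI[of _ "\<lambda>g. coord (\<psi> g) y0"] ballI)
    fix e assume e: "e \<in> gens scale (Suc i)"
    then obtain xs where xs: "e = Rel xs" by auto
    define d where "d y = (if y = y0 then f e else 0) - comb (*) (\<lambda>g. coord (\<psi> g) y) xs" for y
    have "(\<Sum>y\<in>Y. (if y = y0 then f e else 0) *s y) = (\<Sum>y\<in>Y. if y = y0 then f e *s y else 0)"
      by (intro sum.cong) auto
    then have "(\<Sum>y\<in>Y. d y *s y) = f e *s y0 - (\<Sum>y\<in>Y. comb (*) (\<lambda>g. coord (\<psi> g) y) xs *s y)"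
      using y0 finite_Y by (simp add: d_def scale_left_diff_distrib sum_subtractf)
    also have "(\<Sum>y\<in>Y. comb (*) (\<lambda>g. coord (\<psi> g) y) xs *s y) = \<Phi> e"
      using comb_coord[of \<psi> xs] \<psi>[OF e[unfolded xs]] unfolding xs by (simp only: comb_sum comb_scale_left)
    also have "f e *s y0 - \<Phi> e = (\<Sum>z\<in>Z. h z e *s z)" by (simp add: \<Phi>_def)
    also have "\<dots> \<in> mM" by (intro subspace_sum[OF subspace_mM] subspace_scale[OF subspace_mM] Z_sub)
    finally have "d y0 \<in> \<mm>" using indepD[OF indep_Y, of d] y0 by blast
    then show "f e - codiff (*) (\<lambda>g. coord (\<psi> g) y0) e \<in> \<mm>" by (simp add: d_def xs)
  qed
qed

text \<open>\<open>Ext\<^sup>1(M, R/\<mm>)\<close> is \<open>Hom(U, R/\<mm>)\<close>, since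
  \<open>U \<subseteq> \<mm> F\<close> makes coboundaries vanish modulo \<open>\<mm>\<close> at
  \<open>Rel (combo u)\<close>. The coordinate at \<open>i0\<close>, pulled back along
  \<open>rel_vec\<close>, is a cocycle with value \<open>1\<close> modulo \<open>\<mm>\<close> at
  \<open>u i0\<close>.\<close>

lemma basis_empty_if_Ext_residue:
  assumes zero: "ZZ (Suc 0) \<subseteq> BB (Suc 0)" and B: "vec.basis U mU P u" and P: "finite P"
  shows "P = {}"
proof (rule ccontr)
  assume "P \<noteq> {}"
  then obtain i0 where i0: "i0 \<in> P" by blast
  note S = vec.subspace_ideal_mult[of \<mm> U]
  have ind: "r i \<in> \<mm>" if "(\<Sum>i\<in>P. vscale (r i) (u i)) \<in> mU" "i \<in> P" for r i
    using B that vec.indepD[of mU P u r i] unfolding vec.basis_def by blast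
  have "\<forall>v\<in>U. \<exists>c. v - (\<Sum>i\<in>P. vscale (c i) (u i)) \<in> mU"
    using B unfolding vec.basis_def vec.spans_def by blast
  from bchoice[OF this] obtain c where c: "\<And>v. v \<in> U \<Longrightarrow> v - (\<Sum>i\<in>P. vscale (c v i) (u i)) \<in> mU" by blast
  have "(\<lambda>g. c (rel_vec g) i0) \<in> ZZ (Suc 0)"
    unfolding ZZ_def
  proof (intro CollectI allI impI)
    fix ys assume ys: "Rel ys \<in> gens scale (Suc (Suc 0))"
    have "comb vscale (\<lambda>g. rel_vec g - (\<Sum>i\<in>P. vscale (c (rel_vec g) i) (u i))) ys \<in> mU"
    proof (rule vec.comb_in_subspace[OF S])
      fix g assume "g \<in> snd ` set ys"
      then have "g \<in> gens scale (Suc 0)" using ys by (subst (asm) gens.simps(2)) blast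
      then show "rel_vec g - (\<Sum>i\<in>P. vscale (c (rel_vec g) i) (u i)) \<in> mU" by (intro c rel_vec_in)
    qed
    then have "- (0 - (\<Sum>i\<in>P. vscale (comb (*) (\<lambda>g. c (rel_vec g) i) ys) (u i))) \<in> mU"
      unfolding vec.comb_diff vec.comb_sum vec.comb_scale_left comb_rel_vec[OF ys]
      by (rule vec.subspace_neg[OF S])
    then have "(\<Sum>i\<in>P. vscale (comb (*) (\<lambda>g. c (rel_vec g) i) ys) (u i)) \<in> mU"
      by (simp only: diff_0 minus_minus)
    from ind[OF this i0] show "comb (*) (\<lambda>g. c (rel_vec g) i0) ys \<in> \<mm>" .
  qed
  then obtain h where h: "\<And>g. g \<in> gens scale (Suc 0) \<Longrightarrow> c (rel_vec g) i0 - codiff (*) h g \<in> \<mm>"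
    using zero unfolding BB_def by blast
  have u: "u i0 \<in> U" using B i0 by (simp add: vec.basis_def)
  have "(\<Sum>y\<in>Y. u i0 y * h (Elem y)) \<in> \<mm>"
    using u U_le by (intro sum_in mult_in') (auto simp: FF_def)
  then have "c (u i0) i0 \<in> \<mm>"
    using h[OF combo_in_gens[OF u]] add_in unfolding rel_vec_combo[OF u] codiff_Rel comb_combo
    by fastforce
  moreover have "(if i0 = i0 then 1 else 0) - c (u i0) i0 \<in> \<mm>"
  proof (rule ind[of "\<lambda>i. (if i = i0 then 1 else 0) - c (u i0) i" i0])
    have "(\<Sum>i\<in>P. vscale (if i = i0 then 1 else 0) (u i)) = (\<Sum>i\<in>P. if i = i0 then u i else 0)"
    proof (intro sum.cong refl)
      fix j show "vscale (if j = i0 then 1 else 0) (u j) = (if j = i0 then u j else 0)"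
        by (cases "j = i0") (simp_all only: simp_thms if_True if_False vec.scale_one vec.scale_zero_left)
    qed
    also have "\<dots> = u i0" using i0 P by (simp only: sum.delta if_True)
    finally show "(\<Sum>i\<in>P. vscale ((if i = i0 then 1 else 0) - c (u i0) i) (u i)) \<in> mU"
      using c[OF u] by (simp only: vec.scale_left_diff_distrib sum_subtractf)
  qed (rule i0)
  ultimately show False using one_notin add_in by fastforce
qed

text \<open>The dimension in degree \<open>i\<close> is at most \<open>card Y - i\<close>, so it is
  \<open>0\<close> in degree \<open>card Y\<close>; \<open>Ext_residue_back\<close> carries the
  vanishing down to degree \<open>1\<close>.\<close>

lemma free_if_socle_gt:
  assumes ex: "\<And>i. 0 < i \<Longrightarrow> i \<le> card Y \<Longrightarrow> exact_at scale scale i" and less: "card Y < card Z"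
  shows "free_module scale"
proof (cases "Y = {}")
  case False
  then obtain y0 where y0: "y0 \<in> Y" by blast
  have "\<exists>n f. n \<le> card Y - i \<and> coch.spans (ZZ i) (BB i) {..<n::nat} f" if "i \<le> card Y" for i
    using that
  proof (induction i)
    case 0
    then show ?case using Ext_residue_0 by (simp only: diff_zero)
  next
    case (Suc i)
    from Suc.IH[OF Suc_leD[OF Suc.prems]] obtain n f
      where n: "n \<le> card Y - i" and f: "coch.spans (ZZ i) (BB i) {..<n::nat} f" by blast
    show ?case
      by (rule Ext_residue_decreasing[OF ex less _ f]) (use Suc.prems n in auto)
  qed
  then obtain f where "coch.spans (ZZ (card Y)) (BB (card Y)) {..<0::nat} f" by fastforce
  then have top: "ZZ (card Y) \<subseteq> BB (card Y)" by (simp add: coch.spans_def subset_iff)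
  have "Suc 0 \<le> card Y" using y0 finite_Y by (auto simp: Suc_le_eq card_gt_0_iff)
  then have "ZZ (Suc 0) \<subseteq> BB (Suc 0)"
  proof (rule inc_induct[where P = "\<lambda>n. ZZ n \<subseteq> BB n"])
    show "ZZ (card Y) \<subseteq> BB (card Y)" by (rule top)
  next
    fix n assume n: "Suc 0 \<le> n" "n < card Y" and IH: "ZZ (Suc n) \<subseteq> BB (Suc n)"
    obtain i where i: "n = Suc i" using n(1) by (cases n) auto
    show "ZZ n \<subseteq> BB n"
      unfolding i by (rule Ext_residue_back[OF ex IH[unfolded i] y0]) (use n i in simp_all)
  qed
  moreover obtain P :: "(nat + nat) set" and u where "finite P" "vec.basis U mU P u"
    by (rule presentation_bases)
  ultimately show ?thesis using basis_empty_if_Ext_residue free_if_basis_empty by blast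
qed (rule free_if_Y_empty)

end

section \<open>Choice of minimal generators and the two cases\<close>

theorem theorem4p2:
  fixes \<mm> :: "'a::comm_ring_1 set"
    and s :: "'a \<Rightarrow> 'b::ab_group_add \<Rightarrow> 'b"
  assumes "artinian_local_ring \<mm>"
    and "module s"
    and "finitely_generated s UNIV"
    and "ideal_mult s (ideal_mult (*) \<mm> \<mm>) UNIV = {0}"
    and "\<And>i. 0 < i \<Longrightarrow>
        i \<le> Max {3, min_gens s UNIV, min_gens s (ideal_mult s \<mm> UNIV)} \<Longrightarrow>
        Ext_zero i s (module_prod.scale s (*))"
  shows "free_module s"
proof -
  interpret M: artinian_local_module \<mm> s
    using assms(1,2) by (rule artinian_local_module.intro)
  obtain Y where Y: "finite Y" "M.span Y = UNIV" "card Y = min_gens s UNIV"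
    "M.indep (ideal_mult s \<mm> UNIV) Y (\<lambda>y. y)"
    using M.minimal_generators[of UNIV] assms(3) unfolding finitely_generated_def by blast
  interpret syzygy \<mm> s Y
    using Y assms(4) by unfold_locales
  interpret ring: local_module \<mm> "(*)" by (rule M.local_module_ring)
  obtain e :: nat and x where x: "ring.basis \<mm> m2 {..<e} x"
    using M.finite_basis_ideals[OF ideal_mult_ring, of \<mm> \<mm> \<mm>] in_ideal_mult_ring
    unfolding ring.kills_def by blast
  \<comment> \<open>Products of a basis of \<open>\<mm> / m2\<close> with \<open>Y\<close> generate
    \<open>mM\<close>, because \<open>m2\<close> kills \<open>M\<close>; so \<open>mM\<close> is
    finitely generated and has a minimal generating set.\<close>
  define G where "G = (\<lambda>(k, y). s (x k) y) ` ({..<e} \<times> Y)"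
  have "M.span G = mM"
  proof
    show "M.span G \<subseteq> mM"
      using x by (intro M.span_minimal subspace_mM) (auto simp: G_def ring.basis_def intro!: M.in_ideal_mult)
    show "mM \<subseteq> M.span G"
    proof (rule M.ideal_mult_minimal)
      fix a v assume a: "a \<in> \<mm>"
      obtain d where d: "a - (\<Sum>k<e. d k * x k) \<in> m2"
        using x a unfolding ring.basis_def by (blast elim: ring.spansE)
      have "s (a - (\<Sum>k<e. d k * x k)) v = 0" by (rule m2_scale[OF d])
      then have "s a v = (\<Sum>k<e. s (d k) (s (x k) (ev (coord v))))"
        by (simp add: M.scale_left_diff_distrib M.scale_sum_left ev_coord)
      also have "\<dots> = (\<Sum>k<e. \<Sum>y\<in>Y. s (d k * coord v y) (s (x k) y))"
        by (simp add: ev_def M.scale_sum_right mult.commute mult.left_commute)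
      also have "\<dots> \<in> M.span G"
        by (intro M.span_sum M.span_scale M.span_base) (auto simp: G_def)
      finally show "s a v \<in> M.span G" .
    qed simp
  qed
  moreover have "finite G" using Y(1) by (simp add: G_def)
  ultimately obtain Z where Z: "finite Z" "M.span Z = mM" "card Z = min_gens s mM"
    "M.indep (ideal_mult s \<mm> mM) Z (\<lambda>z. z)"
    using M.minimal_generators[of mM] by blast
  have "ideal_mult s \<mm> mM \<subseteq> {0}"
    by (rule M.ideal_mult_minimal) (auto simp: m_mM)
  then have "ideal_mult s \<mm> mM = {0}"
    using M.subspace_0[OF M.subspace_ideal_mult] by blast
  then interpret syzygy_socle \<mm> s Y Z
    using Z by unfold_locales simp_all
  \<comment> \<open>The entry \<open>3\<close> of the maximum provides degree \<open>1\<close>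
    whatever \<open>card Y\<close> is.\<close>
  have zero: "Ext_zero i s (module_prod.scale s (*))" if "0 < i" "i \<le> 1 \<or> i \<le> card Y" for i
    using assms(5)[OF that(1)] that(2) Y(3) by (auto simp: le_max_iff_disj)
  have exM: "exact_at s s i" if "0 < i" "i \<le> 1 \<or> i \<le> card Y" for i
    using Ext_zero_prod_imp_exact_at(1)[OF assms(2,2) module_mult, of "i - 1"] zero[OF that] that(1) by simp
  have exR: "exact_at s (*) (Suc 0)"
    using Ext_zero_prod_imp_exact_at(2)[OF assms(2,2) module_mult, of 0] zero[of 1] by simp
  show ?thesis
  proof (cases "card Z \<le> card Y")
    case True
    then show ?thesis using free_if_socle_le exM[of "Suc 0"] exR by simp
  next
    case False
    then show ?thesis using free_if_socle_gt exM by simp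
  qed
qed

end
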